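(* Let $M$ be a compact orientable smooth manifold of finite dimension $d$, let $f:M\to M$ be a $C^1$-diffeomorphism, and let $\mu$ be an $f$-invariant Borel probability measure on $M$. Then for every smooth volume form $\omega$ on $M$, the function $$\vec{\mathcal{S}}_{f,\mu}:\mathcal{M}_\omega\to\mathfrak{a}^+,\qquad \vec{\mathcal{S}}_{f,\mu}(g)=\int_M\vec{\sigma}^g(\mathrm{d}f_x)\,\mathrm{d}\mu(x),$$ is continuous and geodesically cone-convex, i.e. for every geodesic segment $[0,1]\ni t\mapsto g^t\in\mathcal{M}_\omega$ of the $L^2$-metric on $\mathcal{M}_\omega$, $$\vec{\mathcal{S}}_{f,\mu}(g^t)\preceq(1-t)\,\vec{\mathcal{S}}_{f,\mu}(g^0)+t\,\vec{\mathcal{S}}_{f,\mu}(g^1)\quad\text{for all }t\in[0,1].$$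
   Context: $\mathcal{M}$ is the set of all $C^\infty$ Riemannian metrics on $M$, an open subset of the Fréchet space $\mathcal{S}^0_2M$ of smooth symmetric $(0,2)$-tensor fields with the $C^\infty$-topology. $\mathcal{M}_\omega\subset\mathcal{M}$ is the submanifold (with the inherited topology) of metrics inducing the volume form $\omega$ (with the orientation given by $\omega$); its tangent space at $g$ is $T_g\mathcal{M}_\omega=\{h\in\mathcal{S}^0_2M:\operatorname{tr}(g_x^{-1}h_x)=0\ \forall x\in M\}$. The $L^2$-metric on $\mathcal{M}$ is $\langle h,k\rangle_g=\int_M\operatorname{tr}(g_x^{-1}h_xg_x^{-1}k_x)\,\mathrm{d}\omega_g(x)$, where $\omega_g$ is the volume form of $g$ and local matrix representations are used; $\mathcal{M}_\omega$ carries the restricted metric. It is known (Freed–Groisser) that $\mathcal{M}_\omega$ is geodesically complete and that its geodesic starting at $g^0$ with initial tangent $h\in T_{g^0}\mathcal{M}_\omega$ is given pointwise by $g^t_x=g^0_x\exp\bigl(t(g^0_x)^{-1}h_x\bigr)$, in local matrix representations. $\mathfrak{a}^+=\{\xi\in\mathbb{R}^d:\xi_1\ge\dots\ge\xi_d\}$; for $\xi,\eta\in\mathfrak{a}^+$, $\xi\preceq\eta$ means $\xi_1+\dots+\xi_k\le\eta_1+\dots+\eta_k$ for $k=1,\dots,d-1$, with equality for $k=d$. $\vec{\sigma}^g(\mathrm{d}f_x)=(\log\alpha_1^g(\mathrm{d}f_x),\dots,\log\alpha_d^g(\mathrm{d}f_x))$, where $\alpha_1^g(\mathrm{d}f_x)\ge\dots\ge\alpha_d^g(\mathrm{d}f_x)>0$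 are the singular values of $\mathrm{d}f_x:(T_xM,g_x)\to(T_{fx}M,g_{fx})$. *)

theory Defs
  imports "HOL-Probability.Probability"
begin

section \<open>Differentiability classes in Euclidean spaces\<close>

primrec iter_deriv :: "'a::euclidean_space list \<Rightarrow> ('a \<Rightarrow> 'b::real_normed_vector) \<Rightarrow> 'a \<Rightarrow> 'b" where
  "iter_deriv [] F = F"
| "iter_deriv (v # vs) F = (\<lambda>x. frechet_derivative (iter_deriv vs F) (at x) v)"

text \<open>Only meant for open \<open>S\<close>, since the derivatives are two-sided.\<close>

definition Ck_on :: "nat \<Rightarrow> 'a::euclidean_space set \<Rightarrow> ('a \<Rightarrow> 'b::real_normed_vector) \<Rightarrow> bool" where
  "Ck_on k S F \<longleftrightarrow>
     (\<forall>vs. length vs < k \<longrightarrow> (\<forall>x\<in>S. iter_deriv vs F differentiable (at x))) \<and>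
     (\<forall>vs. length vs \<le> k \<longrightarrow> continuous_on S (iter_deriv vs F))"

text \<open>For sets that need not be open, such as \<open>[0,1] \<times> V\<close> with \<open>V\<close> open, smooth means:
  restriction of a \<open>C\<^sup>\<infinity>\<close> function on an open set.\<close>

definition smooth_on :: "'a::euclidean_space set \<Rightarrow> ('a \<Rightarrow> 'b::real_normed_vector) \<Rightarrow> bool" where
  "smooth_on S F \<longleftrightarrow>
     (\<exists>T H. open T \<and> S \<subseteq> T \<and> (\<forall>k. Ck_on k T H) \<and> (\<forall>x\<in>S. H x = F x))"

section \<open>Smooth manifolds\<close>

text \<open>The manifold is the whole type \<open>'m\<close>, with a smooth structure given by an atlas. A chart is
  a pair of its domain and its coordinate map; the latter is only meaningful on the domain.
  The dimension is the cardinality of \<open>'n\<close>.\<close>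

type_synonym ('m, 'n) chart = "'m set \<times> ('m \<Rightarrow> real ^ 'n)"

abbreviation cdom :: "('m, 'n) chart \<Rightarrow> 'm set" where
  "cdom c \<equiv> fst c"

abbreviation coord :: "('m, 'n) chart \<Rightarrow> 'm \<Rightarrow> real ^ 'n" where
  "coord c \<equiv> snd c"

definition cimg :: "('m, 'n) chart \<Rightarrow> (real ^ 'n) set" where
  "cimg c = coord c ` cdom c"

definition cinv :: "('m, 'n) chart \<Rightarrow> real ^ 'n \<Rightarrow> 'm" where
  "cinv c = inv_into (cdom c) (coord c)"

definition smooth_atlas :: "('m::topological_space, 'n::finite) chart set \<Rightarrow> bool" where
  "smooth_atlas A \<longleftrightarrow>
     (\<Union>c\<in>A. cdom c) = UNIV \<and>
     (\<forall>c\<in>A. open (cdom c) \<and> open (cimg c) \<and>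
        homeomorphism (cdom c) (cimg c) (coord c) (cinv c)) \<and>
     (\<forall>c\<in>A. \<forall>d\<in>A. smooth_on (coord c ` (cdom c \<inter> cdom d)) (coord d \<circ> cinv c))"

text \<open>The matrix of \<open>dF\<^sub>x\<close> in the coordinates \<open>c\<close> at \<open>x\<close> and \<open>d\<close> at \<open>F x\<close>. For
  \<open>F = (\<lambda>x. x)\<close> this is the Jacobian matrix of the change of coordinates from \<open>c\<close> to \<open>d\<close>.\<close>

definition local_deriv ::
  "('m, 'n::finite) chart \<Rightarrow> ('m, 'n) chart \<Rightarrow> ('m \<Rightarrow> 'm) \<Rightarrow> 'm \<Rightarrow> real ^ 'n ^ 'n" where
  "local_deriv c d F x = matrix (frechet_derivative (coord d \<circ> F \<circ> cinv c) (at (coord c x)))"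

definition orientable :: "('m::topological_space, 'n::finite) chart set \<Rightarrow> bool" where
  "orientable A \<longleftrightarrow>
     (\<exists>B. smooth_atlas B \<and> smooth_atlas (A \<union> B) \<and>
        (\<forall>c\<in>B. \<forall>d\<in>B. \<forall>x \<in> cdom c \<inter> cdom d. det (local_deriv c d (\<lambda>x. x) x) > 0))"

definition C1_map ::
  "('m::topological_space, 'n::finite) chart set \<Rightarrow> ('m \<Rightarrow> 'm) \<Rightarrow> bool" where
  "C1_map A F \<longleftrightarrow> continuous_on UNIV F \<and>
     (\<forall>c\<in>A. \<forall>d\<in>A. Ck_on 1 (coord c ` (cdom c \<inter> F -` cdom d)) (coord d \<circ> F \<circ> cinv c))"

definition C1_diffeo ::
  "('m::topological_space, 'n::finite) chart set \<Rightarrow> ('m \<Rightarrow> 'm) \<Rightarrow> bool" where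
  "C1_diffeo A F \<longleftrightarrow> bij F \<and> C1_map A F \<and> C1_map A (inv F)"

text \<open>An arbitrary chart around \<open>x\<close>. It is only used to evaluate quantities that do not depend
  on the choice of coordinates.\<close>

definition chart_at :: "('m, 'n) chart set \<Rightarrow> 'm \<Rightarrow> ('m, 'n) chart" where
  "chart_at A x = (SOME c. c \<in> A \<and> x \<in> cdom c)"

section \<open>Tensor fields, metrics and volume forms\<close>

text \<open>A (0,2)-tensor field \<open>h\<close> is given by its local matrix representations \<open>h c x\<close> for charts
  \<open>c\<close> of the atlas and \<open>x\<close> in the domain of \<open>c\<close>, related by the transformation law of
  covariant tensors. Elsewhere \<open>h c x = 0\<close>, so that a field has exactly one representing
  family.\<close>

type_synonym ('m, 'n) tensor2 = "('m, 'n) chart \<Rightarrow> 'm \<Rightarrow> real ^ 'n ^ 'n"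

definition sym_tensors :: "('m::topological_space, 'n::finite) chart set \<Rightarrow> ('m, 'n) tensor2 set" where
  "sym_tensors A = {h.
     (\<forall>c x. c \<notin> A \<or> x \<notin> cdom c \<longrightarrow> h c x = 0) \<and>
     (\<forall>c\<in>A. \<forall>x\<in>cdom c. transpose (h c x) = h c x) \<and>
     (\<forall>c\<in>A. \<forall>d\<in>A. \<forall>x \<in> cdom c \<inter> cdom d.
        h c x = transpose (local_deriv c d (\<lambda>x. x) x) ** h d x ** local_deriv c d (\<lambda>x. x) x) \<and>
     (\<forall>c\<in>A. smooth_on (cimg c) (\<lambda>y. h c (cinv c y)))}"

definition metrics :: "('m::topological_space, 'n::finite) chart set \<Rightarrow> ('m, 'n) tensor2 set" where
  "metrics A = {g \<in> sym_tensors A.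
     \<forall>c\<in>A. \<forall>x\<in>cdom c. \<forall>v. v \<noteq> 0 \<longrightarrow> v \<bullet> (g c x *v v) > 0}"

text \<open>\<open>w c x\<close> is the coefficient of \<open>dy\<^sub>1 \<and> \<dots> \<and> dy\<^sub>d\<close> in the coordinates \<open>y\<close> given by \<open>c\<close>.
  The wedge product is taken in the order of the index type.\<close>

definition volume_form ::
  "('m::topological_space, 'n::finite) chart set \<Rightarrow> (('m, 'n) chart \<Rightarrow> 'm \<Rightarrow> real) \<Rightarrow> bool" where
  "volume_form A w \<longleftrightarrow>
     (\<forall>c\<in>A. \<forall>x\<in>cdom c. w c x \<noteq> 0) \<and>
     (\<forall>c\<in>A. \<forall>d\<in>A. \<forall>x \<in> cdom c \<inter> cdom d.
        w c x = det (local_deriv c d (\<lambda>x. x) x) * w d x) \<and>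
     (\<forall>c\<in>A. smooth_on (cimg c) (\<lambda>y. w c (cinv c y)))"

text \<open>The volume form of a metric for the orientation given by \<open>w\<close>, and the space
  \<open>\<M>\<^sub>\<omega>\<close>.\<close>

definition metric_volume_form ::
  "(('m, 'n::finite) chart \<Rightarrow> 'm \<Rightarrow> real) \<Rightarrow> ('m, 'n) tensor2 \<Rightarrow> ('m, 'n) chart \<Rightarrow> 'm \<Rightarrow> real" where
  "metric_volume_form w g c x = sgn (w c x) * sqrt (det (g c x))"

definition metrics_vol ::
  "('m::topological_space, 'n::finite) chart set \<Rightarrow> (('m, 'n) chart \<Rightarrow> 'm \<Rightarrow> real) \<Rightarrow>
   ('m, 'n) tensor2 set" where
  "metrics_vol A w =
     {g \<in> metrics A. \<forall>c\<in>A. \<forall>x\<in>cdom c. metric_volume_form w g c x = w c x}"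

text \<open>The \<open>C\<^sup>\<infinity>\<close>-topology: uniform convergence, on compact subsets of charts, of all
  derivatives of the local representations.\<close>

definition Cinf_topology ::
  "('m::topological_space, 'n::finite) chart set \<Rightarrow> ('m, 'n) tensor2 topology" where
  "Cinf_topology A = topology_generated_by
     {{h \<in> sym_tensors A. \<forall>y\<in>K.
         norm (iter_deriv vs (\<lambda>y. h c (cinv c y) - h0 c (cinv c y)) y) < e} | h0 c K vs e.
        h0 \<in> sym_tensors A \<and> c \<in> A \<and> compact K \<and> K \<subseteq> cimg c \<and> (e::real) > 0}"

section \<open>The \<open>L\<^sup>2\<close>-metric and its geodesics\<close>

text \<open>The Borel measure on the manifold whose local densities are \<open>\<bar>\<rho> c\<bar>\<close>; integration of
  functions against a volume form \<open>\<rho>\<close>, with the orientation it induces, is integration against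
  this measure.\<close>

definition volume_measure ::
  "('m::topological_space, 'n::finite) chart set \<Rightarrow> (('m, 'n) chart \<Rightarrow> 'm \<Rightarrow> real) \<Rightarrow> 'm measure" where
  "volume_measure A \<rho> = (THE \<nu>. sets \<nu> = sets borel \<and>
     (\<forall>c\<in>A. \<forall>B\<in>sets borel. B \<subseteq> cdom c \<longrightarrow>
        emeasure \<nu> B =
          (\<integral>\<^sup>+ y. ennreal \<bar>\<rho> c (cinv c y)\<bar> * indicator (coord c ` B) y \<partial>lborel)))"

definition L2_metric ::
  "('m::topological_space, 'n::finite) chart set \<Rightarrow>
   ('m, 'n) tensor2 \<Rightarrow> ('m, 'n) tensor2 \<Rightarrow> ('m, 'n) tensor2 \<Rightarrow> real" where
  "L2_metric A g h k =
     (\<integral>x. (let c = chart_at A x in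
             trace (matrix_inv (g c x) ** h c x ** matrix_inv (g c x) ** k c x))
        \<partial>volume_measure A (\<lambda>c x. sqrt (det (g c x))))"

text \<open>Smoothness of a family of tensor fields with parameters in \<open>P\<close> is joint smoothness in the
  parameter and the point, which is the same as smoothness of the map from \<open>P\<close> to the Frechet
  space of tensor fields.\<close>

definition smooth_family ::
  "('m, 'n::finite) chart set \<Rightarrow> 'p::euclidean_space set \<Rightarrow> ('p \<Rightarrow> ('m, 'n) tensor2) \<Rightarrow> bool" where
  "smooth_family A P G \<longleftrightarrow> (\<forall>c\<in>A. smooth_on (P \<times> cimg c) (\<lambda>(p, y). G p c (cinv c y)))"

definition velocity :: "(real \<Rightarrow> ('m, 'n::finite) tensor2) \<Rightarrow> real \<Rightarrow> ('m, 'n) tensor2" where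
  "velocity g t c x = vector_derivative (\<lambda>s. g s c x) (at t within {0..1})"

definition energy ::
  "('m::topological_space, 'n::finite) chart set \<Rightarrow> (real \<Rightarrow> ('m, 'n) tensor2) \<Rightarrow> real" where
  "energy A g = (1/2) * integral {0..1} (\<lambda>t. L2_metric A (g t) (velocity g t) (velocity g t))"

definition smooth_path_in ::
  "('m::topological_space, 'n::finite) chart set \<Rightarrow> (('m, 'n) chart \<Rightarrow> 'm \<Rightarrow> real) \<Rightarrow>
   (real \<Rightarrow> ('m, 'n) tensor2) \<Rightarrow> bool" where
  "smooth_path_in A w g \<longleftrightarrow> (\<forall>t\<in>{0..1}. g t \<in> metrics_vol A w) \<and> smooth_family A {0..1} g"

definition proper_variation ::
  "('m::topological_space, 'n::finite) chart set \<Rightarrow> (('m, 'n) chart \<Rightarrow> 'm \<Rightarrow> real) \<Rightarrow>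
   (real \<Rightarrow> ('m, 'n) tensor2) \<Rightarrow> (real \<Rightarrow> real \<Rightarrow> ('m, 'n) tensor2) \<Rightarrow> bool" where
  "proper_variation A w g G \<longleftrightarrow>
     (\<forall>t\<in>{0..1}. G 0 t = g t) \<and>
     (\<exists>e>0. (\<forall>s\<in>{-e<..<e}. G s 0 = g 0 \<and> G s 1 = g 1 \<and> (\<forall>t\<in>{0..1}. G s t \<in> metrics_vol A w)) \<and>
        smooth_family A ({-e<..<e} \<times> {0..1}) (\<lambda>(s, t). G s t))"

text \<open>Geodesics of a (weak) Riemannian metric are the critical points of its energy functional
  among curves with fixed end points. Only the values of \<open>g\<close> on \<open>[0,1]\<close> matter.\<close>

definition geodesic_segment ::
  "('m::topological_space, 'n::finite) chart set \<Rightarrow> (('m, 'n) chart \<Rightarrow> 'm \<Rightarrow> real) \<Rightarrow>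
   (real \<Rightarrow> ('m, 'n) tensor2) \<Rightarrow> bool" where
  "geodesic_segment A w g \<longleftrightarrow> smooth_path_in A w g \<and>
     (\<forall>G. proper_variation A w g G \<longrightarrow> ((\<lambda>s. energy A (G s)) has_real_derivative 0) (at 0))"

section \<open>Majorization and singular values\<close>

text \<open>Coordinates of vectors are indexed by a finite linearly ordered type, whose least element
  plays the role of the index 1 and whose greatest element that of \<open>d\<close>.\<close>

text \<open>The syntax \<open>real ^ 'n\<close> would fix the sort of \<open>'n\<close> to be \<open>finite\<close>.\<close>

type_synonym 'n rvec = "(real, 'n) vec"
type_synonym 'n sqmat = "((real, 'n) vec, 'n) vec"

definition a_plus :: "(real ^ 'n::{finite,linorder}) set" where
  "a_plus = {\<xi>. \<forall>i j. i \<le> j \<longrightarrow> \<xi> $ j \<le> \<xi> $ i}"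

definition majorized :: "('n::{finite,linorder}) rvec \<Rightarrow> 'n rvec \<Rightarrow> bool" (infix "\<preceq>" 50) where
  "\<xi> \<preceq> \<eta> \<longleftrightarrow> \<xi> \<in> a_plus \<and> \<eta> \<in> a_plus \<and>
     (\<forall>k. (\<Sum>i\<in>{..k}. \<xi> $ i) \<le> (\<Sum>i\<in>{..k}. \<eta> $ i)) \<and>
     (\<Sum>i\<in>UNIV. \<xi> $ i) = (\<Sum>i\<in>UNIV. \<eta> $ i)"

text \<open>The singular values of \<open>L\<close> from \<open>\<real>\<^sup>d\<close> with inner product \<open>G\<close> to \<open>\<real>\<^sup>d\<close> with inner
  product \<open>H\<close>: the square roots of the eigenvalues, with multiplicity and in decreasing order, of
  \<open>L\<^sup>* L\<close>, where the adjoint \<open>L\<^sup>*\<close> is given by the matrix \<open>G\<^sup>-\<^sup>1 L\<^sup>T H\<close>.\<close>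

definition is_singular_values ::
  "('n::{finite,linorder}) sqmat \<Rightarrow> 'n sqmat \<Rightarrow> 'n sqmat \<Rightarrow> 'n rvec \<Rightarrow> bool" where
  "is_singular_values G H L \<alpha> \<longleftrightarrow>
     (\<forall>i. \<alpha> $ i \<ge> 0) \<and> (\<forall>i j. i \<le> j \<longrightarrow> \<alpha> $ j \<le> \<alpha> $ i) \<and>
     (\<exists>u. (\<forall>i j. u i \<bullet> (G *v u j) = (if i = j then 1 else 0)) \<and>
          (\<forall>i. (matrix_inv G ** transpose L ** H ** L) *v u i = (\<alpha> $ i)\<^sup>2 *\<^sub>R u i))"

definition singular_values ::
  "('n::{finite,linorder}) sqmat \<Rightarrow> 'n sqmat \<Rightarrow> 'n sqmat \<Rightarrow> 'n rvec" where
  "singular_values G H L = (THE \<alpha>. is_singular_values G H L \<alpha>)"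

definition sigma_vec ::
  "('m, 'n::{finite,linorder}) chart set \<Rightarrow> ('m, 'n) tensor2 \<Rightarrow> ('m \<Rightarrow> 'm) \<Rightarrow> 'm \<Rightarrow> 'n rvec" where
  "sigma_vec A g f x =
     (let c = chart_at A x; d = chart_at A (f x) in
        \<chi> i. ln (singular_values (g c x) (g d (f x)) (local_deriv c d f x) $ i))"

definition S_vec ::
  "('m, 'n::{finite,linorder}) chart set \<Rightarrow> ('m \<Rightarrow> 'm) \<Rightarrow> 'm measure \<Rightarrow> ('m, 'n) tensor2 \<Rightarrow> 'n rvec" where
  "S_vec A f \<mu> g = (\<integral>x. sigma_vec A g f x \<partial>\<mu>)"

end

theory Submission
  imports Defs
begin

text \<open>Every geodesic of \<open>\<M>\<^sub>\<omega>\<close> is pointwise a geodesic of the symmetric space of positive definite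
  matrices. Let \<open>g\<close> be a critical point of the energy and \<open>X = g\<^sup>-\<^sup>1 g'\<close>. For a nilpotent field of endomorphisms
  \<open>Y\<close> supported in one chart, the variation \<open>(1 + s\<phi>Y)\<^sup>T g (1 + s\<phi>Y)\<close> keeps the volume form, and its energy is a
  quadratic polynomial in \<open>s\<close> with linear coefficient proportional to \<open>\<integral>\<phi>' \<integral>\<^sub>M tr (X Y)\<close>. By the lemma of du
  Bois-Reymond \<open>\<integral>\<^sub>M tr (X Y)\<close> does not depend on \<open>t\<close>; localising and using \<open>tr X = 0\<close>, neither does \<open>X\<close>. Hence
  \<open>g\<^sub>m g\<^sub>m\<^sub>-\<^sub>k\<^sup>-\<^sup>1 g\<^sub>m = g\<^sub>m\<^sub>+\<^sub>k\<close>, that is, \<open>g\<^sub>m\<close> is the geometric mean of \<open>g\<^sub>m\<^sub>-\<^sub>k\<close> and \<open>g\<^sub>m\<^sub>+\<^sub>k\<close>, and the same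
  holds for the pullbacks under \<open>f\<close>.

  The Cauchy-Schwarz inequality for principal minors shows that the product of the \<open>k\<close> largest
  eigenvalues of a form relative to a metric is midpoint log-convex along geometric means. With
  continuity in \<open>t\<close> this is convexity of the partial sums of the logarithmic singular values at every
  point of \<open>M\<close>; integrate. The sum of all of them depends only on the volume form. Continuity
  in \<open>g\<close> holds because \<open>C\<^sup>0\<close>-close metrics on a compact manifold are uniformly comparable.\<close>

section \<open>Minors of positive definite matrices\<close>

text \<open>Geodesics are known here only as critical points of the energy, so their pointwise law
  has to be extracted from variations. Rank-one nilpotent matrices are convenient test directions:
  \<open>mat 1 + s *\<^sub>R N\<close> has determinant exactly 1 and inverse
  \<open>mat 1 - s *\<^sub>R N\<close>, and the traces of a matrix against all such \<open>N\<close>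
  determine it up to a scalar matrix. The squared singular values of the derivative are the
  eigenvalues of the pulled back metric relative to the metric. Hence the linear algebra concerns
  pairs of forms \<open>G\<close>, \<open>K\<close>, and a change of chart is a common congruence.
  Exterior powers would change the size of the matrices; they are replaced by blocks padded with the
  identity, whose determinants are principal minors and whose quadratic forms can be compared
  directly. Volume measure and singular values are definite descriptions, so existence and
  uniqueness are needed for both. For the measure this rests on the change of variables between
  charts and on gluing, for the singular values on the spectral theorem and on the comparison of
  minors with constant 1.\<close>

lemma matrix_inv_mult:
  fixes A :: "real^'n^'n"
  assumes "det A \<noteq> 0"
  shows "A ** matrix_inv A = mat 1" "matrix_inv A ** A = mat 1"
proof -
  have "\<exists>B. A ** B = mat 1 \<and> B ** A = mat 1"
    using assms invertible_det_nz unfolding invertible_def by blast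
  from someI_ex[OF this] show "A ** matrix_inv A = mat 1" "matrix_inv A ** A = mat 1"
    unfolding matrix_inv_def by auto
qed

lemma matrix_add_mult_distrib: "(A + B) ** C = A ** C + B ** C"
  for A :: "real^'n^'m"
  by (simp add: vec_eq_iff matrix_matrix_mult_def sum.distrib distrib_right)

definition pd :: "real^'n^'n \<Rightarrow> bool" where
  "pd G \<longleftrightarrow> transpose G = G \<and> (\<forall>v. v \<noteq> 0 \<longrightarrow> 0 < v \<bullet> (G *v v))"

definition diag :: "('n \<Rightarrow> real) \<Rightarrow> real^'n^'n" where
  "diag l = (\<chi> i j. if i = j then l i else 0)"

lemma transpose_form: "x \<bullet> (transpose A *v y) = (A *v x) \<bullet> y"
  for A :: "real^'n^'m"
  by (metis dot_lmul_matrix transpose_matrix_vector inner_commute)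

lemma sym_form: "transpose G = G \<Longrightarrow> x \<bullet> (G *v y) = y \<bullet> (G *v x)"
  for G :: "real^'n^'n"
  by (metis transpose_form inner_commute)

lemma congruence_form: "x \<bullet> ((transpose A ** B ** C) *v y) = (A *v x) \<bullet> (B *v (C *v y))"
  for A :: "real^'n^'n"
  by (metis transpose_form matrix_vector_mul_assoc)

lemma form_le_zero: "pd G \<Longrightarrow> 0 \<le> v \<bullet> (G *v v)"
  unfolding pd_def by (cases "v = 0") (auto intro: less_imp_le)

lemma matrix_entry_form: "(A :: real^'n^'n) $ i $ j = axis i 1 \<bullet> (A *v axis j 1)"
  by (simp add: matrix_vector_mult_basis inner_axis' column_def)

lemma matrix_eq_form: "A = B \<longleftrightarrow> (\<forall>x y. x \<bullet> ((A :: real^'n^'n) *v y) = x \<bullet> (B *v y))"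
  unfolding matrix_eq by (subst all_comm) (simp only: vector_eq_ldot)

lemma sym_iff_form: "transpose A = A \<longleftrightarrow> (\<forall>x y. x \<bullet> ((A :: real^'n^'n) *v y) = y \<bullet> (A *v x))"
  unfolding matrix_eq_form transpose_form by (simp add: inner_commute eq_commute)

lemma transpose_congruence:
  "transpose G = G \<Longrightarrow> transpose (transpose A ** G ** A) = transpose A ** G ** A"
  for A :: "real^'n^'n"
  by (simp add: matrix_transpose_mul matrix_mul_assoc)

lemma matrix_mult_diag: "((A :: real^'n^'n) ** diag l) $ i $ j = A $ i $ j * l j"
  by (simp add: diag_def matrix_matrix_mult_def if_distrib cong: if_cong)

lemma diag_matrix_mult: "(diag l ** (A :: real^'n^'n)) $ i $ j = l i * A $ i $ j"
  by (simp add: diag_def matrix_matrix_mult_def if_distrib if_distribR cong: if_cong)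

lemma diag_vector_mult: "(diag l *v x) $ i = l i * x $ i"
  by (simp add: diag_def matrix_vector_mult_def if_distrib if_distribR cong: if_cong)

lemma transpose_diag [simp]: "transpose (diag l) = diag l"
  by (auto simp: diag_def transpose_def vec_eq_iff)

lemma det_diag: "det (diag l) = prod l UNIV"
  by (subst det_diagonal) (auto simp: diag_def)

lemma diag_one: "diag (\<lambda>_. 1) = mat 1"
  by (simp add: diag_def mat_def)

lemma diag_mult_diag: "diag l ** diag m = diag (\<lambda>i. l i * m i)"
  by (simp add: vec_eq_iff diag_matrix_mult) (simp add: diag_def)

lemma diag_form: "x \<bullet> (diag l *v y) = (\<Sum>i\<in>UNIV. l i * x $ i * y $ i)"
  by (simp add: inner_vec_def diag_vector_mult mult_ac)

lemma pd_mat_1: "pd (mat 1)"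
  by (simp add: pd_def)

lemma pd_congruence:
  assumes "pd G" "det P \<noteq> 0"
  shows "pd (transpose P ** G ** (P :: real^'n^'n))"
  unfolding pd_def
proof (intro conjI allI impI)
  show "transpose (transpose P ** G ** P) = transpose P ** G ** P"
    using assms by (simp add: transpose_congruence pd_def)
  fix v :: "real^'n" assume "v \<noteq> 0"
  then have "P *v v \<noteq> 0"
    using assms(2) by (metis invertible_det_nz inj_matrix_vector_mult matrix_vector_mult_0_right injD)
  then show "0 < v \<bullet> (transpose P ** G ** P *v v)"
    using assms(1) by (simp add: congruence_form pd_def)
qed

section \<open>Spectral theorem for a symmetric form relative to a positive definite one\<close>

lemma pd_bounds:
  fixes G :: "real^'n^'n"
  assumes "pd G"
  obtains c where "c > 0" "\<And>x. c * (x \<bullet> x) \<le> x \<bullet> (G *v x)"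
proof -
  let ?S = "sphere (0::real^'n) 1"
  \<comment> \<open>The constant is the minimum of the form on the unit sphere; homogeneity extends
    the bound to all vectors.\<close>
  have "\<exists>x\<in>?S. \<forall>y\<in>?S. x \<bullet> (G *v x) \<le> y \<bullet> (G *v y)"
    by (intro continuous_attains_inf) (auto intro!: continuous_intros)
  then obtain x where x: "x \<in> ?S" "\<And>y. y \<in> ?S \<Longrightarrow> x \<bullet> (G *v x) \<le> y \<bullet> (G *v y)" by blast
  define c where "c = x \<bullet> (G *v x)"
  have "x \<noteq> 0" using x(1) by auto
  then have "c > 0" using assms unfolding c_def pd_def by auto
  moreover have "c * (y \<bullet> y) \<le> y \<bullet> (G *v y)" for y
  proof (cases "y = 0")
    case False
    have "c \<le> (y /\<^sub>R norm y) \<bullet> (G *v (y /\<^sub>R norm y))"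
      unfolding c_def using False by (intro x(2)) simp
    also have "\<dots> = (y \<bullet> (G *v y)) / (y \<bullet> y)"
      by (simp add: matrix_vector_mult_scaleR dot_square_norm power2_eq_square divide_simps)
    finally show ?thesis using False by (simp add: field_simps)
  qed simp
  ultimately show thesis using that by blast
qed

text \<open>The first-order condition at a maximum in algebraic form: for small \<open>e\<close>
  with the sign of \<open>a\<close> the linear term would win. The choice of \<open>e\<close> makes
  \<open>2 * a + e * b\<close> keep the sign of \<open>a\<close>, whatever \<open>b\<close>
  is.\<close>

lemma affine_quadratic_le_zero:
  fixes a b :: real
  assumes "\<And>e. 2 * e * a + e\<^sup>2 * b \<le> 0"
  shows "a = 0"
proof (rule ccontr)
  assume a: "a \<noteq> 0"
  define e where "e = a / (\<bar>b\<bar> + 1)"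
  have "e * (2 * a + e * b) \<le> 0" using assms[of e] by (simp add: power2_eq_square algebra_simps)
  moreover have "e * (2 * a + e * b) = (a / (\<bar>b\<bar> + 1))\<^sup>2 * (2 * (\<bar>b\<bar> + 1) + b)"
    unfolding e_def by (simp add: power2_eq_square divide_simps) (simp add: algebra_simps)
  moreover have "0 < (a / (\<bar>b\<bar> + 1))\<^sup>2 * (2 * (\<bar>b\<bar> + 1) + b)"
    using a by (intro mult_pos_pos) (auto simp: zero_less_power2)
  ultimately show False by linarith
qed

text \<open>The Rayleigh quotient of \<open>K\<close> against \<open>G\<close> attains its maximum
  on the \<open>G\<close>-orthogonal complement of the \<open>u i\<close>: the bound on
  \<open>card A\<close> leaves a nonzero vector there, and \<open>pd_bounds\<close> makes the set of
  unit vectors compact.\<close>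

lemma rayleigh_max:
  fixes G K :: "real^'n^'n" and u :: "'n \<Rightarrow> real^'n"
  assumes G: "pd G" and A: "card A < CARD('n)"
  obtains x where "\<forall>i\<in>A. x \<bullet> (G *v u i) = 0" "x \<bullet> (G *v x) = 1"
    "\<And>y. \<forall>i\<in>A. y \<bullet> (G *v u i) = 0 \<Longrightarrow> y \<bullet> (K *v y) \<le> (x \<bullet> (K *v x)) * (y \<bullet> (G *v y))"
proof -
  define V where "V = {x. \<forall>i\<in>A. x \<bullet> (G *v u i) = 0}"
  define S where "S = V \<inter> {x. x \<bullet> (G *v x) = 1}"
  have normalize: "y /\<^sub>R sqrt (y \<bullet> (G *v y)) \<in> S" if "y \<in> V" "y \<noteq> 0" for y
  proof -
    have "0 < y \<bullet> (G *v y)" using G that by (auto simp: pd_def)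
    then have "inverse (sqrt (y \<bullet> (G *v y))) * (inverse (sqrt (y \<bullet> (G *v y))) * (y \<bullet> (G *v y))) = 1"
      by (simp flip: mult.assoc add: real_sqrt_inverse[symmetric])
    then show ?thesis using that
      by (simp add: S_def V_def matrix_vector_mult_scaleR)
  qed
  have "dim ((\<lambda>i. G *v u i) ` A) < DIM(real^'n)"
  proof -
    have "dim ((\<lambda>i. G *v u i) ` A) \<le> card ((\<lambda>i. G *v u i) ` A)" by (intro dim_le_card') simp
    also have "\<dots> \<le> card A" by (intro card_image_le) simp
    finally show ?thesis using A by simp
  qed
  then obtain z where z: "z \<noteq> 0" "\<And>y. y \<in> span ((\<lambda>i. G *v u i) ` A) \<Longrightarrow> orthogonal z y"
    by (rule orthogonal_to_subspace_exists) blast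
  then have "z \<in> V" unfolding V_def orthogonal_def by (auto intro: span_base)
  then have ne: "S \<noteq> {}" using normalize z by blast
  have co: "compact S"
  proof (intro compact_eq_bounded_closed[THEN iffD2] conjI)
    obtain c where c: "c > 0" "\<And>x. c * (x \<bullet> x) \<le> x \<bullet> (G *v x)" using pd_bounds[OF G] by blast
    have "norm x \<le> sqrt (1 / c)" if "x \<in> S" for x
      using c(2)[of x] c(1) that by (auto simp: S_def norm_eq_sqrt_inner field_simps)
    then show "bounded S" by (intro boundedI)
    have "closed (\<Inter>i\<in>A. {x. x \<bullet> (G *v u i) = 0})"
      by (intro closed_INT ballI closed_Collect_eq) (auto intro!: continuous_intros)
    moreover have "closed {x. x \<bullet> (G *v x) = 1}"
      by (intro closed_Collect_eq) (auto intro!: continuous_intros)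
    moreover have "V = (\<Inter>i\<in>A. {x. x \<bullet> (G *v u i) = 0})" by (auto simp: V_def)
    ultimately show "closed S" unfolding S_def by auto
  qed
  have "continuous_on S (\<lambda>y. y \<bullet> (K *v y))" by (intro continuous_intros)
  from continuous_attains_sup[OF co ne this] obtain x where x: "x \<in> S" "\<And>y. y \<in> S \<Longrightarrow> y \<bullet> (K *v y) \<le> x \<bullet> (K *v x)"
    by blast
  show thesis
  proof (rule that)
    fix y assume "\<forall>i\<in>A. y \<bullet> (G *v u i) = 0"
    then have y: "y \<in> V" by (simp add: V_def)
    show "y \<bullet> (K *v y) \<le> (x \<bullet> (K *v x)) * (y \<bullet> (G *v y))"
    proof (cases "y = 0")
      case False
      then have p: "0 < y \<bullet> (G *v y)" using G by (auto simp: pd_def)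
      have "(y \<bullet> (K *v y)) / (y \<bullet> (G *v y)) \<le> x \<bullet> (K *v x)"
        using x(2)[OF normalize[OF y False]] p
        by (simp add: matrix_vector_mult_scaleR divide_simps)
      then show ?thesis using p by (simp add: divide_simps)
    qed simp
  qed (use x in \<open>auto simp: S_def V_def\<close>)
qed

text \<open>Induction over \<open>A\<close> from below: a new largest index receives the maximiser
  of the Rayleigh quotient on the complement of the vectors already found. The last clause,
  maximality on the complement, is carried along because it forces each new eigenvalue below the old
  ones, hence the decreasing order.\<close>

lemma spectral_on:
  fixes G K :: "'n::{finite,linorder} sqmat" and A :: "'n set"
  assumes G: "pd G" and K: "transpose K = K"
  shows "\<exists>u l. (\<forall>i\<in>A. \<forall>j\<in>A. u i \<bullet> (G *v u j) = (if i = j then 1 else 0)) \<and>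
     (\<forall>i\<in>A. K *v u i = l i *\<^sub>R (G *v u i)) \<and>
     (\<forall>i\<in>A. \<forall>j\<in>A. i \<le> j \<longrightarrow> l j \<le> l i) \<and>
     (\<forall>x. (\<forall>i\<in>A. x \<bullet> (G *v u i) = 0) \<longrightarrow> (\<forall>i\<in>A. x \<bullet> (K *v x) \<le> l i * (x \<bullet> (G *v x))))"
  (is "\<exists>u l. ?P A u l")
proof -
  have "finite A" by simp
  then show ?thesis
  proof (induction A rule: finite_linorder_max_induct)
    case empty
    show ?case by auto
  next
    case (insert b A)
    then obtain u l where P: "?P A u l" by blast
    have bA: "b \<notin> A" using insert.hyps by auto
    then have "card A < CARD('n)" by (intro psubset_card_mono) auto
    then obtain x where x: "\<forall>i\<in>A. x \<bullet> (G *v u i) = 0" "x \<bullet> (G *v x) = 1"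
      "\<And>y. \<forall>i\<in>A. y \<bullet> (G *v u i) = 0 \<Longrightarrow> y \<bullet> (K *v y) \<le> (x \<bullet> (K *v x)) * (y \<bullet> (G *v y))"
      using rayleigh_max[OF G, of A u K] by blast
    define lb where "lb = x \<bullet> (K *v x)"
    have x': "\<forall>i\<in>A. u i \<bullet> (G *v x) = 0"
      using x(1) G sym_form[of G] unfolding pd_def by metis
    have on: "u i \<bullet> (G *v u j) = (if i = j then 1 else 0)" if "i \<in> A" "j \<in> A" for i j
      using P that by blast
    have eig: "K *v u i = l i *\<^sub>R (G *v u i)" if "i \<in> A" for i using P that by blast
    \<comment> \<open>The defect of the eigenvalue equation at the maximiser. It is orthogonal to
      the complement by the first-order condition and to the \<open>u i\<close> by symmetry of the
      forms; together these span the space.\<close>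
    define z where "z = K *v x - lb *\<^sub>R (G *v x)"
    have zV: "y \<bullet> z = 0" if y: "\<forall>i\<in>A. y \<bullet> (G *v u i) = 0" for y
    proof (rule affine_quadratic_le_zero)
      fix e :: real
      have xe: "\<forall>i\<in>A. (x + e *\<^sub>R y) \<bullet> (G *v u i) = 0"
        using x(1) y by (simp add: inner_add_left)
      have "(x + e *\<^sub>R y) \<bullet> (K *v (x + e *\<^sub>R y)) - lb * ((x + e *\<^sub>R y) \<bullet> (G *v (x + e *\<^sub>R y)))
          = 2 * e * (y \<bullet> z) + e\<^sup>2 * (y \<bullet> (K *v y) - lb * (y \<bullet> (G *v y)))"
        using sym_form[of G x y] sym_form[of K x y] G K x(2)
        by (simp add: z_def pd_def lb_def[symmetric] matrix_vector_right_distrib inner_add_left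
            inner_add_right inner_diff_right matrix_vector_mult_scaleR power2_eq_square algebra_simps)
      then show "2 * e * (y \<bullet> z) + e\<^sup>2 * (y \<bullet> (K *v y) - lb * (y \<bullet> (G *v y))) \<le> 0"
        using x(3)[OF xe] by (simp add: lb_def)
    qed
    have zu: "u i \<bullet> z = 0" if "i \<in> A" for i
    proof -
      have "u i \<bullet> (K *v x) = x \<bullet> (l i *\<^sub>R (G *v u i))"
        using sym_form[OF K, of "u i" x] eig[OF that] by simp
      then show ?thesis using x(1) x' that by (simp add: z_def inner_diff_right)
    qed
    have "v \<bullet> z = 0" for v
    proof -
      define y where "y = v - (\<Sum>i\<in>A. (v \<bullet> (G *v u i)) *\<^sub>R u i)"
      have "y \<bullet> (G *v u j) = 0" if "j \<in> A" for j
        using that by (simp add: y_def inner_diff_left inner_sum_left on if_distrib cong: if_cong)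
      then have "y \<bullet> z = 0" using zV by blast
      then show ?thesis by (simp add: y_def inner_diff_left inner_sum_left zu)
    qed
    then have "z = 0" using inner_eq_zero_iff by blast
    then have eigx: "K *v x = lb *\<^sub>R (G *v x)" by (simp add: z_def)
    have lb_le: "lb \<le> l i" if "i \<in> A" for i
      using P x(1,2) that by (auto simp: lb_def)
    have x3: "y \<bullet> (K *v y) \<le> lb * (y \<bullet> (G *v y))" if "\<forall>i\<in>A. i \<noteq> b \<longrightarrow> y \<bullet> (G *v u i) = 0" for y
      using x(3)[of y] that bA unfolding lb_def by metis
    have "?P (insert b A) (u(b := x)) (l(b := lb))"
      using bA P x(1,2) x3 x' eigx lb_le insert.hyps
      by (auto simp: lb_def[symmetric] dest: leD)
    then show ?case by blast
  qed
qed

lemma det_ne_0_of_congruence_1: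
  fixes W :: "real^'n^'n"
  assumes "transpose W ** G ** W = mat 1"
  shows "det W \<noteq> 0"
  using arg_cong[OF assms, of det] by (auto simp: det_mul)

lemma spectral:
  fixes G K :: "'n::{finite,linorder} sqmat"
  assumes G: "pd G" and K: "transpose K = K"
  obtains W :: "'n sqmat" and l where "transpose W ** G ** W = mat 1" "K ** W = G ** W ** diag l"
    "transpose W ** K ** W = diag l" "antimono l"
proof -
  obtain u :: "'n \<Rightarrow> 'n rvec" and l where P: "\<And>i j. u i \<bullet> (G *v u j) = (if i = j then 1 else 0)"
     "\<And>i. K *v u i = l i *\<^sub>R (G *v u i)" "\<And>i j. i \<le> j \<Longrightarrow> l j \<le> l i"
    using spectral_on[OF assms, of UNIV] unfolding ball_UNIV by metis
  define W :: "'n sqmat" where "W = (\<chi> i j. u j $ i)"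
  have W: "W *v axis j 1 = u j" for j
    by (simp add: matrix_vector_mult_basis W_def column_def vec_eq_iff)
  have 1: "transpose W ** G ** W = mat 1"
    by (simp add: vec_eq_iff matrix_entry_form[of "_ ** W"] congruence_form W P(1)) (simp add: mat_def)
  have d: "diag l *v axis j 1 = l j *\<^sub>R axis j 1" for j
    by (auto simp: vec_eq_iff diag_vector_mult axis_def)
  have 2: "K ** W = G ** W ** diag l"
  proof -
    have "(K ** W) *v axis j 1 = (G ** W ** diag l) *v axis j 1" for j
      by (simp add: matrix_vector_mul_assoc[symmetric] W P(2) d matrix_vector_mult_scaleR)
    then show ?thesis
      by (metis matrix_entry_form vec_eq_iff)
  qed
  have "transpose W ** K ** W = transpose W ** G ** W ** diag l"
    by (simp add: 2 matrix_mul_assoc[symmetric])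
  then have 3: "transpose W ** K ** W = diag l" using 1 by simp
  have 4: "antimono l" using P(3) by (auto simp: monotone_on_def)
  show thesis by (rule that[OF 1 2 3 4])
qed

lemma eigenvalue_form:
  fixes W :: "real^'n^'n"
  assumes "transpose W ** K ** W = diag l"
  shows "(W *v axis i 1) \<bullet> (K *v (W *v axis i 1)) = l i"
proof -
  have "(transpose W ** K ** W) $ i $ i = l i" using assms by (simp add: diag_def)
  then show ?thesis by (simp add: matrix_entry_form[of "_ ** W"] congruence_form)
qed

lemma det_diag_congruence:
  fixes W :: "real^'n^'n"
  assumes "transpose W ** K ** W = diag l"
  shows "(det W)\<^sup>2 * det K = prod l UNIV"
  using arg_cong[OF assms, of det] by (simp add: det_mul det_diag power2_eq_square mult_ac)

lemma eigenvalues_pos: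
  fixes W :: "real^'n^'n"
  assumes "transpose W ** K ** W = diag l" "pd K" "det W \<noteq> 0"
  shows "l i > 0"
proof -
  have "W *v axis i 1 \<noteq> 0"
    using assms(3) by (metis invertible_det_nz inj_matrix_vector_mult matrix_vector_mult_0_right injD
        axis_eq_0_iff zero_neq_one)
  then show ?thesis using assms(2) eigenvalue_form[OF assms(1), of i] by (auto simp: pd_def)
qed

section \<open>Determinant inequalities for quadratic forms\<close>

lemma pd_det_pos:
  fixes G :: "'n::{finite,linorder} sqmat"
  assumes "pd G"
  shows "det G > 0"
proof -
  have "transpose G = G" using assms by (simp add: pd_def)
  then obtain W :: "'n sqmat" and l where W: "transpose W ** mat 1 ** W = mat 1" "transpose W ** G ** W = diag l"
    by (rule spectral[OF pd_mat_1])
  have "prod l UNIV > 0"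
    using eigenvalues_pos[OF W(2) assms det_ne_0_of_congruence_1[OF W(1)]] by (intro prod_pos) auto
  then have "0 < (det W)\<^sup>2 * det G" using det_diag_congruence[OF W(2)] by simp
  then show ?thesis by (auto simp: zero_less_mult_iff)
qed

lemma pd_det_ne_0: "pd G \<Longrightarrow> det G \<noteq> 0"
  for G :: "'n::{finite,linorder} sqmat"
  using pd_det_pos[of G] by simp

lemma det_mono_form:
  fixes S Z :: "'n::{finite,linorder} sqmat"
  assumes S: "transpose S = S" "\<And>x. 0 \<le> x \<bullet> (S *v x)" and Z: "pd Z"
    and le: "\<And>x. x \<bullet> (S *v x) \<le> x \<bullet> (Z *v x)"
  shows "det S \<le> det Z"
proof -
  obtain W :: "'n sqmat" and l where W: "transpose W ** Z ** W = mat 1" "transpose W ** S ** W = diag l"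
    using spectral[OF Z S(1)] by blast
  have "l i \<le> 1" for i
    using le[of "W *v axis i 1"] eigenvalue_form[OF W(2), of i]
      eigenvalue_form[of W Z "\<lambda>_. 1" i] W(1) by (simp add: diag_one)
  moreover have "0 \<le> l i" for i
    using S(2)[of "W *v axis i 1"] eigenvalue_form[OF W(2), of i] by simp
  ultimately have "prod l UNIV \<le> 1" by (intro prod_le_1) auto
  then have "(det W)\<^sup>2 * det S \<le> (det W)\<^sup>2 * det Z"
    using det_diag_congruence[OF W(2)] det_diag_congruence[of W Z "\<lambda>_. 1"] W(1)
    by (simp add: diag_one)
  then show ?thesis
    using det_ne_0_of_congruence_1[OF W(1)] by (simp add: mult_le_cancel_left_pos zero_less_power2)
qed

text \<open>The last hypothesis says that the block form with diagonal blocks \<open>X\<close>,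
  \<open>Z\<close> and off-diagonal block \<open>Y\<close> is semidefinite. Eliminating
  \<open>u\<close> by \<open>u = - (D *v v)\<close> bounds the Schur term
  \<open>transpose D ** X ** D\<close> by \<open>Z\<close>, and the determinant of that term is the
  square of \<open>det Y\<close> divided by \<open>det X\<close>.\<close>

lemma det_cauchy_schwarz:
  fixes X Y Z :: "'n::{finite,linorder} sqmat"
  assumes X: "pd X" and Z: "pd Z"
    and nonneg: "\<And>u v. 0 \<le> u \<bullet> (X *v u) + 2 * (u \<bullet> (Y *v v)) + v \<bullet> (Z *v v)"
  shows "(det Y)\<^sup>2 \<le> det X * det Z"
proof -
  define D where "D = matrix_inv X ** Y"
  have XD: "X ** D = Y"
    using matrix_inv_mult(1)[OF pd_det_ne_0[OF X]] by (simp add: D_def matrix_mul_assoc)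
  have "det (transpose D ** X ** D) \<le> det Z"
  proof (rule det_mono_form[OF _ _ Z])
    show "transpose (transpose D ** X ** D) = transpose D ** X ** D"
      using X by (simp add: transpose_congruence pd_def)
    show "0 \<le> x \<bullet> (transpose D ** X ** D *v x)" for x
      using form_le_zero[OF X] by (simp add: congruence_form)
    show "x \<bullet> (transpose D ** X ** D *v x) \<le> x \<bullet> (Z *v x)" for x
    proof -
      have "Y *v x = X *v (D *v x)" by (simp add: XD[symmetric] matrix_vector_mul_assoc)
      then show ?thesis using nonneg[of "- (D *v x)" x]
        by (simp add: congruence_form vec.neg)
    qed
  qed
  moreover have "det X * (det X * (det D)\<^sup>2) = (det Y)\<^sup>2"
    by (simp add: XD[symmetric] det_mul power2_eq_square)
  ultimately show ?thesis using pd_det_pos[OF X]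
    by (auto simp: det_mul power2_eq_square mult_ac dest: mult_left_mono[of _ _ "det X"])
qed

text \<open>The determinant is a polynomial in \<open>e\<close>. It is not identically zero, because
  for \<open>e\<close> above the operator norm of \<open>A\<close> the matrix has trivial
  kernel.\<close>

lemma finite_det_zero: "finite {e::real. det (A + diag (\<lambda>_. e)) = 0}"
  for A :: "real^'n^'n"
proof -
  define p where "p e = det (A + diag (\<lambda>_. e))" for e :: real
  have e: "real_polynomial_function (\<lambda>e::real. (A + diag (\<lambda>_. e)) $ i $ j)" for i j
  proof (cases "i = j")
    case True
    have "(\<lambda>e::real. (A + diag (\<lambda>_. e)) $ i $ j) = (\<lambda>e. A $ i $ j + e)"
      using True by (simp add: diag_def)
    then show ?thesis
      using real_polynomial_function.intros(3)[OF real_polynomial_function.intros(2)[of "A $ i $ j"]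
        real_polynomial_function.intros(1)[OF bounded_linear_ident]] by simp
  next
    case False
    then have "(\<lambda>e::real. (A + diag (\<lambda>_. e)) $ i $ j) = (\<lambda>e. A $ i $ j)"
      by (simp add: diag_def)
    then show ?thesis
      by (simp add: real_polynomial_function.intros(2))
  qed
  have "real_polynomial_function p"
    unfolding p_def det_def
    by (rule real_polynomial_function_sum[OF finite_permutations[OF finite]], rule real_polynomial_function.intros(4)[OF
      real_polynomial_function.intros(2)], rule real_polynomial_function_prod[OF finite], rule e)
  then obtain a n where a: "p = (\<lambda>x. \<Sum>i\<le>n. a i * x^i)"
    using real_polynomial_function_iff_sum by blast
  define e where "e = onorm ((*v) A) + 1"
  have "p e \<noteq> 0"
  proof
    assume "p e = 0"
    then have "\<not> invertible (A + diag (\<lambda>_. e))" by (simp add: p_def invertible_det_nz)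
    then obtain x where x: "x \<noteq> 0" "(A + diag (\<lambda>_. e)) *v x = 0"
      using matrix_left_invertible_ker[of "A + diag (\<lambda>_. e)"] invertible_left_inverse by blast
    have "diag (\<lambda>_. e) *v x = e *\<^sub>R x" by (simp add: vec_eq_iff diag_vector_mult)
    then have "A *v x = - (e *\<^sub>R x)"
      using x(2) by (simp add: matrix_vector_mult_add_rdistrib eq_neg_iff_add_eq_0)
    moreover have "norm (A *v x) \<le> onorm ((*v) A) * norm x"
      by (intro onorm) simp
    moreover have "0 \<le> onorm ((*v) A)" by (intro onorm_pos_le) simp
    ultimately have "(onorm ((*v) A) + 1) * norm x \<le> onorm ((*v) A) * norm x"
      by (simp add: e_def)
    then show False using x(1) by (simp add: distrib_right)
  qed
  then have "\<exists>i\<le>n. a i \<noteq> 0" unfolding a by (metis (no_types, lifting) mult_zero_left sum.neutral atMost_iff)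
  then have "finite {x. p x = 0}" unfolding a using polyfun_finite_roots by blast
  then show ?thesis by (simp add: p_def)
qed

lemma continuous_on_det [continuous_intros]:
  fixes F :: "'a::topological_space \<Rightarrow> real^'n^'n"
  assumes "continuous_on S F"
  shows "continuous_on S (\<lambda>x. det (F x))"
  unfolding det_def using assms by (intro continuous_intros) auto

lemma continuous_on_matrix_mult [continuous_intros]:
  fixes F :: "'a::topological_space \<Rightarrow> real^'n^'m" and F' :: "'a \<Rightarrow> real^'k^'n"
  assumes "continuous_on S F" "continuous_on S F'"
  shows "continuous_on S (\<lambda>x. F x ** F' x)"
  unfolding matrix_matrix_mult_def using assms by (intro continuous_intros) auto

text \<open>Both sides are polynomial in \<open>A\<close> and agree for invertible \<open>A\<close>.\<close>

lemma det_one_plus_mult_commute: "det (mat 1 + A ** B) = det (mat 1 + B ** (A :: real^'n^'n))"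
proof -
  define q where "q e = det (mat 1 + (A + diag (\<lambda>_. e)) ** B) - det (mat 1 + B ** (A + diag (\<lambda>_. e)))"
    for e :: real
  have q0: "q e = 0" if "det (A + diag (\<lambda>_. e)) \<noteq> 0" for e
  proof -
    let ?A = "A + diag (\<lambda>_. e)"
    have "det (mat 1 + ?A ** B) * det ?A = det (?A + ?A ** B ** ?A)"
      by (simp add: det_mul[symmetric] matrix_add_mult_distrib)
    also have "\<dots> = det ?A * det (mat 1 + B ** ?A)"
      by (simp add: det_mul[symmetric] matrix_add_ldistrib matrix_mul_assoc)
    finally show ?thesis using that by (simp add: q_def)
  qed
  have cd: "continuous_on UNIV (\<lambda>e::real. diag (\<lambda>_::'n. e))"
    unfolding diag_def
  proof (intro continuous_on_vec_lambda)
    show "continuous_on UNIV (\<lambda>e::real. if i = j then e else 0)" for i j :: 'n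
      by (cases "i = j") auto
  qed
  have "continuous_on UNIV q"
    unfolding q_def using cd by (intro continuous_intros)
  then have "(q \<longlongrightarrow> q 0) (at 0)" by (simp add: continuous_on_def)
  moreover have "\<forall>\<^sub>F e in at 0. q e = 0"
  proof -
    have "\<forall>\<^sub>F e in at 0. e \<notin> {e. det (A + diag (\<lambda>_. e)) = 0}"
      using islimpt_finite[OF finite_det_zero] by (simp add: islimpt_iff_eventually)
    then show ?thesis by eventually_elim (use q0 in auto)
  qed
  ultimately have "q 0 = 0"
    using tendsto_unique[of "at (0::real)" q "q 0" 0] tendsto_eventually[of q 0 "at 0"] by simp
  moreover have "diag (\<lambda>_. 0) = (0 :: real^'n^'n)" by (simp add: diag_def vec_eq_iff)
  ultimately show ?thesis by (simp add: q_def)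
qed

section \<open>Principal minors as determinants of padded blocks\<close>

definition coord_proj :: "'n set \<Rightarrow> real^'n \<Rightarrow> real^'n" where
  "coord_proj I x = (\<chi> i. if i \<in> I then x $ i else 0)"

text \<open>The determinant of \<open>blk I S\<close> is the principal minor of \<open>S\<close> with index set \<open>I\<close>.\<close>

definition blk :: "'n set \<Rightarrow> real^'n^'n \<Rightarrow> real^'n^'n" where
  "blk I S = (\<chi> i j. if i \<in> I \<and> j \<in> I then S $ i $ j else if i = j then 1 else 0)"

lemma blk_eq:
  fixes S :: "real^'n^'n"
  defines "E \<equiv> \<lambda>I. diag (\<lambda>i::'n. if i \<in> I then 1 else 0)"
  shows "blk I S = E I ** S ** E I + E (- I)"
  by (auto simp: vec_eq_iff E_def matrix_mult_diag diag_matrix_mult blk_def) (auto simp: diag_def)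

lemma diag_indicator_vector: "diag (\<lambda>i. if i \<in> I then 1 else 0) *v x = coord_proj I x"
  by (simp add: vec_eq_iff diag_vector_mult coord_proj_def)

text \<open>In this shape inequalities between forms pass to their blocks, since the padding adds
  the same Euclidean term on both sides.\<close>

lemma blk_form:
  "x \<bullet> (blk I S *v y) =
    coord_proj I x \<bullet> (S *v coord_proj I y) + (x - coord_proj I x) \<bullet> (y - coord_proj I y)"
proof -
  have "x \<bullet> (diag (\<lambda>i. if i \<in> - I then 1 else 0) *v y) = (x - coord_proj I x) \<bullet> (y - coord_proj I y)"
    unfolding diag_indicator_vector
    unfolding inner_vec_def by (rule sum.cong) (auto simp: coord_proj_def)
  then show ?thesis
    using congruence_form[of x "diag (\<lambda>i. if i \<in> I then 1 else 0)" S "diag (\<lambda>i. if i \<in> I then 1 else 0)" y]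
    by (simp add: blk_eq matrix_vector_mult_add_rdistrib inner_add_right diag_indicator_vector)
qed

lemma transpose_blk: "transpose S = S \<Longrightarrow> transpose (blk I S) = blk I S"
  unfolding sym_iff_form blk_form by (metis inner_commute)

lemma blk_mat_1: "blk I (mat 1) = mat 1"
  by (auto simp: blk_def mat_def vec_eq_iff)

lemma pd_blk: "pd S \<Longrightarrow> pd (blk I S)"
proof -
  assume S: "pd S"
  have "0 < v \<bullet> (blk I S *v v)" if "v \<noteq> 0" for v
  proof (cases "coord_proj I v = 0")
    case True
    then show ?thesis using that by (simp add: blk_form)
  next
    case False
    then have "0 < coord_proj I v \<bullet> (S *v coord_proj I v)" using S by (simp add: pd_def)
    then show ?thesis by (simp add: blk_form add_pos_nonneg)
  qed
  then show ?thesis using S by (simp add: pd_def transpose_blk)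
qed

lemma det_blk_diag: "det (blk I (diag l)) = prod l I"
  for l :: "'n::finite \<Rightarrow> real"
proof -
  have "blk I (diag l) = diag (\<lambda>i. if i \<in> I then l i else 1)"
    by (auto simp: blk_def diag_def vec_eq_iff)
  then show ?thesis by (simp add: det_diag prod.If_cases)
qed

lemma blk_mult_diag: "blk I (S ** diag l) = blk I S ** blk I (diag l)"
  for l :: "'n::finite \<Rightarrow> real"
proof -
  have "blk I (diag l) = diag (\<lambda>i. if i \<in> I then l i else 1)"
    by (auto simp: blk_def diag_def vec_eq_iff)
  then show ?thesis by (simp add: vec_eq_iff matrix_mult_diag) (auto simp: blk_def matrix_mult_diag)
qed

lemma det_blk_mono:
  fixes S Z :: "'n::{finite,linorder} sqmat"
  assumes "pd S" "pd Z" "\<And>x. x \<bullet> (S *v x) \<le> x \<bullet> (Z *v x)"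
  shows "det (blk I S) \<le> det (blk I Z)"
  using assms pd_blk[OF assms(1), of I] pd_blk[OF assms(2), of I]
  by (intro det_mono_form) (auto simp: blk_form form_le_zero transpose_blk pd_def[of S])


text \<open>Write the added term as \<open>transpose N ** N\<close> with \<open>N = R ** M\<close>
  and \<open>R\<close> the square root of \<open>diag d\<close>. By
  \<open>det_one_plus_mult_commute\<close> the left side is \<open>det C\<close> times the
  determinant of \<open>mat 1 + N ** Ci ** transpose N\<close>. The hypothesis on \<open>M\<close>
  means that \<open>M ** Ci ** transpose M\<close> is at most the identity, so this second factor is
  at most that of \<open>mat 1 + diag d\<close>.\<close>

lemma det_add_congruence_diag_le:
  fixes C M :: "'n::{finite,linorder} sqmat"
  assumes C: "pd C" and M: "\<And>x. (M *v x) \<bullet> (M *v x) \<le> x \<bullet> (C *v x)" and d: "\<And>i. 0 \<le> d i"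
  shows "det (C + transpose M ** diag d ** M) \<le> det C * (\<Prod>i\<in>UNIV. 1 + d i)"
proof -
  define R where "R = diag (\<lambda>i. sqrt (d i))"
  define N where "N = R ** M"
  have RR: "R ** R = diag d" using d by (simp add: R_def diag_mult_diag)
  have NN: "transpose N ** N = transpose M ** diag d ** M"
    by (simp add: N_def R_def[symmetric] matrix_transpose_mul matrix_mul_assoc RR[symmetric])
       (simp add: R_def matrix_mul_assoc)
  define Ci where "Ci = matrix_inv C"
  have CCi: "C ** Ci = mat 1" "Ci ** C = mat 1"
    using matrix_inv_mult(1)[OF pd_det_ne_0[OF C]] matrix_inv_mult(2)[OF pd_det_ne_0[OF C]]
    by (auto simp: Ci_def)
  have Ci: "transpose Ci = Ci"
  proof -
    have "transpose Ci ** C = mat 1"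
      using arg_cong[OF CCi(1), of transpose] C by (simp add: matrix_transpose_mul pd_def)
    then show ?thesis using CCi by (metis matrix_mul_assoc matrix_mul_lid matrix_mul_rid)
  qed
  have "C + transpose N ** N = C ** (mat 1 + (Ci ** transpose N) ** N)"
    by (simp add: matrix_add_ldistrib matrix_mul_assoc CCi)
  then have 1: "det (C + transpose M ** diag d ** M) = det C * det (mat 1 + N ** Ci ** transpose N)"
    unfolding NN[symmetric] using det_one_plus_mult_commute[of "Ci ** transpose N" N]
    by (simp add: det_mul matrix_mul_assoc)
  have form: "x \<bullet> (N ** Ci ** transpose N *v x) = (transpose N *v x) \<bullet> (Ci *v (transpose N *v x))" for x
    using congruence_form[of x "transpose N" Ci "transpose N" x] by (simp del: transpose_matrix_vector)
  have bounds: "0 \<le> x \<bullet> (N ** Ci ** transpose N *v x) \<and>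
    x \<bullet> (N ** Ci ** transpose N *v x) \<le> x \<bullet> (diag d *v x)" for x
  proof -
    \<comment> \<open>The value \<open>a\<close> of the form at \<open>x\<close> is
      \<open>z \<bullet> (C *v z)\<close> and also the inner product of \<open>R *v x\<close> with
      \<open>M *v z\<close>. Twice the latter is at most the sum of the squared lengths, and that of
      \<open>M *v z\<close> is at most \<open>a\<close>, so one \<open>a\<close> can be
      absorbed.\<close>
    define z where "z = Ci *v (transpose N *v x)"
    have Cz: "C *v z = transpose N *v x"
      unfolding z_def matrix_vector_mul_assoc by (simp add: matrix_mul_assoc CCi del: transpose_matrix_vector)
    define a where "a = z \<bullet> (C *v z)"
    have a: "x \<bullet> (N ** Ci ** transpose N *v x) = a"
      unfolding form z_def[symmetric] unfolding a_def Cz by (rule inner_commute)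
    have "a = (R *v x) \<bullet> (M *v z)"
      unfolding a_def Cz transpose_form N_def matrix_vector_mul_assoc[symmetric]
      using transpose_form[of "M *v z" R x] by (simp add: R_def inner_commute del: transpose_matrix_vector)
    then have "2 * a \<le> (R *v x) \<bullet> (R *v x) + (M *v z) \<bullet> (M *v z)"
      using inner_ge_zero[of "R *v x - M *v z"] by (simp add: inner_diff_left inner_diff_right inner_commute)
    moreover have "(M *v z) \<bullet> (M *v z) \<le> a" unfolding a_def by (rule M)
    moreover have "(R *v x) \<bullet> (R *v x) = x \<bullet> (diag d *v x)"
      using congruence_form[of x R "mat 1" R x] by (simp add: RR[symmetric] R_def)
    moreover have "0 \<le> a" unfolding a_def by (rule form_le_zero[OF C])
    ultimately show ?thesis by (simp add: a)
  qed
  have "det (mat 1 + N ** Ci ** transpose N) \<le> det (diag (\<lambda>i. 1 + d i))"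
  proof (rule det_mono_form)
    show "transpose (mat 1 + N ** Ci ** transpose N) = mat 1 + N ** Ci ** transpose N"
      using transpose_congruence[OF Ci, of "transpose N"]
      by (simp add: vec_eq_iff transpose_def mat_def)
    have one: "diag (\<lambda>i. 1 + d i) = mat 1 + diag d" by (auto simp: diag_def mat_def vec_eq_iff)
    have dd: "0 \<le> x \<bullet> (diag d *v x)" for x using bounds[of x] by linarith
    show "0 \<le> x \<bullet> ((mat 1 + N ** Ci ** transpose N) *v x)" for x
      using bounds[of x] by (simp add: matrix_vector_mult_add_rdistrib inner_add_right del: transpose_matrix_vector)
    show "x \<bullet> ((mat 1 + N ** Ci ** transpose N) *v x) \<le> x \<bullet> (diag (\<lambda>i. 1 + d i) *v x)" for x
      using bounds[of x] unfolding one
      by (simp add: matrix_vector_mult_add_rdistrib inner_add_right del: transpose_matrix_vector)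
    show "pd (diag (\<lambda>i. 1 + d i))"
      unfolding pd_def
      by (simp add: one matrix_vector_mult_add_rdistrib inner_add_right add_pos_nonneg dd)
         (simp flip: one)
  qed
  then show ?thesis unfolding 1 det_diag using pd_det_pos[OF C] by (simp add: mult_left_mono)
qed

text \<open>Initial segments: for decreasing eigenvalues the product over such a set is that of the
  \<open>card I\<close> largest. The empty set is included, so that single eigenvalues can be
  recovered as quotients.\<close>

definition down_closed :: "'n::order set \<Rightarrow> bool" where
  "down_closed I \<longleftrightarrow> (\<forall>i\<in>I. \<forall>j\<le>i. j \<in> I)"

text \<open>This plays the role of the norm of an exterior power. With \<open>m\<close> the smallest
  of the \<open>l i\<close> for \<open>i\<close> in \<open>I\<close>, the eigenvalues outside
  \<open>I\<close> are at most \<open>m\<close> and those inside equal \<open>m * (1 + d i)\<close>.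
  The diagonal form is therefore at most \<open>m\<close> times \<open>mat 1 + diag d\<close>, and
  the block of the latter is controlled by \<open>det_add_congruence_diag_le\<close>.\<close>

lemma det_blk_congruence_diag_le:
  fixes V :: "'n::{finite,linorder} sqmat"
  assumes V: "det V \<noteq> 0" and l: "\<And>i. 0 < l i" "antimono l"
    and I: "down_closed I"
  shows "det (blk I (transpose V ** diag l ** V)) \<le> prod l I * det (blk I (transpose V ** V))"
proof (cases "I = {}")
  case True
  then have "blk I S = mat 1" for S :: "'n sqmat" by (auto simp: blk_def mat_def vec_eq_iff)
  then show ?thesis using True by simp
next
  case False
  define m where "m = l (Max I)"
  have lm: "m > 0" using l by (simp add: m_def)
  have inI: "m \<le> l i" if "i \<in> I" for i
    unfolding m_def by (rule antimonoD[OF l(2)]) (use that in simp)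
  have outI: "l i \<le> m" if "i \<notin> I" for i
  proof -
    have "Max I \<in> I" using False by simp
    then have "Max I \<le> i" using I that unfolding down_closed_def by (meson linorder_le_cases)
    then show ?thesis unfolding m_def by (rule antimonoD[OF l(2)])
  qed
  define d where "d i = (if i \<in> I then l i / m - 1 else 0)" for i
  have d: "0 \<le> d i" for i using inI lm by (simp add: d_def)
  have l_le: "l i \<le> m * (1 + d i)" for i
    using outI lm by (cases "i \<in> I") (auto simp: d_def)
  define C where "C = blk I (transpose V ** V)"
  define E where "E = diag (\<lambda>i. if i \<in> I then 1 else 0 :: real)"
  define M where "M = V ** E"
  have pdV: "pd (transpose V ** V)" using pd_congruence[OF pd_mat_1 V] by simp
  have C: "pd C" unfolding C_def by (rule pd_blk[OF pdV])
  have Mx: "M *v x = V *v coord_proj I x" for x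
    by (simp add: M_def E_def matrix_vector_mul_assoc[symmetric] diag_indicator_vector)
  have VV: "x \<bullet> (transpose V ** V *v y) = (V *v x) \<bullet> (V *v y)" for x y
    using congruence_form[of x V "mat 1" V y] by simp
  have Cform: "x \<bullet> (C *v x) = (M *v x) \<bullet> (M *v x) + (x - coord_proj I x) \<bullet> (x - coord_proj I x)" for x
    unfolding C_def blk_form VV Mx ..
  define P where "P = C + transpose M ** diag d ** M"
  have P_le: "det P \<le> det C * (\<Prod>i\<in>UNIV. 1 + d i)"
    unfolding P_def by (rule det_add_congruence_diag_le[OF C _ d]) (simp add: Cform)
  \<comment> \<open>Only the coordinates in \<open>I\<close> are scaled by the square root of
    \<open>m\<close>, since the identity padding must stay as it is; hence the exponent in
    \<open>m ^ card I\<close>.\<close>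
  define T where "T = diag (\<lambda>i. if i \<in> I then sqrt m else 1)"
  have Pform: "x \<bullet> (P *v x) = x \<bullet> (C *v x) + (M *v x) \<bullet> (diag d *v (M *v x))" for x
    by (simp add: P_def matrix_vector_mult_add_rdistrib inner_add_right congruence_form)
  have dform: "0 \<le> x \<bullet> (diag d *v x)" for x
    by (simp add: diag_form d sum_nonneg mult.assoc)
  have symP: "transpose P = P"
    using C unfolding sym_iff_form P_def pd_def
    by (simp add: matrix_vector_mult_add_rdistrib inner_add_right congruence_form sym_form[of "diag d"])
  have P: "pd P"
    unfolding pd_def
  proof (intro conjI allI impI symP)
    fix v :: "'n rvec" assume "v \<noteq> 0"
    then have "0 < v \<bullet> (C *v v)" using C by (simp add: pd_def)
    then show "0 < v \<bullet> (P *v v)" using dform[of "M *v v"] by (simp add: Pform)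
  qed
  have detT: "det T = sqrt m ^ card I"
    by (simp add: T_def det_diag prod.If_cases)
  have T: "det T \<noteq> 0" "(det T)\<^sup>2 = m ^ card I"
    unfolding detT power2_eq_square using lm by (simp_all flip: power_mult_distrib)
  have TPT: "pd (transpose T ** P ** T)" by (rule pd_congruence[OF P T(1)])
  have pdl: "pd (transpose V ** diag l ** V)"
  proof (rule pd_congruence[OF _ V])
    have "0 < v \<bullet> (diag l *v v)" if "v \<noteq> 0" for v :: "'n rvec"
    proof -
      obtain k where "v $ k \<noteq> 0" using \<open>v \<noteq> 0\<close> by (auto simp: vec_eq_iff)
      then have "0 < (\<Sum>i\<in>UNIV. l i * (v $ i * v $ i))"
        using l(1) by (intro sum_pos2[of _ k]) (auto simp: less_imp_le zero_less_mult_iff linorder_neq_iff)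
      then show ?thesis by (simp add: diag_form mult.assoc)
    qed
    then show "pd (diag l)" by (simp add: pd_def)
  qed
  have "det (blk I (transpose V ** diag l ** V)) \<le> det (transpose T ** P ** T)"
  proof (rule det_mono_form[OF _ _ TPT])
    show "transpose (blk I (transpose V ** diag l ** V)) = blk I (transpose V ** diag l ** V)"
      using pd_blk[OF pdl] by (simp add: pd_def)
    show "0 \<le> x \<bullet> (blk I (transpose V ** diag l ** V) *v x)" for x
      by (rule form_le_zero[OF pd_blk[OF pdl]])
    fix x :: "'n rvec"
    define p where "p = V *v coord_proj I x"
    define r where "r = (x - coord_proj I x) \<bullet> (x - coord_proj I x)"
    have Tp: "coord_proj I (T *v x) = sqrt m *\<^sub>R coord_proj I x"
      "T *v x - coord_proj I (T *v x) = x - coord_proj I x"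
      by (auto simp: T_def diag_vector_mult coord_proj_def vec_eq_iff)
    have MT: "M *v (T *v x) = sqrt m *\<^sub>R p"
      by (simp add: Mx Tp p_def matrix_vector_mult_scaleR)
    have "x \<bullet> (blk I (transpose V ** diag l ** V) *v x) = p \<bullet> (diag l *v p) + r"
      by (simp add: blk_form congruence_form p_def r_def)
    also have "p \<bullet> (diag l *v p) \<le> m * (p \<bullet> p) + m * (p \<bullet> (diag d *v p))"
    proof -
      have "(\<Sum>i\<in>UNIV. l i * (p $ i * p $ i)) \<le> (\<Sum>i\<in>UNIV. m * (1 + d i) * (p $ i * p $ i))"
        by (intro sum_mono mult_right_mono l_le) simp
      also have "\<dots> = m * (p \<bullet> p) + m * (p \<bullet> (diag d *v p))"
        by (simp add: inner_vec_def diag_vector_mult sum_distrib_left sum.distrib[symmetric] algebra_simps)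
      finally show ?thesis by (simp add: diag_form mult.assoc)
    qed
    also have "m * (p \<bullet> p) + m * (p \<bullet> (diag d *v p)) + r = x \<bullet> (transpose T ** P ** T *v x)"
    proof -
      have "\<And>z. sqrt m * (sqrt m * z) = m * z" unfolding mult.assoc[symmetric] using lm by simp
      then show ?thesis
        unfolding congruence_form Pform Cform MT Tp(2) r_def by (simp only: matrix_vector_mult_scaleR inner_scaleR_left inner_scaleR_right)
    qed
    finally show "x \<bullet> (blk I (transpose V ** diag l ** V) *v x) \<le> x \<bullet> (transpose T ** P ** T *v x)"
      by simp
  qed
  also have "\<dots> = m ^ card I * det P" using T(2) by (simp add: det_mul power2_eq_square mult_ac)
  also have "\<dots> \<le> m ^ card I * (det C * (\<Prod>i\<in>UNIV. 1 + d i))"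
    using P_le lm by (intro mult_left_mono) auto
  also have "(\<Prod>i\<in>UNIV. 1 + d i) = (\<Prod>i\<in>I. l i / m)"
    by (rule prod.mono_neutral_cong_right) (auto simp: d_def)
  also have "m ^ card I * (det C * (\<Prod>i\<in>I. l i / m)) = prod l I * det C"
    using lm by (simp add: prod_dividef)
  finally show ?thesis by (simp add: C_def)
qed

text \<open>The generalised eigenvalue problem \<open>K u = l G u\<close>: the columns of
  \<open>W\<close> are a \<open>G\<close>-orthonormal eigenbasis. For positive definite
  \<open>K\<close> the \<open>l i\<close> are the squared singular values of the identity map from
  the inner product \<open>G\<close> to the inner product \<open>K\<close>.\<close>

definition eigenbasis ::
  "'n::{finite,linorder} sqmat \<Rightarrow> 'n sqmat \<Rightarrow> 'n sqmat \<Rightarrow> ('n \<Rightarrow> real) \<Rightarrow> bool" where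
  "eigenbasis G K W l \<longleftrightarrow> transpose W ** G ** W = mat 1 \<and> K ** W = G ** W ** diag l \<and> antimono l"

lemma eigenbasisD:
  fixes W :: "'n::{finite,linorder} sqmat"
  assumes "eigenbasis G K W l"
  shows "transpose W ** G ** W = mat 1" "K ** W = G ** W ** diag l" "antimono l"
    "transpose W ** K ** W = diag l" "det W \<noteq> 0"
proof -
  show *: "transpose W ** G ** W = mat 1" "K ** W = G ** W ** diag l" "antimono l"
    using assms by (auto simp: eigenbasis_def)
  have "transpose W ** K ** W = transpose W ** G ** W ** diag l"
    using *(2) by (simp add: matrix_mul_assoc[symmetric])
  then show "transpose W ** K ** W = diag l" using *(1) by simp
  show "det W \<noteq> 0" using det_ne_0_of_congruence_1[OF *(1)] .
qed

lemma eigenbasis_exists: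
  fixes G K :: "'n::{finite,linorder} sqmat"
  assumes "pd G" "transpose K = K"
  obtains W l where "eigenbasis G K W l"
  using spectral[OF assms] unfolding eigenbasis_def by metis

lemma eigenbasis_pos:
  fixes W :: "'n::{finite,linorder} sqmat"
  shows "eigenbasis G K W l \<Longrightarrow> pd K \<Longrightarrow> 0 < l i"
  using eigenvalues_pos eigenbasisD by metis

text \<open>In the coordinates given by \<open>W\<close> the two forms become \<open>diag l\<close>
  and the identity. Equality holds for \<open>U = W\<close>, so \<open>prod l I\<close> is the
  largest ratio of the two minors.\<close>

lemma det_blk_congruence_le:
  fixes U :: "'n::{finite,linorder} sqmat"
  assumes W: "eigenbasis G K W l" and K: "pd K" and U: "det U \<noteq> 0"
    and I: "down_closed I"
  shows "det (blk I (transpose U ** K ** U)) \<le> prod l I * det (blk I (transpose U ** G ** U))"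
proof -
  note W = W eigenbasisD[OF W]
  define V where "V = matrix_inv W ** U"
  have WV: "W ** V = U"
    using matrix_inv_mult(1)[OF W(6)] by (simp add: V_def matrix_mul_assoc)
  have "transpose U ** K ** U = transpose V ** (transpose W ** K ** W) ** V"
    "transpose U ** G ** U = transpose V ** (transpose W ** G ** W) ** V"
    by (simp_all add: WV[symmetric] matrix_transpose_mul matrix_mul_assoc)
  moreover have "det V \<noteq> 0" using U unfolding WV[symmetric] by (simp add: det_mul)
  ultimately show ?thesis
    using det_blk_congruence_diag_le[of V l I] eigenbasis_pos[OF W(1) K] W I by simp
qed

text \<open>The relations say that \<open>Gm\<close> and \<open>Km\<close> are the geometric means of \<open>Gs\<close>, \<open>Gt\<close> and \<open>Ks\<close>, \<open>Kt\<close>.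
  The proof realises \<open>Gm\<^sup>-\<^sup>1 Km\<close> up to conjugation as a product of the adjoint of one identity map
  \<open>Gs \<rightarrow> Ks\<close> and a conjugate of the other, and applies the Cauchy-Schwarz inequality to minors.\<close>

lemma eigenvalues_geometric_mean:
  fixes Gs :: "'n::{finite,linorder} sqmat"
  assumes pd: "pd Gs" "pd Gm" "pd Gt" "pd Ks" "pd Km" "pd Kt"
    and mean: "Gm ** matrix_inv Gs ** Gm = Gt" "Km ** matrix_inv Ks ** Km = Kt"
    and W: "eigenbasis Gs Ks Ws ls" "eigenbasis Gm Km Wm lm" "eigenbasis Gt Kt Wt lt"
    and I: "down_closed I"
  shows "(prod lm I)\<^sup>2 \<le> prod ls I * prod lt I"
proof -
  define R where "R = matrix_inv Gs ** Gm"
  define Q where "Q = matrix_inv Ks ** Km"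
  have GR: "Gs ** R = Gm" and KQ: "Ks ** Q = Km"
    using matrix_inv_mult(1)[OF pd_det_ne_0[OF pd(1)]] matrix_inv_mult(1)[OF pd_det_ne_0[OF pd(4)]]
    by (simp_all add: R_def Q_def matrix_mul_assoc)
  have RGm: "transpose R ** Gm = Gt"
  proof -
    have "transpose R ** Gm = transpose R ** Gs ** R" by (simp add: GR[symmetric] matrix_mul_assoc)
    also have "transpose R ** Gs = Gm"
      using arg_cong[OF GR, of transpose] pd(1,2) by (simp add: matrix_transpose_mul pd_def)
    finally show ?thesis using mean(1) by (simp add: R_def matrix_mul_assoc)
  qed
  have QKm: "transpose Q ** Km = Kt"
  proof -
    have "transpose Q ** Km = transpose Q ** Ks ** Q" by (simp add: KQ[symmetric] matrix_mul_assoc)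
    also have "transpose Q ** Ks = Km"
      using arg_cong[OF KQ, of transpose] pd(4,5) by (simp add: matrix_transpose_mul pd_def)
    finally show ?thesis using mean(2) by (simp add: Q_def matrix_mul_assoc)
  qed
  note Wm = eigenbasisD[OF W(2)]
  \<comment> \<open>With this choice \<open>Gs\<close> on the columns of \<open>U\<close> and
    \<open>Gt\<close> on those of \<open>Wm\<close> have the same matrix \<open>\<Gamma>\<close>,
    and the mixed matrix of \<open>Km\<close> is \<open>\<Gamma> ** diag lm\<close>. The minors of
    \<open>\<Gamma>\<close> therefore cancel at the end and leave the products of
    eigenvalues.\<close>
  define U where "U = R ** Wm"
  define \<Gamma> where "\<Gamma> = transpose Wm ** Gt ** Wm"
  have detR: "det R \<noteq> 0" using GR pd_det_pos[OF pd(2)] det_mul[of Gs R] by auto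
  have detQ: "det Q \<noteq> 0" using KQ pd_det_pos[OF pd(5)] det_mul[of Ks Q] by auto
  have detU: "det U \<noteq> 0" using detR Wm(5) by (simp add: U_def det_mul)
  have UGs: "transpose U ** Gs ** U = \<Gamma>"
    by (simp add: U_def \<Gamma>_def RGm[symmetric] GR[symmetric] matrix_transpose_mul matrix_mul_assoc)
  have UKW: "transpose U ** Km ** Wm = \<Gamma> ** diag lm"
  proof -
    have "transpose U ** Km ** Wm = transpose Wm ** (transpose R ** Gm) ** Wm ** diag lm"
      using Wm(2) by (simp add: U_def matrix_transpose_mul matrix_mul_assoc[symmetric])
    then show ?thesis by (simp add: RGm \<Gamma>_def)
  qed
  have pdG: "pd \<Gamma>" unfolding \<Gamma>_def by (rule pd_congruence[OF pd(3) Wm(5)])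
  have g: "0 < det (blk I \<Gamma>)" by (rule pd_det_pos[OF pd_blk[OF pdG]])
  have X: "pd (transpose U ** Ks ** U)" by (rule pd_congruence[OF pd(4) detU])
  have Z: "pd (transpose Wm ** Kt ** Wm)" by (rule pd_congruence[OF pd(6) Wm(5)])
  have "(det (blk I (transpose U ** Km ** Wm)))\<^sup>2
     \<le> det (blk I (transpose U ** Ks ** U)) * det (blk I (transpose Wm ** Kt ** Wm))"
  proof (rule det_cauchy_schwarz[OF pd_blk[OF X] pd_blk[OF Z]])
    fix u v :: "'n rvec"
    \<comment> \<open>Completing the square: the whole expression is \<open>Ks\<close> evaluated at
      \<open>p + q\<close> plus the squared length of \<open>r\<close>, which collects the padding
      of all three blocks.\<close>
    define p where "p = U *v coord_proj I u"
    define q where "q = Q *v (Wm *v coord_proj I v)"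
    define r where "r = u - coord_proj I u + (v - coord_proj I v)"
    have 1: "p \<bullet> (Km *v (Wm *v coord_proj I v)) = p \<bullet> (Ks *v q)"
      by (simp add: KQ[symmetric] q_def matrix_vector_mul_assoc matrix_mul_assoc)
    have 2: "(Wm *v coord_proj I v) \<bullet> (Kt *v (Wm *v coord_proj I v)) = q \<bullet> (Ks *v q)"
      unfolding QKm[symmetric] KQ[symmetric] q_def
      using congruence_form[of "Wm *v coord_proj I v" Q Ks Q "Wm *v coord_proj I v"]
      by (simp add: matrix_mul_assoc)
    have "0 \<le> (p + q) \<bullet> (Ks *v (p + q)) + r \<bullet> r"
      using form_le_zero[OF pd(4)] by simp
    then show "0 \<le> u \<bullet> (blk I (transpose U ** Ks ** U) *v u)
      + 2 * (u \<bullet> (blk I (transpose U ** Km ** Wm) *v v)) + v \<bullet> (blk I (transpose Wm ** Kt ** Wm) *v v)"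
      using sym_form[of Ks p q] pd(4)
      unfolding blk_form congruence_form p_def[symmetric] 1 2 r_def pd_def
      by (simp add: matrix_vector_right_distrib inner_add_left inner_add_right) (simp add: inner_commute)
  qed
  also have "\<dots> \<le> (prod ls I * det (blk I (transpose U ** Gs ** U))) * (prod lt I * det (blk I (transpose Wm ** Gt ** Wm)))"
    using det_blk_congruence_le[OF W(1) pd(4) detU I] det_blk_congruence_le[OF W(3) pd(6) Wm(5) I]
      pd_det_pos[OF pd_blk[OF X, of I]] pd_det_pos[OF pd_blk[OF Z, of I]]
    by (intro mult_mono) linarith+
  also have "\<dots> = (prod ls I * prod lt I) * (det (blk I \<Gamma>))\<^sup>2"
    unfolding UGs \<Gamma>_def[symmetric] by (simp add: power2_eq_square)
  finally have "(prod lm I)\<^sup>2 * (det (blk I \<Gamma>))\<^sup>2 \<le> (prod ls I * prod lt I) * (det (blk I \<Gamma>))\<^sup>2"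
    by (simp add: UKW blk_mult_diag det_mul det_blk_diag power_mult_distrib mult.commute)
  then show ?thesis using g by (simp add: mult_le_cancel_right)
qed

lemma det_blk_scale:
  fixes S :: "real^'n^'n"
  assumes "c \<ge> 0"
  shows "det (blk I (c *\<^sub>R S)) = c ^ card I * det (blk I S)"
proof -
  have "blk I (c *\<^sub>R S) = diag (\<lambda>i. if i \<in> I then c else 1) ** blk I S"
    by (auto simp: vec_eq_iff diag_matrix_mult blk_def)
  then show ?thesis by (simp add: det_mul det_diag prod.If_cases)
qed

lemma pd_scale: "pd S \<Longrightarrow> c > 0 \<Longrightarrow> pd (c *\<^sub>R S)"
  by (simp add: pd_def transpose_scalar flip: scaleR_matrix_vector_assoc)

text \<open>Tested on the eigenbasis \<open>W'\<close>, the product \<open>prod l' I\<close> is a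
  minor of \<open>K'\<close>. Passing from \<open>K'\<close> to \<open>K\<close> and from
  \<open>G\<close> to \<open>G'\<close> costs a factor \<open>c ^ card I\<close> each. The case
  \<open>c = 1\<close> gives uniqueness of the eigenvalues, and \<open>c\<close> close to 1 their
  continuity.\<close>

lemma eigenvalues_compare:
  fixes G :: "'n::{finite,linorder} sqmat"
  assumes pd: "pd G" "pd K" "pd G'" "pd K'" and c: "c > 0"
    and le: "\<And>x. x \<bullet> (K' *v x) \<le> c * (x \<bullet> (K *v x))" "\<And>x. x \<bullet> (G *v x) \<le> c * (x \<bullet> (G' *v x))"
    and W: "eigenbasis G K W l" "eigenbasis G' K' W' l'"
    and I: "down_closed I"
  shows "prod l' I \<le> c ^ (2 * card I) * prod l I"
proof -
  note W' = eigenbasisD[OF W(2)]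
  have mono: "det (blk I (transpose W' ** S ** W')) \<le> c ^ card I * det (blk I (transpose W' ** Z ** W'))"
    if "pd S" "pd Z" "\<And>x. x \<bullet> (S *v x) \<le> c * (x \<bullet> (Z *v x))" for S Z
  proof -
    have "det (blk I (transpose W' ** S ** W')) \<le> det (blk I (c *\<^sub>R (transpose W' ** Z ** W')))"
      using that c by (intro det_blk_mono pd_scale pd_congruence W')
        (auto simp: congruence_form simp flip: scaleR_matrix_vector_assoc)
    then show ?thesis using c by (simp add: det_blk_scale)
  qed
  have lp: "0 \<le> prod l I" using eigenbasis_pos[OF W(1) pd(2)] by (intro prod_nonneg) (auto simp: less_imp_le)
  have "prod l' I = det (blk I (transpose W' ** K' ** W'))" by (simp add: W' det_blk_diag)
  also have "\<dots> \<le> c ^ card I * det (blk I (transpose W' ** K ** W'))"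
    by (rule mono[OF pd(4,2) le(1)])
  also have "\<dots> \<le> c ^ card I * (prod l I * det (blk I (transpose W' ** G ** W')))"
    using det_blk_congruence_le[OF W(1) pd(2) W'(5) I] c by (intro mult_left_mono) auto
  also have "\<dots> \<le> c ^ card I * (prod l I * (c ^ card I * det (blk I (transpose W' ** G' ** W'))))"
    using mono[OF pd(1,3) le(2)] c lp by (intro mult_left_mono) auto
  also have "\<dots> = c ^ (2 * card I) * prod l I"
    by (simp add: W' blk_mat_1 mult_2 power_add)
  finally show ?thesis .
qed

section \<open>Calculus of \<open>C\<^sup>k\<close> functions\<close>

lemma frechet_derivative_eqI:
  "(F has_derivative F') (at x) \<Longrightarrow> frechet_derivative F (at x) = F'"
  by (rule frechet_derivative_at[symmetric])

lemma frechet_derivative_cong: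
  assumes "open S" "x \<in> S" "\<And>y. y \<in> S \<Longrightarrow> F y = G y"
  shows "frechet_derivative F (at x) = frechet_derivative G (at x)"
proof -
  have "(F has_derivative D) (at x) \<longleftrightarrow> (G has_derivative D) (at x)" for D
    using has_derivative_transform_within_open[OF _ assms(1,2), of F D UNIV G]
      has_derivative_transform_within_open[OF _ assms(1,2), of G D UNIV F] assms(3) by auto
  then show ?thesis by (simp add: frechet_derivative_def)
qed

lemma differentiable_cong_open:
  assumes "open S" "x \<in> S" "\<And>y. y \<in> S \<Longrightarrow> F y = G y" "F differentiable (at x)"
  shows "G differentiable (at x)"
  using has_derivative_transform_within_open[OF _ assms(1,2), of F _ UNIV G] assms(3,4)
  unfolding differentiable_def by blast

lemma iter_deriv_cong:
  assumes "open S" "\<And>y. y \<in> S \<Longrightarrow> F y = G y"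
  shows "x \<in> S \<Longrightarrow> iter_deriv vs F x = iter_deriv vs G x"
proof (induction vs arbitrary: x)
  case (Cons v vs)
  then show ?case using frechet_derivative_cong[OF assms(1), of x "iter_deriv vs F" "iter_deriv vs G"]
    by simp
qed (use assms in simp)

lemma iter_deriv_append: "iter_deriv (vs @ ws) F = iter_deriv vs (iter_deriv ws F)"
  by (induction vs) auto

lemma Ck_on_cong:
  assumes S: "open S" and eq: "\<And>y. y \<in> S \<Longrightarrow> F y = G y" and F: "Ck_on k S F"
  shows "Ck_on k S G"
  unfolding Ck_on_def
proof (intro conjI allI impI ballI)
  fix vs :: "'a list" assume vs: "length vs \<le> k"
  then have "continuous_on S (iter_deriv vs F)" using F by (simp add: Ck_on_def)
  then show "continuous_on S (iter_deriv vs G)"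
    by (subst continuous_on_cong[OF refl iter_deriv_cong[OF S eq[symmetric]]])
next
  fix vs :: "'a list" and x assume vs: "length vs < k" "x \<in> S"
  then have "iter_deriv vs F differentiable (at x)" using F by (auto simp: Ck_on_def)
  then show "iter_deriv vs G differentiable (at x)"
    by (intro differentiable_cong_open[OF S vs(2) iter_deriv_cong[OF S eq]])
qed

lemma Ck_on_0: "Ck_on 0 S F \<longleftrightarrow> continuous_on S F"
  by (simp add: Ck_on_def)

text \<open>\<open>iter_deriv\<close> recurses on the derivative taken last. Here the derivative
  taken first, the last element of the list, is split off, so that inductions on \<open>k\<close>
  can run over arbitrary functions.\<close>

lemma Ck_on_Suc:
  "Ck_on (Suc k) S F \<longleftrightarrow> continuous_on S F \<and> (\<forall>x\<in>S. F differentiable (at x)) \<and>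
     (\<forall>v. Ck_on k S (\<lambda>x. frechet_derivative F (at x) v))"
proof -
  have 1: "iter_deriv vs (\<lambda>x. frechet_derivative F (at x) v) = iter_deriv (vs @ [v]) F" for vs v
    by (simp add: iter_deriv_append)
  show ?thesis
  proof (intro iffI conjI allI ballI)
    assume F: "Ck_on (Suc k) S F"
    show "continuous_on S F" using F[unfolded Ck_on_def, THEN conjunct2, rule_format, of "[]"] by simp
    show "F differentiable (at x)" if "x \<in> S" for x
      using F[unfolded Ck_on_def, THEN conjunct1, rule_format, of "[]" x] that by simp
    show "Ck_on k S (\<lambda>x. frechet_derivative F (at x) v)" for v
      using F unfolding Ck_on_def 1 by simp
  next
    assume R: "continuous_on S F \<and> (\<forall>x\<in>S. F differentiable (at x)) \<and>
      (\<forall>v. Ck_on k S (\<lambda>x. frechet_derivative F (at x) v))"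
    show "Ck_on (Suc k) S F"
      unfolding Ck_on_def
    proof (intro conjI allI impI ballI)
      fix vs :: "'a list" assume "length vs \<le> Suc k"
      then show "continuous_on S (iter_deriv vs F)"
        using R by (cases vs rule: rev_cases) (auto simp: iter_deriv_append Ck_on_def)
    next
      fix vs :: "'a list" and x assume "length vs < Suc k" "x \<in> S"
      then show "iter_deriv vs F differentiable (at x)"
        using R by (cases vs rule: rev_cases) (auto simp: iter_deriv_append Ck_on_def)
    qed
  qed
qed

lemma Ck_on_subset: "Ck_on k S F \<Longrightarrow> T \<subseteq> S \<Longrightarrow> Ck_on k T F"
  unfolding Ck_on_def using continuous_on_subset by blast

lemma Ck_on_mono: "Ck_on k S F \<Longrightarrow> j \<le> k \<Longrightarrow> Ck_on j S F"
  unfolding Ck_on_def by auto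

lemma Ck_on_continuous: "Ck_on k S F \<Longrightarrow> continuous_on S F"
  using Ck_on_mono[of k S F 0] by (simp add: Ck_on_0)

lemma Ck_on_UN:
  assumes "\<And>i. i \<in> I \<Longrightarrow> open (S i)" "\<And>i. i \<in> I \<Longrightarrow> Ck_on k (S i) F"
  shows "Ck_on k (\<Union>i\<in>I. S i) F"
  using assms unfolding Ck_on_def by (auto intro!: continuous_on_open_UN)

lemma Ck_on_const: "Ck_on k S (\<lambda>x. c)"
proof (induction k arbitrary: c)
  case (Suc k)
  then show ?case by (simp add: Ck_on_Suc frechet_derivative_const)
qed (simp add: Ck_on_0)

lemma Ck_on_bounded_linear:
  assumes S: "open S" and L: "bounded_linear L" and F: "Ck_on k S F"
  shows "Ck_on k S (\<lambda>x. L (F x))"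
  using F
proof (induction k arbitrary: F)
  case 0
  then show ?case using bounded_linear.continuous_on[OF L] by (simp add: Ck_on_0)
next
  case (Suc k)
  have d: "((\<lambda>x. L (F x)) has_derivative (\<lambda>v. L (frechet_derivative F (at x) v))) (at x)" if "x \<in> S" for x
    using Suc.prems that bounded_linear.has_derivative[OF L] frechet_derivative_works
    unfolding Ck_on_Suc by blast
  have "Ck_on k S (\<lambda>x. frechet_derivative (\<lambda>x. L (F x)) (at x) v)" for v
    by (rule Ck_on_cong[OF S _ Suc.IH[of "\<lambda>x. frechet_derivative F (at x) v"]])
       (use Suc.prems frechet_derivative_eqI[OF d] in \<open>auto simp: Ck_on_Suc\<close>)
  then show ?case
    using Suc.prems d bounded_linear.continuous_on[OF L] by (auto simp: Ck_on_Suc differentiable_def)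
qed

lemma Ck_on_id: "Ck_on k S (\<lambda>x. x)"
proof (cases k)
  case (Suc j)
  have "frechet_derivative (\<lambda>x. x) (at x) v = v" for x v :: 'a
    by (simp add: frechet_derivative_eqI[OF has_derivative_ident])
  then show ?thesis using Suc by (simp add: Ck_on_Suc Ck_on_const)
qed (simp add: Ck_on_0)

lemma Ck_on_linear: "open S \<Longrightarrow> bounded_linear L \<Longrightarrow> Ck_on k S L"
  using Ck_on_bounded_linear[OF _ _ Ck_on_id] by blast

lemma Ck_on_add:
  assumes S: "open S" and F: "Ck_on k S F" and G: "Ck_on k S G"
  shows "Ck_on k S (\<lambda>x. F x + G x)"
  using F G
proof (induction k arbitrary: F G)
  case 0
  then show ?case by (simp add: Ck_on_0 continuous_on_add)
next
  case (Suc k)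
  have d: "((\<lambda>x. F x + G x) has_derivative
      (\<lambda>v. frechet_derivative F (at x) v + frechet_derivative G (at x) v)) (at x)" if "x \<in> S" for x
    using Suc.prems that has_derivative_add frechet_derivative_works unfolding Ck_on_Suc by blast
  have "Ck_on k S (\<lambda>x. frechet_derivative (\<lambda>x. F x + G x) (at x) v)" for v
    by (rule Ck_on_cong[OF S _ Suc.IH[of "\<lambda>x. frechet_derivative F (at x) v" "\<lambda>x. frechet_derivative G (at x) v"]])
       (use Suc.prems frechet_derivative_eqI[OF d] in \<open>auto simp: Ck_on_Suc\<close>)
  then show ?case
    using Suc.prems d by (auto simp: Ck_on_Suc differentiable_def intro: continuous_on_add)
qed

lemma Ck_on_sum:
  assumes "open S" "\<And>i. i \<in> I \<Longrightarrow> Ck_on k S (F i)"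
  shows "Ck_on k S (\<lambda>x. \<Sum>i\<in>I. F i x)"
  using assms(2) by (induction I rule: infinite_finite_induct) (auto simp: Ck_on_const intro: Ck_on_add[OF assms(1)])

lemma Ck_on_bilinear:
  assumes S: "open S" and B: "bounded_bilinear B" and F: "Ck_on k S F" and G: "Ck_on k S G"
  shows "Ck_on k S (\<lambda>x. B (F x) (G x))"
  using F G
proof (induction k arbitrary: F G)
  case 0
  then show ?case using bounded_bilinear.continuous_on[OF B] by (simp add: Ck_on_0)
next
  case (Suc k)
  have d: "((\<lambda>x. B (F x) (G x)) has_derivative
      (\<lambda>v. B (F x) (frechet_derivative G (at x) v) + B (frechet_derivative F (at x) v) (G x))) (at x)"
    if "x \<in> S" for x
    by (rule bounded_bilinear.FDERIV[OF B])
       (use Suc.prems that in \<open>auto simp: Ck_on_Suc frechet_derivative_works[symmetric]\<close>)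
  have FG: "Ck_on k S F" "Ck_on k S G" using Suc.prems Ck_on_mono by (meson le_SucI order_refl)+
  have "Ck_on k S (\<lambda>x. frechet_derivative (\<lambda>x. B (F x) (G x)) (at x) v)" for v
    by (rule Ck_on_cong[OF S _ Ck_on_add[OF S Suc.IH[of F "\<lambda>x. frechet_derivative G (at x) v"]
       Suc.IH[of "\<lambda>x. frechet_derivative F (at x) v" G]]])
       (use Suc.prems FG frechet_derivative_eqI[OF d] in \<open>auto simp: Ck_on_Suc\<close>)
  then show ?case
    using Suc.prems d bounded_bilinear.continuous_on[OF B] by (auto simp: Ck_on_Suc differentiable_def)
qed

lemma Ck_on_compose:
  assumes T: "open T" and S: "open S" and "\<phi> ` T \<subseteq> S" and F: "Ck_on k S F" and p: "Ck_on k T \<phi>"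
  shows "Ck_on k T (\<lambda>x. F (\<phi> x))"
  using assms(3) F p
proof (induction k arbitrary: F)
  case 0
  then show ?case by (auto simp: Ck_on_0 intro: continuous_on_compose2)
next
  case (Suc k)
  let ?DF = "\<lambda>y v. frechet_derivative F (at y) v" and ?Dp = "\<lambda>x v. frechet_derivative \<phi> (at x) v"
  have dF: "(F has_derivative ?DF y) (at y)" if "y \<in> S" for y
    using Suc.prems that frechet_derivative_works unfolding Ck_on_Suc by blast
  have dp: "(\<phi> has_derivative ?Dp x) (at x)" if "x \<in> T" for x
    using Suc.prems that frechet_derivative_works unfolding Ck_on_Suc by blast
  have d: "((\<lambda>x. F (\<phi> x)) has_derivative (\<lambda>v. ?DF (\<phi> x) (?Dp x v))) (at x)" if "x \<in> T" for x
    using has_derivative_compose[OF dp[OF that] dF] that Suc.prems(1) by blast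
  \<comment> \<open>In the chain rule the direction \<open>?Dp x v\<close> moves with
    \<open>x\<close>, while the induction hypothesis covers derivatives in fixed directions only;
    hence the expansion in basis directions.\<close>
  have expand: "?DF y w = (\<Sum>b\<in>Basis. (w \<bullet> b) *\<^sub>R ?DF y b)" if "y \<in> S" for y w
  proof -
    have "linear (?DF y)" using dF[OF that] has_derivative_linear by blast
    then show ?thesis
      using linear_sum[of "?DF y" "\<lambda>b. (w \<bullet> b) *\<^sub>R b" Basis] linear_scale[of "?DF y"]
      by (simp add: euclidean_representation)
  qed
  have p: "Ck_on k T \<phi>" using Suc.prems Ck_on_mono by (meson le_SucI order_refl)
  have "Ck_on k T (\<lambda>x. frechet_derivative (\<lambda>x. F (\<phi> x)) (at x) v)" for v
  proof (rule Ck_on_cong[OF T])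
    show "Ck_on k T (\<lambda>x. \<Sum>b\<in>Basis. (?Dp x v \<bullet> b) *\<^sub>R ?DF (\<phi> x) b)"
    proof (intro Ck_on_sum[OF T] Ck_on_bilinear[OF T bounded_bilinear_scaleR])
      fix b :: 'b
      show "Ck_on k T (\<lambda>x. ?Dp x v \<bullet> b)"
        using Suc.prems(3) by (intro Ck_on_bounded_linear[OF T bounded_linear_inner_left]) (simp add: Ck_on_Suc)
      show "Ck_on k T (\<lambda>x. ?DF (\<phi> x) b)"
        using Suc.IH[of "\<lambda>y. ?DF y b"] Suc.prems p by (simp add: Ck_on_Suc)
    qed
    fix y assume "y \<in> T"
    then show "(\<Sum>b\<in>Basis. (?Dp y v \<bullet> b) *\<^sub>R ?DF (\<phi> y) b) = frechet_derivative (\<lambda>x. F (\<phi> x)) (at y) v"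
      using expand[of "\<phi> y" "?Dp y v"] Suc.prems(1) frechet_derivative_eqI[OF d] by auto
  qed
  moreover have "continuous_on T (\<lambda>x. F (\<phi> x))"
    using Suc.prems by (auto simp: Ck_on_Suc intro: continuous_on_compose2)
  ultimately show ?case using d by (auto simp: Ck_on_Suc differentiable_def)
qed

lemma Ck_on_vec_lambda:
  fixes F :: "'n::finite \<Rightarrow> 'a::euclidean_space \<Rightarrow> 'b::euclidean_space"
  assumes S: "open S" and F: "\<And>i. Ck_on k S (F i)"
  shows "Ck_on k S (\<lambda>x. \<chi> i. F i x)"
proof -
  have "Ck_on k S (\<lambda>x. \<Sum>i\<in>UNIV. axis i (F i x))"
  proof (intro Ck_on_sum[OF S])
    fix i :: 'n
    have "bounded_linear (axis i :: 'b \<Rightarrow> 'b ^ 'n)"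
      by (intro linear_conv_bounded_linear[THEN iffD1] linearI) (auto simp: axis_def vec_eq_iff)
    then show "Ck_on k S (\<lambda>x. axis i (F i x))" by (rule Ck_on_bounded_linear[OF S _ F])
  qed
  moreover have "(\<Sum>i\<in>UNIV. axis i (F i x)) = (\<chi> i. F i x)" for x
    by (simp add: vec_eq_iff axis_def if_distrib cong: if_cong)
  ultimately show ?thesis by simp
qed

lemma bounded_bilinear_matrix_mult:
  "bounded_bilinear ((**) :: real^'n^'m \<Rightarrow> real^'k^'n \<Rightarrow> real^'k^'m)"
proof (rule bilinear_conv_bounded_bilinear[THEN iffD1], unfold bilinear_def, intro conjI allI linearI)
qed (auto simp: vec_eq_iff matrix_matrix_mult_def sum.distrib algebra_simps sum_distrib_left)

lemma bounded_linear_transpose: "bounded_linear (transpose :: real^'n^'m \<Rightarrow> real^'m^'n)"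
  by (intro linear_conv_bounded_linear[THEN iffD1] linearI) (auto simp: transpose_def vec_eq_iff)

lemma smooth_on_open:
  assumes "open S"
  shows "smooth_on S F \<longleftrightarrow> (\<forall>k. Ck_on k S F)"
proof
  assume "smooth_on S F"
  then obtain T H where "open T" "S \<subseteq> T" "\<forall>k. Ck_on k T H" "\<forall>x\<in>S. H x = F x"
    unfolding smooth_on_def by blast
  then show "\<forall>k. Ck_on k S F" using Ck_on_cong[OF assms, of H F] Ck_on_subset by blast
qed (use assms in \<open>auto simp: smooth_on_def\<close>)

lemma real_polynomial_function_Ck_on:
  "real_polynomial_function p \<Longrightarrow> open S \<Longrightarrow> Ck_on k S p"
  for p :: "'a::euclidean_space \<Rightarrow> real"
proof (induction rule: real_polynomial_function.induct)
  case (mult f g)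
  then show ?case by (intro Ck_on_bilinear[OF _ bounded_bilinear_mult])
qed (simp_all add: Ck_on_linear Ck_on_const Ck_on_add)

section \<open>Smooth bump functions\<close>

definition exp_bump :: "real \<Rightarrow> real" where
  "exp_bump x = (if x > 0 then exp (- inverse x) else 0)"

lemma poly_exp_inverse_tendsto_0:
  "((\<lambda>x. poly p (inverse x) * exp (- inverse x)) \<longlongrightarrow> 0) (at_right (0::real))"
proof -
  have "((\<lambda>x. poly p x * exp (- x)) \<longlongrightarrow> 0) (at_top :: real filter)"
  proof (induction p)
    case (pCons a p)
    have "((\<lambda>x. \<Sum>i\<le>degree q. coeff q i * (x ^ i / exp x)) \<longlongrightarrow> (\<Sum>i\<le>degree q. coeff q i * 0)) (at_top :: real filter)" for q :: "real poly"
      by (intro tendsto_intros tendsto_power_div_exp_0)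
    then have "((\<lambda>x. poly q x * exp (- x)) \<longlongrightarrow> 0) (at_top :: real filter)" for q :: "real poly"
      by (simp add: poly_altdef sum_distrib_right exp_minus divide_inverse mult.assoc)
    then show ?case .
  qed simp
  then show ?thesis by (rule filterlim_compose[OF _ filterlim_inverse_at_top_right])
qed

text \<open>Polynomial factors in \<open>inverse x\<close> make the family closed under
  differentiation: the derivative replaces \<open>p\<close> by
  \<open>(p - pderiv p) * [:0, 0, 1:]\<close>. At 0 the exponential beats every such factor.\<close>

lemma Ck_on_poly_exp_bump:
  "Ck_on k UNIV (\<lambda>x::real. if x > 0 then poly p (inverse x) * exp (- inverse x) else 0)"
    (is "Ck_on k UNIV (?h p)")
proof (induction k arbitrary: p)
  have deriv: "(?h p has_real_derivative ?h ((p - pderiv p) * [:0, 0, 1:]) x) (at x)" for p x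
  proof -
    consider "x > 0" | "x < 0" | "x = 0" by linarith
    then show ?thesis
    proof cases
      case 1
      have "((\<lambda>x. poly p (inverse x) * exp (- inverse x)) has_real_derivative
          ?h ((p - pderiv p) * [:0, 0, 1:]) x) (at x)"
        using 1 by (auto intro!: derivative_eq_intros simp: power2_eq_square algebra_simps)
      then show ?thesis
        by (rule has_field_derivative_transform_within_open[of _ _ _ "{0<..}"]) (use 1 in auto)
    next
      case 2
      have "((\<lambda>x. 0) has_real_derivative ?h ((p - pderiv p) * [:0, 0, 1:]) x) (at x)"
        using 2 by simp
      then show ?thesis
        by (rule has_field_derivative_transform_within_open[of _ _ _ "{..<0}"]) (use 2 in auto)
    next
      case 3
      have "((\<lambda>y. (?h p y - ?h p 0) / (y - 0)) \<longlongrightarrow> 0) (at_right 0)"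
        by (rule Lim_transform_eventually[OF poly_exp_inverse_tendsto_0[of "p * [:0, 1:]"]])
           (auto simp: eventually_at_filter field_simps)
      moreover have "((\<lambda>y. (?h p y - ?h p 0) / (y - 0)) \<longlongrightarrow> 0) (at_left 0)"
        by (rule Lim_transform_eventually[OF tendsto_const]) (auto simp: eventually_at_filter)
      ultimately have "((\<lambda>y. (?h p y - ?h p 0) / (y - 0)) \<longlongrightarrow> 0) (at 0)"
        by (simp add: filterlim_split_at)
      then show ?thesis using 3 by (simp add: has_field_derivative_iff)
    qed
  qed
  {
    case 0
    show ?case
      using deriv by (auto simp: Ck_on_0 intro!: continuous_at_imp_continuous_on DERIV_isCont)
  next
    case (Suc k)
    have "frechet_derivative (?h p) (at x) v = v * ?h ((p - pderiv p) * [:0, 0, 1:]) x" for x v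
      using frechet_derivative_eqI[OF deriv[of p x, unfolded has_field_derivative_def]] by simp
    moreover have "Ck_on k UNIV (\<lambda>x. v * ?h ((p - pderiv p) * [:0, 0, 1:]) x)" for v
      by (rule Ck_on_bounded_linear[OF open_UNIV bounded_linear_mult_right Suc.IH])
    moreover have "?h p differentiable (at x)" for x
      using deriv[of p x] unfolding differentiable_def has_field_derivative_def by blast
    moreover have "continuous_on UNIV (?h p)"
      using deriv by (intro continuous_at_imp_continuous_on ballI DERIV_isCont)
    ultimately show ?case unfolding Ck_on_Suc by simp
  }
qed

lemma Ck_on_exp_bump: "Ck_on k UNIV exp_bump"
  using Ck_on_poly_exp_bump[of k 1] unfolding exp_bump_def[abs_def] by (simp cong: if_cong)

definition ball_bump :: "'a::euclidean_space \<Rightarrow> real \<Rightarrow> 'a \<Rightarrow> real" where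
  "ball_bump a r y = exp_bump (r\<^sup>2 - (y - a) \<bullet> (y - a))"

lemma Ck_on_ball_bump: "Ck_on k UNIV (ball_bump a r)"
proof -
  have "Ck_on k UNIV (\<lambda>y. r\<^sup>2 + (- 1) *\<^sub>R ((y + (- a)) \<bullet> (y + (- a))))"
    by (intro Ck_on_add[OF open_UNIV] Ck_on_const Ck_on_bilinear[OF open_UNIV bounded_bilinear_inner]
        Ck_on_bilinear[OF open_UNIV bounded_bilinear_scaleR] Ck_on_id)
  then have "Ck_on k UNIV (\<lambda>y. exp_bump (r\<^sup>2 + (- 1) *\<^sub>R ((y + (- a)) \<bullet> (y + (- a)))))"
    by (intro Ck_on_compose[OF open_UNIV open_UNIV _ Ck_on_exp_bump]) auto
  then show ?thesis by (simp add: ball_bump_def[abs_def])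
qed

lemma ball_bump_nonneg: "0 \<le> ball_bump a r y"
  by (simp add: ball_bump_def exp_bump_def)

lemma ball_bump_pos_iff:
  assumes "r > 0"
  shows "0 < ball_bump a r y \<longleftrightarrow> y \<in> ball a r"
proof -
  have "(y - a) \<bullet> (y - a) < r\<^sup>2 \<longleftrightarrow> dist a y < r"
    using assms norm_lt_square[of "y - a" r] by (simp add: dist_norm norm_minus_commute)
  then show ?thesis by (auto simp: ball_bump_def exp_bump_def)
qed

section \<open>Change of variables\<close>

text \<open>The change-of-variables theorem of the library is stated for well-ordered index types. A
  finite linear order is a well-order, but this is not visible to the type class system; so we
  transport the theorem along a copy of the index type.\<close>

typedef (overloaded) 'n wcopy = "UNIV :: 'n set" ..

instance wcopy :: (finite) finite
proof
  have "surj (Abs_wcopy :: 'a \<Rightarrow> 'a wcopy)" by (metis surjI Rep_wcopy_inverse)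
  then show "finite (UNIV :: 'a wcopy set)" by (metis finite finite_imageI)
qed

instantiation wcopy :: ("{finite,linorder}") wellorder
begin

definition less_eq_wcopy :: "'a wcopy \<Rightarrow> 'a wcopy \<Rightarrow> bool" where
  "less_eq_wcopy x y \<longleftrightarrow> Rep_wcopy x \<le> Rep_wcopy y"
definition less_wcopy :: "'a wcopy \<Rightarrow> 'a wcopy \<Rightarrow> bool" where
  "less_wcopy x y \<longleftrightarrow> Rep_wcopy x < Rep_wcopy y"

instance
proof
  fix P :: "'a wcopy \<Rightarrow> bool" and a
  assume step: "\<And>x. (\<And>y. y < x \<Longrightarrow> P y) \<Longrightarrow> P x"
  have "wf {(x, y :: 'a). x < y}"
    by (rule wf_subset[OF wf_measure[of "\<lambda>x. card {..<x}"]])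
       (auto intro!: psubset_card_mono)
  then have "P (Abs_wcopy b)" for b
  proof (induction b rule: wf_induct_rule)
    case (less b)
    show ?case
    proof (rule step)
      fix y assume "y < Abs_wcopy b"
      then show "P y" using less[of "Rep_wcopy y"]
        by (simp add: less_wcopy_def Abs_wcopy_inverse Rep_wcopy_inverse)
    qed
  qed
  then show "P a" by (metis Rep_wcopy_inverse)
qed (auto simp: less_eq_wcopy_def less_wcopy_def less_le Rep_wcopy_inject)

end

definition to_wcopy :: "real^'n \<Rightarrow> real^('n wcopy)" where
  "to_wcopy x = (\<chi> i. x $ Rep_wcopy i)"

definition of_wcopy :: "real^('n wcopy) \<Rightarrow> real^'n" where
  "of_wcopy x = (\<chi> i. x $ Abs_wcopy i)"

lemma of_to_wcopy [simp]: "of_wcopy (to_wcopy x) = x" "to_wcopy (of_wcopy y) = y"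
  by (simp_all add: of_wcopy_def to_wcopy_def vec_eq_iff Abs_wcopy_inverse Rep_wcopy_inverse)

lemma linear_to_wcopy: "bounded_linear to_wcopy" and linear_of_wcopy: "bounded_linear of_wcopy"
  by (intro linear_conv_bounded_linear[THEN iffD1] linearI;
      simp add: to_wcopy_def of_wcopy_def vec_eq_iff)+

lemma bij_Rep_wcopy: "bij Rep_wcopy" and bij_Abs_wcopy: "bij Abs_wcopy"
  by (metis bij_betw_def bijI' UNIV_I Rep_wcopy_inject Abs_wcopy_inverse Rep_wcopy_inverse)+

lemma prod_wcopy: "(\<Prod>i\<in>UNIV. f (Rep_wcopy i)) = (\<Prod>i\<in>(UNIV :: 'n set). f i)"
  using bij_Rep_wcopy by (rule prod.reindex_bij_betw)

lemma measurable_to_wcopy [measurable]: "to_wcopy \<in> borel_measurable borel"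
  and measurable_of_wcopy [measurable]: "of_wcopy \<in> borel_measurable borel"
  by (intro borel_measurable_continuous_onI linear_continuous_on linear_to_wcopy linear_of_wcopy)+

lemma prod_Basis_cart: "(\<Prod>b\<in>Basis. (x :: real^'n) \<bullet> b) = (\<Prod>i\<in>UNIV. x $ i)"
proof -
  have B: "(Basis :: (real^'n) set) = (\<lambda>i. axis i 1) ` UNIV" by (auto simp: Basis_vec_def)
  have inj: "inj (\<lambda>i. axis i 1 :: real^'n)" by (auto simp: inj_def axis_eq_axis)
  show ?thesis unfolding B prod.reindex[OF inj] by (simp add: inner_axis o_def)
qed

text \<open>Lebesgue measure is determined by the volumes of boxes, and renaming coordinates only
  permutes the factors of such a volume.\<close>

lemma distr_to_wcopy: "distr lborel borel (to_wcopy :: real^'n \<Rightarrow> real^('n wcopy)) = lborel"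
proof (rule lborel_eqI[symmetric])
  fix l u :: "real^('n wcopy)"
  assume lu: "\<And>b. b \<in> Basis \<Longrightarrow> l \<bullet> b \<le> u \<bullet> b"
  have lu': "l $ i \<le> u $ i" for i using lu[of "axis i 1"] by (simp add: inner_axis)
  have "to_wcopy -` box l u = box (of_wcopy l) (of_wcopy u)"
    unfolding mem_box_cart set_eq_iff vimage_def mem_Collect_eq
    by (simp add: to_wcopy_def of_wcopy_def) (metis Rep_wcopy_inverse Abs_wcopy_inverse UNIV_I)
  then have "emeasure (distr lborel borel to_wcopy) (box l u) = emeasure lborel (box (of_wcopy l) (of_wcopy u))"
    by (simp add: emeasure_distr)
  also have "\<dots> = (\<Prod>b\<in>Basis. (of_wcopy u - of_wcopy l) \<bullet> b)"
    using lu' by (intro emeasure_lborel_box) (auto simp: Basis_vec_def inner_axis of_wcopy_def)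
  also have "(\<Prod>b\<in>Basis. (of_wcopy u - of_wcopy l) \<bullet> b) = (\<Prod>i\<in>UNIV. of_wcopy u $ i - of_wcopy l $ i)"
    by (simp add: prod_Basis_cart)
  also have "\<dots> = (\<Prod>i\<in>UNIV. u $ i - l $ i)"
    using prod_wcopy[of "\<lambda>i. of_wcopy u $ i - of_wcopy l $ i"] by (simp add: of_wcopy_def Rep_wcopy_inverse)
  also have "\<dots> = (\<Prod>b\<in>Basis. (u - l) \<bullet> b)"
    by (simp add: prod_Basis_cart)
  finally show "emeasure (distr lborel borel to_wcopy) (box l u) = (\<Prod>b\<in>Basis. (u - l) \<bullet> b)" .
qed simp

lemma swapidseq_wcopy:
  "swapidseq k p \<Longrightarrow> swapidseq k (Abs_wcopy \<circ> p \<circ> Rep_wcopy)"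
proof (induction rule: swapidseq.induct)
  case id
  then show ?case by (simp add: comp_def Rep_wcopy_inverse swapidseq.id[unfolded id_def] id_def)
next
  case (comp_Suc n p a b)
  have "Abs_wcopy \<circ> (Transposition.transpose a b \<circ> p) \<circ> Rep_wcopy
    = Transposition.transpose (Abs_wcopy a) (Abs_wcopy b) \<circ> (Abs_wcopy \<circ> p \<circ> Rep_wcopy)"
    by (auto simp: fun_eq_iff Transposition.transpose_def Abs_wcopy_inject)
  moreover have "Abs_wcopy a \<noteq> Abs_wcopy b" using comp_Suc by (simp add: Abs_wcopy_inject)
  ultimately show ?case using comp_Suc swapidseq.comp_Suc by metis
qed

text \<open>Conjugation by the renaming carries transpositions to transpositions, so the parity of
  their number is kept.\<close>

lemma sign_wcopy:
  fixes p :: "'n::finite \<Rightarrow> 'n"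
  assumes "permutation p"
  shows "sign (Abs_wcopy \<circ> p \<circ> Rep_wcopy) = sign p"
proof -
  obtain k where "swapidseq k p" using assms by (auto simp: permutation_def)
  then show ?thesis
    using swapidseq_wcopy[of k p] evenperm_unique[of k _ "even k"] by (metis sign_def)
qed

lemma det_wcopy:
  fixes B :: "real^'n^'n"
  shows "det (\<chi> i j. B $ Rep_wcopy i $ Rep_wcopy j) = det B"
proof -
  let ?c = "\<lambda>p. Abs_wcopy \<circ> p \<circ> Rep_wcopy"
  have "(\<Sum>p\<in>{p. p permutes UNIV}. of_int (sign p) * (\<Prod>i\<in>UNIV. B $ Rep_wcopy i $ Rep_wcopy (p i)))
     = (\<Sum>p\<in>{p. p permutes UNIV}. of_int (sign (?c p)) * (\<Prod>i\<in>UNIV. B $ Rep_wcopy i $ Rep_wcopy (?c p i)))"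
  proof (rule sum.reindex_bij_witness[of _ ?c "\<lambda>p. Rep_wcopy \<circ> p \<circ> Abs_wcopy"])
    show "?c p \<in> {p. p permutes UNIV}" if "p \<in> {p. p permutes UNIV}" for p
      using that by (auto intro!: bij_imp_permutes bij_comp bij_Rep_wcopy bij_Abs_wcopy permutes_bij
        simp del: comp_apply)
    show "Rep_wcopy \<circ> p \<circ> Abs_wcopy \<in> {p. p permutes UNIV}" if "p \<in> {p. p permutes UNIV}" for p
      using that by (auto intro!: bij_imp_permutes bij_comp bij_Rep_wcopy bij_Abs_wcopy permutes_bij
        simp del: comp_apply)
    have c: "?c (Rep_wcopy \<circ> p \<circ> Abs_wcopy) = p" "Rep_wcopy \<circ> ?c q \<circ> Abs_wcopy = q" for p :: "'n wcopy \<Rightarrow> 'n wcopy" and q :: "'n \<Rightarrow> 'n"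
      by (auto simp: fun_eq_iff Rep_wcopy_inverse Abs_wcopy_inverse)
    show "?c (Rep_wcopy \<circ> p \<circ> Abs_wcopy) = p" for p :: "'n wcopy \<Rightarrow> 'n wcopy" by (rule c)
    show "Rep_wcopy \<circ> ?c q \<circ> Abs_wcopy = q" for q :: "'n \<Rightarrow> 'n" by (rule c)
    show "of_int (sign (?c (Rep_wcopy \<circ> p \<circ> Abs_wcopy))) * (\<Prod>i\<in>UNIV. B $ Rep_wcopy i $ Rep_wcopy (?c (Rep_wcopy \<circ> p \<circ> Abs_wcopy) i))
      = of_int (sign p) * (\<Prod>i\<in>UNIV. B $ Rep_wcopy i $ Rep_wcopy (p i))" for p
      unfolding c ..
  qed
  also have "\<dots> = (\<Sum>p\<in>{p. p permutes UNIV}. of_int (sign p) * (\<Prod>i\<in>UNIV. B $ i $ p i))"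
  proof (rule sum.cong[OF refl])
    fix p :: "'n \<Rightarrow> 'n" assume "p \<in> {p. p permutes UNIV}"
    then have "sign (?c p) = sign p"
      by (intro sign_wcopy) (auto simp: permutation_permutes)
    then show "of_int (sign (?c p)) * (\<Prod>i\<in>UNIV. B $ Rep_wcopy i $ Rep_wcopy (?c p i))
        = of_int (sign p) * (\<Prod>i\<in>UNIV. B $ i $ p i)"
      using prod_wcopy[of "\<lambda>i. B $ i $ p i"] by (simp add: Abs_wcopy_inverse)
  qed
  finally show ?thesis by (simp add: det_def)
qed


text \<open>Translates between a finite value of the extended integral and absolute integrability
  with that value, the form in which the change of variables is applied.\<close>

lemma nn_integral_eq_iff_absolutely_integrable:
  fixes h :: "'a::euclidean_space \<Rightarrow> real"
  assumes [measurable]: "(\<lambda>x. indicator S x * h x) \<in> borel_measurable borel" and h: "\<And>x. 0 \<le> h x" and b: "0 \<le> b"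
  shows "(\<integral>\<^sup>+x. ennreal (h x) * indicator S x \<partial>lborel) = ennreal b \<longleftrightarrow>
    h absolutely_integrable_on S \<and> integral S h = b"
proof -
  have 1: "(\<integral>\<^sup>+x. ennreal (h x) * indicator S x \<partial>lborel) = (\<integral>\<^sup>+x. ennreal (indicator S x * h x) \<partial>lborel)"
    by (intro nn_integral_cong) (auto simp: indicator_def)
  have 2: "h absolutely_integrable_on S \<longleftrightarrow> integrable lborel (\<lambda>x. indicator S x * h x)"
    by (simp add: set_integrable_def integrable_completion)
  have 3: "integral S h = (\<integral>x. indicator S x * h x \<partial>lborel)" if "h absolutely_integrable_on S"
    using set_lebesgue_integral_eq_integral(2)[OF that]
    by (simp add: set_lebesgue_integral_def integral_completion)
  show ?thesis
  proof
    assume L: "(\<integral>\<^sup>+x. ennreal (h x) * indicator S x \<partial>lborel) = ennreal b"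
    have "integrable lborel (\<lambda>x. indicator S x * h x)"
      by (rule integrableI_nn_integral_finite[of _ _ b]) (use L h b in \<open>auto simp: 1\<close>)
    moreover have "(\<integral>x. indicator S x * h x \<partial>lborel) = b"
      by (subst integral_eq_nn_integral) (use L h b in \<open>auto simp: 1\<close>)
    ultimately show "h absolutely_integrable_on S \<and> integral S h = b" using 2 3 by simp
  next
    assume R: "h absolutely_integrable_on S \<and> integral S h = b"
    then have "integrable lborel (\<lambda>x. indicator S x * h x)" using 2 by simp
    then show "(\<integral>\<^sup>+x. ennreal (h x) * indicator S x \<partial>lborel) = ennreal b"
      unfolding 1 using R h by (subst nn_integral_eq_integral) (auto simp: 3)
  qed
qed

lemma nn_integral_change_of_variables_wellorder:
  fixes T :: "'n::{finite,wellorder} rvec \<Rightarrow> 'n rvec"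
  assumes S: "S \<in> sets borel" and TS: "T ` S \<in> sets borel"
    and T: "\<And>x. x \<in> S \<Longrightarrow> (T has_derivative T' x) (at x)" and inj: "inj_on T S"
    and f: "f \<in> borel_measurable borel" "\<And>x. 0 \<le> f x"
    and m: "(\<lambda>x. indicator S x * (\<bar>det (matrix (T' x))\<bar> * f (T x))) \<in> borel_measurable borel"
  shows "(\<integral>\<^sup>+y. ennreal (f y) * indicator (T ` S) y \<partial>lborel) =
    (\<integral>\<^sup>+x. ennreal (\<bar>det (matrix (T' x))\<bar> * f (T x)) * indicator S x \<partial>lborel)" (is "?L = ?R")
proof -
  let ?v = "vec :: real \<Rightarrow> real^1"
  \<comment> \<open>Comparing the two sides with every finite value is enough: if neither takes a
    finite value, both are infinite.\<close>
  have "?L = ennreal b \<longleftrightarrow> ?R = ennreal b" if b: "0 \<le> b" for b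
  proof -
    have "(\<lambda>x. indicator (T ` S) x * f x) \<in> borel_measurable borel" using TS f by measurable
    then have "?L = ennreal b \<longleftrightarrow> f absolutely_integrable_on (T ` S) \<and> integral (T ` S) f = b"
      by (rule nn_integral_eq_iff_absolutely_integrable[OF _ f(2) b])
    also have "\<dots> \<longleftrightarrow> (\<lambda>x. \<bar>det (matrix (T' x))\<bar> * f (T x)) absolutely_integrable_on S \<and>
        integral S (\<lambda>x. \<bar>det (matrix (T' x))\<bar> * f (T x)) = b"
      using has_absolute_integral_change_of_variables[of S T T' "\<lambda>x. ?v (f x)" "?v b"]
        S has_derivative_at_withinI[OF T] inj
      by (simp add: absolutely_integrable_on_1_iff integral_on_1_eq vec_eq_iff o_def)
    also have "\<dots> \<longleftrightarrow> ?R = ennreal b"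
      by (rule nn_integral_eq_iff_absolutely_integrable[OF m _ b, symmetric]) (simp add: f)
    finally show ?thesis .
  qed
  note * = this
  show ?thesis
  proof (cases ?L)
    case (real b)
    then show ?thesis using *[of b] by simp
  next
    case top
    have "?R \<noteq> ennreal b" if "0 \<le> b" for b using *[OF that] top by simp
    then show ?thesis using top by (cases ?R) auto
  qed
qed

lemma nn_integral_change_of_variables:
  fixes T :: "'n::{finite,linorder} rvec \<Rightarrow> 'n rvec"
  assumes S: "S \<in> sets borel" and TS: "T ` S \<in> sets borel"
    and T: "\<And>x. x \<in> S \<Longrightarrow> (T has_derivative T' x) (at x)" and inj: "inj_on T S"
    and f: "f \<in> borel_measurable borel" "\<And>x. 0 \<le> f x"
    and m: "(\<lambda>x. indicator S x * (\<bar>det (matrix (T' x))\<bar> * f (T x))) \<in> borel_measurable borel"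
  shows "(\<integral>\<^sup>+y. ennreal (f y) * indicator (T ` S) y \<partial>lborel) =
    (\<integral>\<^sup>+x. ennreal (\<bar>det (matrix (T' x))\<bar> * f (T x)) * indicator S x \<partial>lborel)"
proof -
  define T2 where "T2 = (\<lambda>y. to_wcopy (T (of_wcopy y)))"
  define T2' where "T2' = (\<lambda>y v. to_wcopy (T' (of_wcopy y) (of_wcopy v)))"
  define S2 where "S2 = of_wcopy -` S"
  define f2 where "f2 = (\<lambda>y. f (of_wcopy y))"
  have TS2: "T2 ` S2 = of_wcopy -` (T ` S)"
    unfolding T2_def S2_def by (auto simp: image_iff vimage_def) (metis of_to_wcopy)+
  have axis: "of_wcopy (axis j 1) = axis (Rep_wcopy j) 1" for j :: "'n wcopy"
    by (auto simp: of_wcopy_def axis_def vec_eq_iff Abs_wcopy_inverse Rep_wcopy_inverse)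
  have det: "det (matrix (T2' y)) = det (matrix (T' (of_wcopy y)))" for y
    unfolding det_wcopy[of "matrix (T' (of_wcopy y))", symmetric]
    by (intro arg_cong[of _ _ det]) (simp add: matrix_def T2'_def axis to_wcopy_def vec_eq_iff)
  have of_image: "of_wcopy -` X \<in> sets borel" if "X \<in> sets borel" for X :: "('n rvec) set"
    using measurable_sets[OF measurable_of_wcopy that] by simp
  have 1: "(\<integral>\<^sup>+y. ennreal (f2 y) * indicator (T2 ` S2) y \<partial>lborel) =
    (\<integral>\<^sup>+x. ennreal (\<bar>det (matrix (T2' x))\<bar> * f2 (T2 x)) * indicator S2 x \<partial>lborel)"
  proof (rule nn_integral_change_of_variables_wellorder)
    show "S2 \<in> sets borel" unfolding S2_def by (rule of_image[OF S])
    show "T2 ` S2 \<in> sets borel" unfolding TS2 by (rule of_image[OF TS])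
    show "(T2 has_derivative T2' x) (at x)" if "x \<in> S2" for x
      unfolding T2_def T2'_def
      by (rule bounded_linear.has_derivative[OF linear_to_wcopy],
          rule has_derivative_compose[OF bounded_linear.has_derivative[OF linear_of_wcopy has_derivative_ident] T])
         (use that in \<open>simp add: S2_def\<close>)
    show "inj_on T2 S2"
      using inj unfolding inj_on_def T2_def S2_def by (metis of_to_wcopy vimageE)
    show "f2 \<in> borel_measurable borel" unfolding f2_def using f(1) by measurable
    show "(\<lambda>x. indicator S2 x * (\<bar>det (matrix (T2' x))\<bar> * f2 (T2 x))) \<in> borel_measurable borel"
      using measurable_compose[OF measurable_of_wcopy m]
      by (simp add: det f2_def T2_def S2_def indicator_def vimage_def)
  qed (simp add: f2_def f)
  have tr: "(\<integral>\<^sup>+y. g y \<partial>lborel) = (\<integral>\<^sup>+x. g (to_wcopy x) \<partial>lborel)" if [measurable]: "g \<in> borel_measurable borel"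
    for g :: "(real, 'n wcopy) vec \<Rightarrow> ennreal"
    by (subst distr_to_wcopy[symmetric]) (simp add: nn_integral_distr)
  have m1: "(\<lambda>y. ennreal (f2 y) * indicator (T2 ` S2) y) \<in> borel_measurable borel"
    unfolding TS2 f2_def using f(1) of_image[OF TS] by measurable
  have "(\<lambda>x. ennreal (indicator S x * (\<bar>det (matrix (T' x))\<bar> * f (T x)))) \<in> borel_measurable borel"
    using m by measurable
  from measurable_compose[OF measurable_of_wcopy this]
  have "(\<lambda>x. ennreal (indicator S2 x * (\<bar>det (matrix (T2' x))\<bar> * f2 (T2 x)))) \<in> borel_measurable borel"
    by (simp add: det f2_def T2_def S2_def indicator_def vimage_def)
  moreover have "ennreal (indicator S2 x * (\<bar>det (matrix (T2' x))\<bar> * f2 (T2 x))) =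
      ennreal (\<bar>det (matrix (T2' x))\<bar> * f2 (T2 x)) * indicator S2 x" for x
    by (simp add: indicator_def)
  ultimately have m2: "(\<lambda>x. ennreal (\<bar>det (matrix (T2' x))\<bar> * f2 (T2 x)) * indicator S2 x) \<in> borel_measurable borel"
    by simp
  show ?thesis
    using 1[unfolded tr[OF m1] tr[OF m2]] unfolding TS2
    by (simp add: det f2_def T2_def S2_def indicator_def)
qed

section \<open>Charts and coordinate changes\<close>

lemma atlas_charts:
  assumes A: "smooth_atlas A" and c: "c \<in> A"
  shows atlas_open_cdom: "open (cdom c)" and atlas_open_cimg: "open (cimg c)"
    and atlas_cinv_coord: "\<And>x. x \<in> cdom c \<Longrightarrow> cinv c (coord c x) = x"
    and atlas_coord_cinv: "\<And>y. y \<in> cimg c \<Longrightarrow> coord c (cinv c y) = y"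
    and atlas_coord_in: "\<And>x. x \<in> cdom c \<Longrightarrow> coord c x \<in> cimg c"
    and atlas_cinv_in: "\<And>y. y \<in> cimg c \<Longrightarrow> cinv c y \<in> cdom c"
    and atlas_continuous_coord: "continuous_on (cdom c) (coord c)"
    and atlas_continuous_cinv: "continuous_on (cimg c) (cinv c)"
    and atlas_inj_coord: "inj_on (coord c) (cdom c)"
proof -
  show "open (cdom c)" "open (cimg c)"
    using assms unfolding smooth_atlas_def by auto
  have h: "homeomorphism (cdom c) (cimg c) (coord c) (cinv c)"
    using assms unfolding smooth_atlas_def by auto
  show "\<And>x. x \<in> cdom c \<Longrightarrow> cinv c (coord c x) = x" "\<And>y. y \<in> cimg c \<Longrightarrow> coord c (cinv c y) = y"
    "\<And>x. x \<in> cdom c \<Longrightarrow> coord c x \<in> cimg c" "\<And>y. y \<in> cimg c \<Longrightarrow> cinv c y \<in> cdom c"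
    "continuous_on (cdom c) (coord c)" "continuous_on (cimg c) (cinv c)"
    using h unfolding homeomorphism_def by auto
  then show "inj_on (coord c) (cdom c)" by (metis inj_onI)
qed

lemma atlas_cover: "smooth_atlas A \<Longrightarrow> \<exists>c\<in>A. x \<in> cdom c"
  unfolding smooth_atlas_def by blast

lemma chart_at:
  assumes "smooth_atlas A"
  shows "chart_at A x \<in> A" "x \<in> cdom (chart_at A x)"
  using someI_ex[OF atlas_cover[OF assms, of x, unfolded Bex_def]] by (auto simp: chart_at_def)

lemma atlas_coord_image_open:
  assumes A: "smooth_atlas A" and c: "c \<in> A" and U: "open U" "U \<subseteq> cdom c"
  shows "open (coord c ` U)"
proof -
  have "coord c ` U = cimg c \<inter> cinv c -` U"
    using U atlas_cinv_coord[OF A c] atlas_coord_cinv[OF A c] atlas_coord_in[OF A c]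
    by (auto simp: image_iff) (metis subsetD)+
  then show ?thesis
    using continuous_on_open_vimage[OF atlas_open_cimg[OF A c], of "cinv c"] atlas_continuous_cinv[OF A c] U
    by (metis inf_commute)
qed

lemma atlas_cinv_image_open:
  assumes A: "smooth_atlas A" and c: "c \<in> A" and U: "open U" "U \<subseteq> cimg c"
  shows "open (cinv c ` U)"
proof -
  have "cinv c ` U = cdom c \<inter> coord c -` U"
    using U atlas_cinv_coord[OF A c] atlas_coord_cinv[OF A c] atlas_cinv_in[OF A c]
    by (auto simp: image_iff) (metis subsetD)+
  then show ?thesis
    using continuous_on_open_vimage[OF atlas_open_cdom[OF A c], of "coord c"] atlas_continuous_coord[OF A c] U
    by (metis inf_commute)
qed

abbreviation jac :: "('m, 'n::finite) chart \<Rightarrow> ('m, 'n) chart \<Rightarrow> 'm \<Rightarrow> real ^ 'n ^ 'n" where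
  "jac c d x \<equiv> local_deriv c d (\<lambda>x. x) x"

abbreviation overlap :: "('m, 'n::finite) chart \<Rightarrow> ('m, 'n) chart \<Rightarrow> (real ^ 'n) set" where
  "overlap c d \<equiv> coord c ` (cdom c \<inter> cdom d)"

lemma overlap_open:
  assumes "smooth_atlas A" "c \<in> A" "d \<in> A"
  shows "open (overlap c d)"
  by (intro atlas_coord_image_open[OF assms(1,2)] open_Int atlas_open_cdom[OF assms(1)] assms(2,3)) simp

lemma transition_Ck:
  assumes "smooth_atlas A" "c \<in> A" "d \<in> A"
  shows "Ck_on k (overlap c d) (coord d \<circ> cinv c)"
  using assms smooth_on_open[OF overlap_open[OF assms]] unfolding smooth_atlas_def by blast

lemma Ck_on_has_derivative:
  assumes "Ck_on k S F" "k > 0" "x \<in> S"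
  shows "(F has_derivative frechet_derivative F (at x)) (at x)"
  using assms Ck_on_mono[of k S F 1] by (auto simp: Ck_on_Suc frechet_derivative_works[symmetric])

lemma matrix_frechet_Ck:
  fixes F :: "real^'n \<Rightarrow> real^'m"
  assumes "open S" "Ck_on (Suc k) S F"
  shows "Ck_on k S (\<lambda>y. matrix (frechet_derivative F (at y)))"
proof -
  have "Ck_on k S (\<lambda>y. \<chi> i j. frechet_derivative F (at y) (axis j 1) $ i)"
    using assms(2) by (intro Ck_on_vec_lambda[OF assms(1)]
        Ck_on_bounded_linear[OF assms(1) bounded_linear_vec_nth]) (simp add: Ck_on_Suc)
  then show ?thesis by (simp add: matrix_def[abs_def])
qed

text \<open>Taking \<open>F\<close> to be the identity covers changes of coordinates.\<close>

lemma local_deriv_has_derivative: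
  assumes "Ck_on k S (coord d \<circ> F \<circ> cinv c)" "k > 0" "coord c x \<in> S"
  shows "((coord d \<circ> F \<circ> cinv c) has_derivative (\<lambda>v. local_deriv c d F x *v v)) (at (coord c x))"
proof -
  have *: "((coord d \<circ> F \<circ> cinv c) has_derivative frechet_derivative (coord d \<circ> F \<circ> cinv c) (at (coord c x))) (at (coord c x))"
    by (rule Ck_on_has_derivative[OF assms])
  then have "linear (frechet_derivative (coord d \<circ> F \<circ> cinv c) (at (coord c x)))"
    by (rule has_derivative_linear)
  then show ?thesis using * unfolding local_deriv_def by (simp add: matrix_works)
qed

lemma local_deriv_eqI:
  assumes "((coord d \<circ> F \<circ> cinv c) has_derivative (\<lambda>v. J *v v)) (at (coord c x))"
  shows "local_deriv c d F x = J"
  unfolding local_deriv_def frechet_derivative_eqI[OF assms] by (rule matrix_of_matrix_vector_mul)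

lemma jac_has_derivative:
  assumes A: "smooth_atlas A" "c \<in> A" "d \<in> A" and x: "x \<in> cdom c" "x \<in> cdom d"
  shows "((coord d \<circ> cinv c) has_derivative (\<lambda>v. jac c d x *v v)) (at (coord c x))"
  using local_deriv_has_derivative[of 1 "overlap c d" d "\<lambda>x. x" c x] transition_Ck[OF A] x
  by (auto simp: o_def)

lemma jac_Ck:
  assumes A: "smooth_atlas A" "c \<in> A" "d \<in> A"
  shows "Ck_on k (overlap c d) (\<lambda>y. jac c d (cinv c y))"
proof (rule Ck_on_cong[OF overlap_open[OF A] _ matrix_frechet_Ck[OF overlap_open[OF A] transition_Ck[OF A]]])
  fix y assume "y \<in> overlap c d"
  then have "coord c (cinv c y) = y" using atlas_cinv_coord[OF A(1,2)] by auto
  then show "matrix (frechet_derivative (coord d \<circ> cinv c) (at y)) = jac c d (cinv c y)"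
    by (simp add: local_deriv_def o_def)
qed

text \<open>The chain rule in charts. Continuity of \<open>F\<close> makes the set on which the
  intermediate chart \<open>d\<close> may be inserted open, so that inserting it does not affect the
  derivative.\<close>

lemma local_deriv_compose:
  assumes A: "smooth_atlas A" "c \<in> A" "d \<in> A" "e \<in> A"
    and x: "x \<in> cdom c" "F x \<in> cdom d" "G (F x) \<in> cdom e"
    and F: "continuous_on UNIV F"
    and dF: "((coord d \<circ> F \<circ> cinv c) has_derivative (\<lambda>v. local_deriv c d F x *v v)) (at (coord c x))"
    and dG: "((coord e \<circ> G \<circ> cinv d) has_derivative (\<lambda>v. local_deriv d e G (F x) *v v)) (at (coord d (F x)))"
  shows "local_deriv c e (G \<circ> F) x = local_deriv d e G (F x) ** local_deriv c d F x"
    and "((coord e \<circ> (G \<circ> F) \<circ> cinv c) has_derivative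
      (\<lambda>v. (local_deriv d e G (F x) ** local_deriv c d F x) *v v)) (at (coord c x))"
proof -
  let ?U = "coord c ` (cdom c \<inter> F -` cdom d)"
  have U: "open ?U"
    using atlas_open_cdom[OF A(1,2)] open_vimage[OF atlas_open_cdom[OF A(1,3)] F]
    by (intro atlas_coord_image_open[OF A(1,2)]) auto
  have "(coord d \<circ> F \<circ> cinv c) (coord c x) = coord d (F x)"
    using atlas_cinv_coord[OF A(1,2) x(1)] by simp
  then have "((coord e \<circ> G \<circ> cinv d) \<circ> (coord d \<circ> F \<circ> cinv c) has_derivative
      (\<lambda>v. local_deriv d e G (F x) *v v) \<circ> (\<lambda>v. local_deriv c d F x *v v)) (at (coord c x))"
    using diff_chain_at[OF dF, of "coord e \<circ> G \<circ> cinv d"] dG by simp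
  then show *: "((coord e \<circ> (G \<circ> F) \<circ> cinv c) has_derivative
      (\<lambda>v. (local_deriv d e G (F x) ** local_deriv c d F x) *v v)) (at (coord c x))"
    unfolding o_def matrix_vector_mul_assoc
  proof (rule has_derivative_transform_within_open[OF _ U])
    show "coord c x \<in> ?U" using x by auto
    fix y assume "y \<in> ?U"
    then show "coord e (G (cinv d (coord d (F (cinv c y))))) = coord e (G (F (cinv c y)))"
      using atlas_cinv_coord[OF A(1,2)] atlas_cinv_coord[OF A(1,3)] by auto
  qed
  show "local_deriv c e (G \<circ> F) x = local_deriv d e G (F x) ** local_deriv c d F x"
    by (rule local_deriv_eqI[OF *])
qed

lemma jac_compose:
  assumes A: "smooth_atlas A" "c \<in> A" "d \<in> A" "e \<in> A"
    and x: "x \<in> cdom c" "x \<in> cdom d" "x \<in> cdom e"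
  shows "jac c e x = jac d e x ** jac c d x"
  using local_deriv_compose(1)[OF A x(1), of "\<lambda>x. x" "\<lambda>x. x"] x jac_has_derivative[OF A(1,2,3) x(1,2)]
    jac_has_derivative[OF A(1,3,4) x(2,3)]
  by (simp add: o_def)

lemma jac_self:
  assumes A: "smooth_atlas A" "c \<in> A" and x: "x \<in> cdom c"
  shows "jac c c x = mat 1"
proof (rule local_deriv_eqI)
  have "((\<lambda>y. y) has_derivative (\<lambda>v. v)) (at (coord c x))" by (rule has_derivative_ident)
  then have "((coord c \<circ> (\<lambda>x. x) \<circ> cinv c) has_derivative (\<lambda>v. v)) (at (coord c x))"
    by (rule has_derivative_transform_within_open[OF _ atlas_open_cimg[OF A]])
       (use x atlas_coord_in[OF A] atlas_coord_cinv[OF A] in auto)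
  then show "((coord c \<circ> (\<lambda>x. x) \<circ> cinv c) has_derivative (\<lambda>v. mat 1 *v v)) (at (coord c x))" by simp
qed

lemma jac_inverse:
  assumes A: "smooth_atlas A" "c \<in> A" "d \<in> A" and x: "x \<in> cdom c" "x \<in> cdom d"
  shows "jac d c x ** jac c d x = mat 1"
  using jac_compose[OF A A(2) x x(1)] jac_self[OF A(1,2) x(1)] by simp

lemma jac_det_ne_0:
  assumes A: "smooth_atlas A" "c \<in> A" "d \<in> A" and x: "x \<in> cdom c" "x \<in> cdom d"
  shows "det (jac c d x) \<noteq> 0"
  using arg_cong[OF jac_inverse[OF assms], of det] by (auto simp: det_mul)

lemma atlas_finite_subcover:
  assumes "compact (UNIV :: 'm::topological_space set)" and A: "smooth_atlas (A :: ('m, 'n::finite) chart set)"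
  obtains C where "C \<subseteq> A" "finite C" "(\<Union>c\<in>C. cdom c) = UNIV"
proof -
  have "UNIV \<subseteq> (\<Union>c\<in>A. cdom c)" using A by (auto simp: smooth_atlas_def)
  then show ?thesis
    using compactE_image[OF assms(1), of A cdom] atlas_open_cdom[OF A] that by (metis UNIV_I subsetI subset_antisym)
qed

section \<open>The measure of a volume form\<close>

definition chart_measure :: "(('m::topological_space, 'n::finite) chart \<Rightarrow> 'm \<Rightarrow> real) \<Rightarrow> ('m, 'n) chart \<Rightarrow> 'm measure" where
  "chart_measure w c = distr (density (restrict_space lborel (cimg c)) (\<lambda>y. ennreal \<bar>w c (cinv c y)\<bar>)) borel (cinv c)"

lemma sets_chart_measure [simp]: "sets (chart_measure w c) = sets borel"
  by (simp add: chart_measure_def)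

lemma volume_form_continuous:
  assumes A: "smooth_atlas A" and w: "volume_form A w" and c: "c \<in> A"
  shows "continuous_on (cimg c) (\<lambda>y. w c (cinv c y))"
  using w c smooth_on_open[OF atlas_open_cimg[OF A c]] Ck_on_continuous unfolding volume_form_def by blast

lemma coord_image_eq:
  assumes A: "smooth_atlas A" and c: "c \<in> A" and B: "B \<subseteq> cdom c"
  shows "coord c ` B = cinv c -` B \<inter> cimg c"
  using B atlas_cinv_coord[OF A c] atlas_coord_cinv[OF A c] atlas_coord_in[OF A c]
  by (auto simp: image_iff) (metis subsetD)+

lemma cinv_measurable:
  assumes A: "smooth_atlas A" and c: "c \<in> A"
  shows "cinv c \<in> borel_measurable (restrict_space borel (cimg c))"
  by (rule borel_measurable_continuous_on_restrict[OF atlas_continuous_cinv[OF A c]])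

lemma coord_image_borel:
  assumes A: "smooth_atlas A" and c: "c \<in> A" and B: "B \<in> sets borel" "B \<subseteq> cdom c"
  shows "coord c ` B \<in> sets borel"
  using measurable_sets[OF cinv_measurable[OF A c] B(1)] atlas_open_cimg[OF A c]
  by (simp add: coord_image_eq[OF A c B(2)] space_restrict_space sets_restrict_space_iff)

lemma emeasure_chart_measure:
  assumes A: "smooth_atlas A" and w: "volume_form A w" and c: "c \<in> A" and B: "B \<in> sets borel" "B \<subseteq> cdom c"
  shows "emeasure (chart_measure w c) B =
    (\<integral>\<^sup>+ y. ennreal \<bar>w c (cinv c y)\<bar> * indicator (coord c ` B) y \<partial>lborel)"
proof -
  let ?M = "restrict_space lborel (cimg c)" and ?f = "\<lambda>y. ennreal \<bar>w c (cinv c y)\<bar>"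
  have sM: "sets ?M = sets (restrict_space borel (cimg c))" by (simp add: sets_restrict_space)
  have f: "?f \<in> borel_measurable ?M"
    using borel_measurable_continuous_on_restrict[OF continuous_on_rabs[OF volume_form_continuous[OF A w c]]]
    unfolding measurable_cong_sets[OF sM refl] by measurable
  have ci: "cinv c \<in> borel_measurable (density ?M ?f)"
    using cinv_measurable[OF A c] unfolding measurable_cong_sets[OF trans[OF sets_density sM] refl] .
  have X: "coord c ` B \<in> sets ?M"
    using coord_image_borel[OF A c B] atlas_coord_in[OF A c] B(2) atlas_open_cimg[OF A c]
    by (auto simp: sets_restrict_space_iff)
  have "emeasure (chart_measure w c) B = emeasure (density ?M ?f) (coord c ` B)"
    unfolding chart_measure_def using B ci
    by (subst emeasure_distr) (auto simp: coord_image_eq[OF A c B(2)] space_restrict_space)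
  also have "\<dots> = (\<integral>\<^sup>+y. ?f y * indicator (coord c ` B) y \<partial>?M)"
    by (rule emeasure_density[OF f X])
  also have "\<dots> = (\<integral>\<^sup>+y. ?f y * indicator (coord c ` B) y * indicator (cimg c) y \<partial>lborel)"
    using atlas_open_cimg[OF A c] by (subst nn_integral_restrict_space) auto
  also have "\<dots> = (\<integral>\<^sup>+ y. ?f y * indicator (coord c ` B) y \<partial>lborel)"
    using atlas_coord_in[OF A c] B(2) by (intro nn_integral_cong) (auto simp: indicator_def)
  finally show ?thesis .
qed

text \<open>Change of variables along the transition map: its Jacobian determinant is exactly the
  factor in the transformation law of \<open>w\<close>.\<close>

lemma chart_measure_consistent:
  fixes A :: "('m::topological_space, 'n::{finite,linorder}) chart set"
  assumes A: "smooth_atlas A" and w: "volume_form A w" and c: "c \<in> A" and d: "d \<in> A"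
    and B: "B \<in> sets borel" "B \<subseteq> cdom c" "B \<subseteq> cdom d"
  shows "emeasure (chart_measure w c) B = emeasure (chart_measure w d) B"
proof -
  let ?T = "coord d \<circ> cinv c"
  let ?S = "coord c ` B"
  have TS: "?T ` ?S = coord d ` B"
    unfolding image_image o_def using B(2) atlas_cinv_coord[OF A c] by (intro image_cong) auto
  \<comment> \<open>Extending the density by zero off the chart image makes it Borel on the whole
    space.\<close>
  define W where "W e y = indicator (cimg e) y *\<^sub>R \<bar>w e (cinv e y)\<bar>" for e y
  have Wm: "W e \<in> borel_measurable borel" if "e \<in> A" for e
    unfolding W_def[abs_def] using atlas_open_cimg[OF A that]
    by (intro borel_measurable_continuous_on_indicator continuous_on_rabs volume_form_continuous[OF A w that]) auto
  have trans: "\<bar>det (jac c d (cinv c y))\<bar> * W d (?T y) = W c y" if "y \<in> ?S" for y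
  proof -
    obtain x where x: "x \<in> B" "y = coord c x" using \<open>y \<in> ?S\<close> by auto
    then have "w c x = det (jac c d x) * w d x"
      using w c d B unfolding volume_form_def by blast
    moreover have "x \<in> cdom c" "x \<in> cdom d" using x B by auto
    ultimately show ?thesis
      using x(2) atlas_cinv_coord[OF A c, of x] atlas_cinv_coord[OF A d, of x]
        atlas_coord_in[OF A c, of x] atlas_coord_in[OF A d, of x]
      by (simp add: W_def abs_mult)
  qed
  have "(\<integral>\<^sup>+z. ennreal (W d z) * indicator (?T ` ?S) z \<partial>lborel) =
    (\<integral>\<^sup>+y. ennreal (\<bar>det (matrix ((*v) (jac c d (cinv c y))))\<bar> * W d (?T y)) * indicator ?S y \<partial>lborel)"
  proof (rule nn_integral_change_of_variables)
    show "?S \<in> sets borel" by (rule coord_image_borel[OF A c B(1,2)])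
    show "?T ` ?S \<in> sets borel" unfolding TS by (rule coord_image_borel[OF A d B(1,3)])
    show "(?T has_derivative (*v) (jac c d (cinv c y))) (at y)" if "y \<in> ?S" for y
    proof -
      obtain x where "x \<in> B" "y = coord c x" using \<open>y \<in> ?S\<close> by auto
      moreover have "x \<in> cdom c" "x \<in> cdom d" using B \<open>x \<in> B\<close> by auto
      ultimately show ?thesis
        using jac_has_derivative[OF A c d, of x] atlas_cinv_coord[OF A c, of x] by simp
    qed
    show "inj_on ?T ?S"
      using inj_on_subset[OF atlas_inj_coord[OF A d] B(3)] subsetD[OF B(2)] atlas_cinv_coord[OF A c]
      by (auto simp: inj_on_def)
    show "W d \<in> borel_measurable borel" by (rule Wm[OF d])
    show "0 \<le> W d y" for y by (simp add: W_def)
    have "(\<lambda>y. indicator ?S y * W c y) \<in> borel_measurable borel"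
      using coord_image_borel[OF A c B(1,2)] Wm[OF c] by measurable
    also have "(\<lambda>y. indicator ?S y * W c y) =
        (\<lambda>y. indicator ?S y * (\<bar>det (matrix ((*v) (jac c d (cinv c y))))\<bar> * W d (?T y)))"
    proof
      fix y
      show "indicator ?S y * W c y = indicator ?S y * (\<bar>det (matrix ((*v) (jac c d (cinv c y))))\<bar> * W d (?T y))"
      proof (cases "y \<in> ?S")
        case True
        show ?thesis unfolding matrix_of_matrix_vector_mul trans[OF True] ..
      next
        case False
        show ?thesis by (simp only: indicator_simps(2)[OF False] mult_zero_left)
      qed
    qed
    finally show "(\<lambda>y. indicator ?S y * (\<bar>det (matrix ((*v) (jac c d (cinv c y))))\<bar> * W d (?T y))) \<in> borel_measurable borel" .
  qed
  also have "(\<integral>\<^sup>+y. ennreal (\<bar>det (matrix ((*v) (jac c d (cinv c y))))\<bar> * W d (?T y)) * indicator ?S y \<partial>lborel)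
    = (\<integral>\<^sup>+y. ennreal (W c y) * indicator ?S y \<partial>lborel)"
  proof (rule nn_integral_cong)
    fix y
    show "ennreal (\<bar>det (matrix ((*v) (jac c d (cinv c y))))\<bar> * W d (?T y)) * indicator ?S y
      = ennreal (W c y) * indicator ?S y"
    proof (cases "y \<in> ?S")
      case True
      show ?thesis unfolding matrix_of_matrix_vector_mul trans[OF True] ..
    next
      case False
      show ?thesis by (simp only: indicator_simps(2)[OF False] mult_zero_right)
    qed
  qed
  moreover have "(\<integral>\<^sup>+y. ennreal (W e y) * indicator (coord e ` B) y \<partial>lborel) = emeasure (chart_measure w e) B"
    if "e \<in> A" "B \<subseteq> cdom e" for e
    unfolding emeasure_chart_measure[OF A w that(1) B(1) that(2)]
    using atlas_coord_in[OF A that(1)] that(2)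
    by (intro nn_integral_cong) (auto simp: W_def indicator_def)
  ultimately show ?thesis using c d B by (simp only: TS)
qed

text \<open>The predicate under the definite description in \<open>volume_measure\<close>, named so
  that existence and uniqueness can be treated separately.\<close>

definition is_volume_measure ::
  "('m::topological_space, 'n::finite) chart set \<Rightarrow> (('m, 'n) chart \<Rightarrow> 'm \<Rightarrow> real) \<Rightarrow> 'm measure \<Rightarrow> bool" where
  "is_volume_measure A \<rho> \<nu> \<longleftrightarrow> sets \<nu> = sets borel \<and>
     (\<forall>c\<in>A. \<forall>B\<in>sets borel. B \<subseteq> cdom c \<longrightarrow>
        emeasure \<nu> B =
          (\<integral>\<^sup>+ y. ennreal \<bar>\<rho> c (cinv c y)\<bar> * indicator (coord c ` B) y \<partial>lborel))"

text \<open>A finite subcover by charts is made disjoint by removing the earlier domains from each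
  one.\<close>

lemma borel_partition:
  assumes "compact (UNIV :: 'm::topological_space set)" and A: "smooth_atlas (A :: ('m, 'n::finite) chart set)"
  obtains n :: nat and e D where "\<forall>i<n. e i \<in> A" "\<forall>i<n. D i \<in> sets borel"
    "\<forall>i<n. D i \<subseteq> cdom (e i)" "disjoint_family_on D {..<n}" "(\<Union>i<n. D i) = UNIV"
proof -
  obtain C where C: "C \<subseteq> A" "finite C" "(\<Union>c\<in>C. cdom c) = UNIV"
    using atlas_finite_subcover[OF assms] .
  obtain e n where e: "bij_betw e {..<n :: nat} C"
    using ex_bij_betw_nat_finite[OF C(2)] by (auto simp: atLeast0LessThan)
  have eA: "e i \<in> A" if "i < n" for i using e C(1) that by (auto simp: bij_betw_def)
  define D where "D i = cdom (e i) - (\<Union>j<i. cdom (e j))" for i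
  have "D i \<in> sets borel" if "i < n" for i
    unfolding D_def using eA that atlas_open_cdom[OF A]
    by (intro sets.Diff sets.finite_UN borel_open) auto
  moreover have "disjoint_family_on D {..<n}"
    unfolding disjoint_family_on_def
  proof (intro ballI impI)
    fix i j :: nat assume "i \<noteq> j"
    then show "D i \<inter> D j = {}" unfolding D_def by (cases i j rule: linorder_cases) auto
  qed
  moreover have "x \<in> (\<Union>i<n. D i)" for x
  proof -
    have "x \<in> (\<Union>c\<in>e ` {..<n}. cdom c)" using C(3) e by (simp add: bij_betw_def)
    then have "\<exists>i<n. x \<in> cdom (e i)" by auto
    then obtain k where k: "k < n" "x \<in> cdom (e k)" "\<And>j. j < k \<Longrightarrow> \<not> (j < n \<and> x \<in> cdom (e j))"
      using exists_least_iff[of "\<lambda>i. i < n \<and> x \<in> cdom (e i)"] by blast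
    have "x \<notin> cdom (e j)" if "j < k" for j using k(1) k(3)[OF that] that by simp
    then have "x \<in> D k" using k(2) by (simp add: D_def)
    then show ?thesis using k(1) by blast
  qed
  moreover have "D i \<subseteq> cdom (e i)" for i by (auto simp: D_def)
  ultimately show ?thesis using that[of n e D] eA by blast
qed

text \<open>The chart measures are glued along a partition into pieces of charts. For a set inside
  one chart, \<open>chart_measure_consistent\<close> allows all pieces to be measured in that chart,
  so the partition leaves no trace.\<close>

lemma volume_measure_exists:
  fixes A :: "('m::topological_space, 'n::{finite,linorder}) chart set"
  assumes co: "compact (UNIV :: 'm set)" and A: "smooth_atlas A" and w: "volume_form A w"
  shows "\<exists>\<nu>. is_volume_measure A w \<nu>"
proof -
  obtain n :: nat and e D where eA: "\<forall>i<n. e i \<in> A" and D: "\<forall>i<n. D i \<in> sets borel"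
    "\<forall>i<n. D i \<subseteq> cdom (e i)" "disjoint_family_on D {..<n}" "(\<Union>i<n. D i) = UNIV"
    by (rule borel_partition[OF co A])
  define F where "F B = (\<Sum>i<n. emeasure (chart_measure w (e i)) (B \<inter> D i))" for B
  define \<nu> where "\<nu> = measure_of (UNIV :: 'm set) (sets borel) F"
  have sets: "sets \<nu> = sets borel"
    unfolding \<nu>_def using sets.sigma_sets_eq[of "borel :: 'm measure"] by simp
  have "emeasure \<nu> B = F B" if "B \<in> sets borel" for B
    unfolding \<nu>_def
  proof (rule emeasure_measure_of_sigma[OF _ _ _ that])
    show "sigma_algebra UNIV (sets (borel :: 'm measure))"
      using sets.sigma_algebra_axioms[of "borel :: 'm measure"] by simp
    show "positive (sets borel) F" by (simp add: positive_def F_def)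
    show "countably_additive (sets borel) F"
    proof (rule countably_additiveI)
      fix X :: "nat \<Rightarrow> 'm set"
      assume X: "range X \<subseteq> sets borel" "disjoint_family X" "\<Union> (range X) \<in> sets borel"
      have "(\<Sum>k. F (X k)) = (\<Sum>i<n. \<Sum>k. emeasure (chart_measure w (e i)) (X k \<inter> D i))"
        unfolding F_def by (rule suminf_sum) simp
      also have "\<dots> = F (\<Union> (range X))"
        unfolding F_def
      proof (rule sum.cong[OF refl])
        fix i assume "i \<in> {..<n}"
        then have "(\<Sum>k. emeasure (chart_measure w (e i)) (X k \<inter> D i))
            = emeasure (chart_measure w (e i)) (\<Union>k. X k \<inter> D i)"
          using X D by (intro suminf_emeasure) (auto simp: disjoint_family_on_def)
        then show "(\<Sum>k. emeasure (chart_measure w (e i)) (X k \<inter> D i))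
            = emeasure (chart_measure w (e i)) (\<Union> (range X) \<inter> D i)"
          by (simp add: Int_UN_distrib2)
      qed
      finally show "(\<Sum>k. F (X k)) = F (\<Union> (range X))" .
    qed
  qed
  moreover have "F B = emeasure (chart_measure w c) B" if c: "c \<in> A" and B: "B \<in> sets borel" "B \<subseteq> cdom c" for c B
  proof -
    have "F B = (\<Sum>i<n. emeasure (chart_measure w c) (B \<inter> D i))"
      unfolding F_def
    proof (rule sum.cong[OF refl])
      fix i assume "i \<in> {..<n}"
      then show "emeasure (chart_measure w (e i)) (B \<inter> D i) = emeasure (chart_measure w c) (B \<inter> D i)"
        using eA D B by (intro chart_measure_consistent[OF A w _ c]) auto
    qed
    also have "\<dots> = emeasure (chart_measure w c) (\<Union>i<n. B \<inter> D i)"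
      using D B disjoint_family_on_bisimulation[OF D(3), of "\<lambda>i. B \<inter> D i"] by (intro sum_emeasure) auto
    also have "(\<Union>i<n. B \<inter> D i) = B" using D(4) by auto
    finally show ?thesis .
  qed
  ultimately show ?thesis
    unfolding is_volume_measure_def using sets emeasure_chart_measure[OF A w] by (intro exI[of _ \<nu>]) auto
qed

lemma volume_measure_unique:
  fixes A :: "('m::topological_space, 'n::finite) chart set"
  assumes co: "compact (UNIV :: 'm set)" and A: "smooth_atlas A"
    and \<nu>: "is_volume_measure A w \<nu>" "is_volume_measure A w \<nu>'"
  shows "\<nu> = \<nu>'"
proof -
  obtain n :: nat and e D where eA: "\<forall>i<n. e i \<in> A" and D: "\<forall>i<n. D i \<in> sets borel"
    "\<forall>i<n. D i \<subseteq> cdom (e i)" "disjoint_family_on D {..<n}" "(\<Union>i<n. D i) = UNIV"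
    by (rule borel_partition[OF co A])
  have sets: "sets \<nu> = sets borel" "sets \<nu>' = sets borel" using \<nu> by (auto simp: is_volume_measure_def)
  have split: "emeasure \<nu>0 B = (\<Sum>i<n. emeasure \<nu>0 (B \<inter> D i))" if "sets \<nu>0 = sets borel" "B \<in> sets borel" for \<nu>0 :: "'m measure" and B
  proof -
    have "(\<Sum>i<n. emeasure \<nu>0 (B \<inter> D i)) = emeasure \<nu>0 (\<Union>i<n. B \<inter> D i)"
      using D that disjoint_family_on_bisimulation[OF D(3), of "\<lambda>i. B \<inter> D i"] by (intro sum_emeasure) auto
    also have "(\<Union>i<n. B \<inter> D i) = B" using D(4) by auto
    finally show ?thesis by simp
  qed
  show ?thesis
  proof (rule measure_eqI)
    fix B assume "B \<in> sets \<nu>"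
    then have B: "B \<in> sets borel" using sets by simp
    have "emeasure \<nu> (B \<inter> D i) = emeasure \<nu>' (B \<inter> D i)" if "i < n" for i
    proof -
      have "B \<inter> D i \<in> sets borel" "B \<inter> D i \<subseteq> cdom (e i)" "e i \<in> A" using that D B eA by auto
      then show ?thesis using \<nu> by (simp add: is_volume_measure_def)
    qed
    then show "emeasure \<nu> B = emeasure \<nu>' B" using split[OF sets(1) B] split[OF sets(2) B] by simp
  qed (simp add: sets)
qed

text \<open>Only absolute values of densities on the charts enter, so the positive densities of a
  metric and a volume form of either sign describe the same measure.\<close>

lemma volume_measure:
  fixes A :: "('m::topological_space, 'n::{finite,linorder}) chart set"
  assumes co: "compact (UNIV :: 'm set)" and A: "smooth_atlas A" and w: "volume_form A w"
    and \<rho>: "\<And>c x. c \<in> A \<Longrightarrow> x \<in> cdom c \<Longrightarrow> \<bar>\<rho> c x\<bar> = \<bar>w c x\<bar>"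
  shows "is_volume_measure A w (volume_measure A \<rho>)"
proof -
  have eq: "is_volume_measure A \<rho> \<nu> \<longleftrightarrow> is_volume_measure A w \<nu>" for \<nu>
  proof -
    have I: "(\<integral>\<^sup>+ y. ennreal \<bar>\<rho> c (cinv c y)\<bar> * indicator (coord c ` B) y \<partial>lborel)
       = (\<integral>\<^sup>+ y. ennreal \<bar>w c (cinv c y)\<bar> * indicator (coord c ` B) y \<partial>lborel)" if "c \<in> A" "B \<subseteq> cdom c" for c B
      using \<rho>[OF that(1)] that(2) atlas_cinv_coord[OF A that(1)]
      by (intro nn_integral_cong) (auto simp: indicator_def subset_iff)
    show ?thesis unfolding is_volume_measure_def
      by (intro conj_cong ball_cong imp_cong refl) (simp add: I)
  qed
  have "volume_measure A \<rho> = (THE \<nu>. is_volume_measure A \<rho> \<nu>)"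
    by (simp add: volume_measure_def is_volume_measure_def)
  also have "\<dots> = (THE \<nu>. is_volume_measure A w \<nu>)" by (simp add: eq)
  finally show ?thesis
    using theI'[of "is_volume_measure A w"] volume_measure_exists[OF co A w] volume_measure_unique[OF co A]
    by (auto simp: Ex1_def)
qed

lemma volume_measure_cong:
  fixes A :: "('m::topological_space, 'n::{finite,linorder}) chart set"
  assumes co: "compact (UNIV :: 'm set)" and A: "smooth_atlas A" and w: "volume_form A w"
    and \<rho>: "\<And>c x. c \<in> A \<Longrightarrow> x \<in> cdom c \<Longrightarrow> \<bar>\<rho> c x\<bar> = \<bar>w c x\<bar>"
  shows "volume_measure A \<rho> = volume_measure A w"
  using volume_measure_unique[OF co A volume_measure[OF co A w \<rho>] volume_measure[OF co A w refl]] by simp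

text \<open>The local densities do not vanish and nonempty open sets are not negligible. This is
  what turns an identity almost everywhere into one at each point.\<close>

lemma volume_measure_open_pos:
  fixes A :: "('m::topological_space, 'n::finite) chart set"
  assumes A: "smooth_atlas A" and w: "volume_form A w" and \<nu>: "is_volume_measure A w \<nu>"
    and U: "open U" "U \<noteq> {}"
  shows "0 < emeasure \<nu> U"
proof -
  obtain x where "x \<in> U" using U by blast
  obtain c where c: "c \<in> A" "x \<in> cdom c" using atlas_cover[OF A] by blast
  define V where "V = U \<inter> cdom c"
  have V: "open V" "V \<subseteq> cdom c" "x \<in> V"
    using open_Int[OF U(1) atlas_open_cdom[OF A c(1)]] \<open>x \<in> U\<close> c by (auto simp: V_def)
  have oV: "open (coord c ` V)" by (rule atlas_coord_image_open[OF A c(1) V(1,2)])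
  have "(\<integral>\<^sup>+ y. ennreal \<bar>w c (cinv c y)\<bar> * indicator (coord c ` V) y \<partial>lborel) \<noteq> 0"
  proof
    assume 0: "(\<integral>\<^sup>+ y. ennreal \<bar>w c (cinv c y)\<bar> * indicator (coord c ` V) y \<partial>lborel) = 0"
    have Vi: "coord c ` V \<subseteq> cimg c" using V(2) by (auto simp: cimg_def)
    have "(\<lambda>y. indicator (coord c ` V) y *\<^sub>R \<bar>w c (cinv c y)\<bar>) \<in> borel_measurable borel"
      using oV by (intro borel_measurable_continuous_on_indicator continuous_on_rabs
          continuous_on_subset[OF volume_form_continuous[OF A w c(1)] Vi]) auto
    then have "(\<lambda>y. ennreal (indicator (coord c ` V) y *\<^sub>R \<bar>w c (cinv c y)\<bar>)) \<in> borel_measurable borel"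
      by measurable
    moreover have "(\<lambda>y. ennreal (indicator (coord c ` V) y *\<^sub>R \<bar>w c (cinv c y)\<bar>))
      = (\<lambda>y. ennreal \<bar>w c (cinv c y)\<bar> * indicator (coord c ` V) y)"
      by (auto simp: indicator_def)
    ultimately have "(\<lambda>y. ennreal \<bar>w c (cinv c y)\<bar> * indicator (coord c ` V) y) \<in> borel_measurable lborel"
      by (simp only: measurable_lborel1 measurable_lborel2)
    then have ae: "AE y in lborel. ennreal \<bar>w c (cinv c y)\<bar> * indicator (coord c ` V) y = 0"
      using 0 nn_integral_0_iff_AE by blast
    have ne: "w c (cinv c y) \<noteq> 0" if "y \<in> coord c ` V" for y
    proof -
      obtain x where "x \<in> V" "y = coord c x" using \<open>y \<in> coord c ` V\<close> by blast
      moreover have "x \<in> cdom c" using \<open>x \<in> V\<close> V(2) by blast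
      moreover from this have "w c x \<noteq> 0" using w c(1) unfolding volume_form_def by blast
      ultimately show ?thesis
        using atlas_cinv_coord[OF A c(1), of x] by simp
    qed
    have "AE y in lborel. y \<notin> coord c ` V"
      using ae by (rule eventually_mono) (use ne in \<open>auto simp: indicator_def split: if_splits\<close>)
    then have "coord c ` V \<in> null_sets lborel"
      using oV by (subst (asm) AE_iff_null) auto
    then have "negligible (coord c ` V)"
      by (simp add: negligible_iff_null_sets null_sets_completionI)
    then show False using open_not_negligible[OF oV] V(3) by blast
  qed
  then have "0 < emeasure \<nu> V"
    using \<nu> V c(1) unfolding is_volume_measure_def by (simp add: zero_less_iff_neq_zero)
  also have "\<dots> \<le> emeasure \<nu> U"
    using \<nu> U by (intro emeasure_mono) (auto simp: V_def is_volume_measure_def)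
  finally show ?thesis .
qed

text \<open>Coordinate balls whose closure stays inside a chart have finite measure because the
  density is bounded there; finitely many of them cover.\<close>

lemma volume_measure_finite:
  fixes A :: "('m::topological_space, 'n::finite) chart set"
  assumes co: "compact (UNIV :: 'm set)"
    and A: "smooth_atlas A" and w: "volume_form A w" and \<nu>: "is_volume_measure A w \<nu>"
  shows "finite_measure \<nu>"
proof -
  have sets: "sets \<nu> = sets borel" and space: "space \<nu> = UNIV"
    using \<nu> sets_eq_imp_space_eq[of \<nu> borel] by (auto simp: is_volume_measure_def)
  have "\<exists>U. open U \<and> x \<in> U \<and> emeasure \<nu> U < \<infinity>" for x
  proof -
    obtain c where c: "c \<in> A" "x \<in> cdom c" using atlas_cover[OF A] by blast
    then obtain r where r: "r > 0" "cball (coord c x) r \<subseteq> cimg c"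
      using atlas_open_cimg[OF A c(1)] atlas_coord_in[OF A c] open_contains_cball by blast
    let ?K = "cball (coord c x) r" and ?U = "cinv c ` ball (coord c x) r"
    have sub: "ball (coord c x) r \<subseteq> cimg c" using r(2) ball_subset_cball by blast
    have U: "open ?U" by (rule atlas_cinv_image_open[OF A c(1) _ sub]) simp
    have "bounded ((\<lambda>y. w c (cinv c y)) ` ?K)"
      using volume_form_continuous[OF A w c(1)] r(2)
      by (intro compact_imp_bounded compact_continuous_image) (auto intro: continuous_on_subset)
    then obtain M where M: "\<And>y. y \<in> ?K \<Longrightarrow> \<bar>w c (cinv c y)\<bar> \<le> M"
      unfolding bounded_iff by (metis image_eqI real_norm_def)
    have "emeasure \<nu> ?U = (\<integral>\<^sup>+ y. ennreal \<bar>w c (cinv c y)\<bar> * indicator (coord c ` ?U) y \<partial>lborel)"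
    proof -
      have "?U \<subseteq> cdom c" using sub atlas_cinv_in[OF A c(1)] by blast
      then show ?thesis using \<nu> c(1) U by (simp add: is_volume_measure_def)
    qed
    also have "coord c ` ?U = ball (coord c x) r"
      using subsetD[OF sub] atlas_coord_cinv[OF A c(1)] by (simp add: image_image cong: image_cong_simp)
    also have "(\<integral>\<^sup>+ y. ennreal \<bar>w c (cinv c y)\<bar> * indicator (ball (coord c x) r) y \<partial>lborel)
      \<le> (\<integral>\<^sup>+ y. ennreal M * indicator (ball (coord c x) r) y \<partial>lborel)"
      using M by (intro nn_integral_mono) (auto simp: indicator_def intro!: ennreal_leI)
    also have "\<dots> = ennreal M * emeasure lborel (ball (coord c x) r)"
      by (simp add: nn_integral_cmult_indicator)
    also have "\<dots> < \<infinity>"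
      using emeasure_bounded_finite[of "ball (coord c x) r"] by (simp add: ennreal_mult_less_top)
    finally have "emeasure \<nu> ?U < \<infinity>" .
    moreover have "x \<in> ?U"
      using r(1) atlas_cinv_coord[OF A c] by (intro image_eqI[of _ _ "coord c x"]) auto
    ultimately show ?thesis using U by blast
  qed
  then obtain U where U: "\<And>x. open (U x)" "\<And>x. x \<in> U x" "\<And>x. emeasure \<nu> (U x) < \<infinity>" by metis
  have "(UNIV :: 'm set) \<subseteq> (\<Union>x\<in>UNIV. U x)" using U(2) by blast
  then obtain X where X: "X \<subseteq> UNIV" "finite X" "UNIV \<subseteq> (\<Union>x\<in>X. U x)"
    by (rule compactE_image[OF co U(1)])
  have "emeasure \<nu> (space \<nu>) \<le> emeasure \<nu> (\<Union>x\<in>X. U x)"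
    using X U sets borel_open[OF open_UN[of X U]] by (intro emeasure_mono) (simp_all add: space)
  also have "\<dots> \<le> (\<Sum>x\<in>X. emeasure \<nu> (U x))"
    using X(2) U(1) sets by (intro emeasure_subadditive_finite) auto
  also have "\<dots> < \<infinity>" using X(2) U(3) by (simp add: less_top)
  finally show ?thesis by (intro finite_measureI) simp
qed

section \<open>Metrics with a prescribed volume form\<close>

lemma sym_tensorsD:
  assumes "h \<in> sym_tensors A"
  shows "c \<notin> A \<or> x \<notin> cdom c \<Longrightarrow> h c x = 0"
    "c \<in> A \<Longrightarrow> x \<in> cdom c \<Longrightarrow> transpose (h c x) = h c x"
    "c \<in> A \<Longrightarrow> d \<in> A \<Longrightarrow> x \<in> cdom c \<Longrightarrow> x \<in> cdom d \<Longrightarrow> h c x = transpose (jac c d x) ** h d x ** jac c d x"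
    "c \<in> A \<Longrightarrow> smooth_on (cimg c) (\<lambda>y. h c (cinv c y))"
  using assms unfolding sym_tensors_def by blast+

lemma metrics_vol_sym: "g \<in> metrics_vol A w \<Longrightarrow> g \<in> sym_tensors A"
  by (auto simp: metrics_vol_def metrics_def)

lemma metrics_vol_pd:
  assumes "g \<in> metrics_vol A w" "c \<in> A" "x \<in> cdom c"
  shows "pd (g c x)"
  using assms sym_tensorsD(2)[OF metrics_vol_sym[OF assms(1)] assms(2,3)]
  unfolding pd_def metrics_vol_def metrics_def by blast

lemma volume_form_ne_0: "volume_form A w \<Longrightarrow> c \<in> A \<Longrightarrow> x \<in> cdom c \<Longrightarrow> w c x \<noteq> 0"
  unfolding volume_form_def by blast

lemma metrics_vol_det:
  fixes w :: "('m::topological_space, 'n::{finite,linorder}) chart \<Rightarrow> 'm \<Rightarrow> real"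
  assumes w: "volume_form A w" and g: "g \<in> metrics_vol A w" and c: "c \<in> A" "x \<in> cdom c"
  shows "sqrt (det (g c x)) = \<bar>w c x\<bar>" "det (g c x) = (w c x)\<^sup>2"
proof -
  have ne: "w c x \<noteq> 0" by (rule volume_form_ne_0[OF w c])
  have p: "0 < det (g c x)" by (rule pd_det_pos[OF metrics_vol_pd[OF g c]])
  have "sgn (w c x) * sqrt (det (g c x)) = w c x"
    using g c unfolding metrics_vol_def metric_volume_form_def by blast
  then show 1: "sqrt (det (g c x)) = \<bar>w c x\<bar>"
    using ne by (auto simp: sgn_if split: if_splits)
  show "det (g c x) = (w c x)\<^sup>2"
    using arg_cong[OF 1, of "\<lambda>z. z\<^sup>2"] p by simp
qed

lemma metrics_volI:
  fixes w :: "('m::topological_space, 'n::{finite,linorder}) chart \<Rightarrow> 'm \<Rightarrow> real"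
  assumes "h \<in> sym_tensors A" "\<And>c x. c \<in> A \<Longrightarrow> x \<in> cdom c \<Longrightarrow> pd (h c x)"
    "\<And>c x. c \<in> A \<Longrightarrow> x \<in> cdom c \<Longrightarrow> det (h c x) = det (g c x)" "g \<in> metrics_vol A w"
  shows "h \<in> metrics_vol A w"
  using assms unfolding metrics_vol_def metrics_def metric_volume_form_def pd_def by simp

section \<open>First variation of the energy\<close>

lemma trace_transpose: "trace (transpose A) = trace (A :: real^'n^'n)"
  by (simp add: trace_def transpose_def)

lemma trace_scaleR: "trace (k *\<^sub>R A) = k * trace (A :: real^'n^'n)"
  by (simp add: trace_def sum_distrib_left)

lemma matrix_mul_scaleR: "(k *\<^sub>R A) ** B = k *\<^sub>R (A ** B)" "A ** (k *\<^sub>R B) = k *\<^sub>R (A ** B)"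
  for A :: "real^'n^'m" and B :: "real^'p^'n"
  by (auto simp: vec_eq_iff matrix_matrix_mult_def sum_distrib_left mult_ac)

lemma matrix_diff_distrib: "(A - B) ** C = A ** C - B ** C" "D ** (A - B) = D ** A - D ** B"
  for A :: "real^'n^'m" and D :: "real^'m^'k"
  by (auto simp: vec_eq_iff matrix_matrix_mult_def sum_subtractf algebra_simps)

text \<open>\<open>J\<close> intertwines both pairs, so the products are similar. With
  \<open>J\<close> a Jacobian matrix this gives independence of the chart for traces of endomorphism
  fields.\<close>

lemma trace_conj:
  fixes A A' B B' J K :: "real^'n^'n"
  assumes "J ** A = B ** J" "J ** A' = B' ** J" "K ** J = mat 1"
  shows "trace (A ** A') = trace (B ** B')"
proof -
  have JK: "J ** K = mat 1" using assms(3) matrix_left_right_inverse by blast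
  have "A ** A' = K ** (J ** A ** A')" by (simp add: matrix_mul_assoc assms(3))
  also have "J ** A ** A' = B ** (J ** A')" by (simp add: assms(1) matrix_mul_assoc)
  also have "\<dots> = B ** B' ** J" by (simp add: assms(2) matrix_mul_assoc)
  finally have "trace (A ** A') = trace ((B ** B') ** J ** K)"
    using trace_mul_sym[of K "B ** B' ** J"] by simp
  then show ?thesis by (simp add: matrix_mul_assoc[symmetric] JK)
qed

lemma matrix_inv_unique: "A ** B = mat 1 \<Longrightarrow> matrix_inv A = B"
  for A B :: "real^'n^'n"
proof -
  assume AB: "A ** B = mat 1"
  then have "det A \<noteq> 0" using det_mul[of A B] by auto
  then have "matrix_inv A ** (A ** B) = B" by (simp add: matrix_mul_assoc matrix_inv_mult)
  then show ?thesis by (simp add: AB)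
qed

lemma matrix_inv_congruence:
  fixes g P Q :: "real^'n^'n"
  assumes "det g \<noteq> 0" "P ** Q = mat 1"
  shows "matrix_inv (transpose P ** g ** P) = Q ** matrix_inv g ** transpose Q"
proof (rule matrix_inv_unique)
  have QP: "transpose P ** transpose Q = mat 1"
  proof -
    have "Q ** P = mat 1" using assms(2) matrix_left_right_inverse by blast
    then show ?thesis by (metis matrix_transpose_mul transpose_mat)
  qed
  have "transpose P ** g ** P ** (Q ** matrix_inv g ** transpose Q)
    = transpose P ** (g ** (P ** Q) ** matrix_inv g) ** transpose Q"
    by (simp only: matrix_mul_assoc)
  also have "\<dots> = mat 1" using assms QP by (simp add: matrix_inv_mult)
  finally show "transpose P ** g ** P ** (Q ** matrix_inv g ** transpose Q) = mat 1" .
qed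

text \<open>Nilpotency of \<open>Y\<close> makes the squared speed exactly a quadratic polynomial in the speed \<open>\<tau>\<close>
  of \<open>\<sigma>\<close>, so the first variation involves no remainder terms.\<close>

lemma variation_speed:
  fixes g g' Y :: "real^'n^'n" and \<sigma> \<tau> :: real
  assumes g: "det g \<noteq> 0" "transpose g = g" "transpose g' = g'" and Y: "Y ** Y = 0"
  defines "P \<equiv> mat 1 + \<sigma> *\<^sub>R Y" and "X \<equiv> matrix_inv g ** g'"
    and "Z \<equiv> Y + matrix_inv g ** transpose Y ** g"
  defines "G \<equiv> transpose P ** g ** P"
  defines "V \<equiv> \<tau> *\<^sub>R (transpose Y ** g ** P) + transpose P ** g' ** P + \<tau> *\<^sub>R (transpose P ** g ** Y)"
  shows "trace (matrix_inv G ** V ** matrix_inv G ** V)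
    = trace (X ** X) + 4 * \<tau> * trace (X ** Y) + \<tau>\<^sup>2 * trace (Z ** Z)"
proof -
  \<comment> \<open>The inverse of \<open>P\<close>, exactly, since
    \<open>Y ** Y = 0\<close>.\<close>
  define Q where "Q = mat 1 - \<sigma> *\<^sub>R Y"
  have PQ: "P ** Q = mat 1"
    by (simp add: P_def Q_def matrix_add_mult_distrib matrix_diff_distrib matrix_mul_scaleR Y)
  have YQ: "Y ** Q = Y" by (simp add: Q_def matrix_diff_distrib matrix_mul_scaleR Y)
  have QP: "Q ** P = mat 1" using PQ matrix_left_right_inverse by blast
  have tQ: "transpose Q ** transpose P = mat 1" "transpose Q ** transpose Y = transpose Y"
    using arg_cong[OF PQ, of transpose] arg_cong[OF YQ, of transpose] by (simp_all add: matrix_transpose_mul)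
  have gi: "g ** matrix_inv g = mat 1" "matrix_inv g ** g = mat 1"
    using matrix_inv_mult[OF g(1)] by auto
  have gis: "transpose (matrix_inv g) = matrix_inv g"
    using arg_cong[OF gi(2), of transpose] g(2) matrix_inv_unique[of g "transpose (matrix_inv g)"]
    by (simp add: matrix_transpose_mul)
  have inv: "matrix_inv G = Q ** matrix_inv g ** transpose Q"
    unfolding G_def by (rule matrix_inv_congruence[OF g(1) PQ])
  \<comment> \<open>After conjugation by \<open>P\<close> the matrix
    \<open>matrix_inv G ** V\<close> becomes \<open>M\<close>, in which \<open>\<sigma>\<close> no
    longer occurs.\<close>
  define M where "M = X + \<tau> *\<^sub>R Z"
  have 1: "transpose Q ** (transpose Y ** g ** P) = transpose Y ** g ** P"
    by (simp add: matrix_mul_assoc tQ)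
  have 2: "transpose Q ** (transpose P ** g' ** P) = g' ** P"
    by (simp add: matrix_mul_assoc tQ)
  have 3: "transpose Q ** (transpose P ** g ** Y) = g ** Y"
    by (simp add: matrix_mul_assoc tQ)
  have "transpose Q ** V = \<tau> *\<^sub>R (transpose Y ** g ** P) + g' ** P + \<tau> *\<^sub>R (g ** Y)"
    unfolding V_def matrix_add_ldistrib matrix_mul_scaleR 1 2 3 ..
  moreover have "Y = Y ** P" using arg_cong[OF YQ, of "\<lambda>A. A ** P"] QP by (simp flip: matrix_mul_assoc)
  ultimately have "matrix_inv g ** (transpose Q ** V) = M ** P"
    by (simp add: M_def X_def Z_def matrix_add_ldistrib matrix_add_mult_distrib matrix_mul_scaleR
        matrix_mul_assoc gi scaleR_add_right add_ac)
  then have "matrix_inv G ** V = Q ** M ** P"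
    unfolding inv by (simp add: matrix_mul_assoc[symmetric])
  then have 4: "P ** (matrix_inv G ** V) = M ** P" by (simp add: matrix_mul_assoc PQ)
  have "trace (matrix_inv G ** V ** (matrix_inv G ** V)) = trace (M ** M)"
    by (rule trace_conj[OF 4 4 QP])
  also have "M ** M = X ** X + \<tau> *\<^sub>R (X ** Z) + \<tau> *\<^sub>R (Z ** X) + (\<tau>\<^sup>2) *\<^sub>R (Z ** Z)"
    by (simp add: M_def matrix_add_ldistrib matrix_add_mult_distrib matrix_mul_scaleR power2_eq_square scaleR_add_right add_ac)
  also have "trace \<dots> = trace (X ** X) + 2 * \<tau> * trace (X ** Z) + \<tau>\<^sup>2 * trace (Z ** Z)"
    by (simp add: trace_add trace_scaleR trace_mul_sym[of Z X])
  \<comment> \<open>\<open>X\<close> is self-adjoint for \<open>g\<close>, and the second summand of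
    \<open>Z\<close> is the \<open>g\<close>-adjoint of \<open>Y\<close>; so both summands
    contribute the same trace.\<close>
  also have "trace (X ** Z) = 2 * trace (X ** Y)"
  proof -
    have "trace (X ** (matrix_inv g ** transpose Y ** g)) = trace (g ** matrix_inv g ** g' ** matrix_inv g ** transpose Y)"
      unfolding X_def using trace_mul_sym[of "matrix_inv g ** g' ** matrix_inv g ** transpose Y" g]
      by (simp add: matrix_mul_assoc)
    also have "\<dots> = trace (transpose (g' ** matrix_inv g ** transpose Y))"
      by (simp add: gi trace_transpose)
    also have "\<dots> = trace (Y ** X)"
      by (simp add: matrix_transpose_mul gis g X_def matrix_mul_assoc)
    finally show ?thesis
      by (simp add: Z_def matrix_add_ldistrib trace_add trace_mul_sym[of Y X])
  qed
  finally show ?thesis by (simp add: matrix_mul_assoc)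
qed

section \<open>Nilpotent endomorphism fields supported in one chart\<close>

definition bump_at :: "('m, 'n::finite) chart \<Rightarrow> real^'n \<Rightarrow> real \<Rightarrow> 'm \<Rightarrow> real" where
  "bump_at c0 a r x = (if x \<in> cdom c0 then ball_bump a r (coord c0 x) else 0)"

text \<open>The field with constant matrix \<open>N\<close> in \<open>c0\<close>, cut off by the
  bump. The type of covariant tensors is reused, but these matrices change by conjugation, as
  endomorphisms do (\<open>bump_endo_jac\<close>).\<close>

definition bump_endo ::
  "('m, 'n::finite) chart \<Rightarrow> real^'n \<Rightarrow> real \<Rightarrow> real^'n^'n \<Rightarrow> ('m, 'n) tensor2" where
  "bump_endo c0 a r N d x =
     (if x \<in> cdom d \<and> x \<in> cdom c0 then bump_at c0 a r x *\<^sub>R (jac c0 d x ** N ** jac d c0 x) else 0)"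

lemma bump_endo_jac:
  assumes A: "smooth_atlas A" "c \<in> A" "d \<in> A" "c0 \<in> A" and x: "x \<in> cdom c" "x \<in> cdom d"
  shows "jac c d x ** bump_endo c0 a r N c x = bump_endo c0 a r N d x ** jac c d x"
proof (cases "x \<in> cdom c0")
  case True
  have "jac c d x ** (jac c0 c x ** N ** jac c c0 x) = jac c0 d x ** N ** jac c c0 x"
    using jac_compose[OF A(1,4,2,3) True x] by (simp add: matrix_mul_assoc)
  moreover have "jac c0 d x ** N ** jac d c0 x ** jac c d x = jac c0 d x ** N ** jac c c0 x"
    using jac_compose[OF A(1,2,3,4) x True] by (simp add: matrix_mul_assoc[symmetric])
  ultimately show ?thesis using x True by (simp add: bump_endo_def matrix_mul_scaleR)
qed (simp add: bump_endo_def)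

lemma bump_endo_square:
  assumes A: "smooth_atlas A" "d \<in> A" "c0 \<in> A" and N: "N ** N = 0"
  shows "bump_endo c0 a r N d x ** bump_endo c0 a r N d x = 0"
proof (cases "x \<in> cdom d \<and> x \<in> cdom c0")
  case True
  have "(jac c0 d x ** N ** jac d c0 x) ** (jac c0 d x ** N ** jac d c0 x)
    = jac c0 d x ** (N ** (jac d c0 x ** jac c0 d x) ** N) ** jac d c0 x"
    by (simp only: matrix_mul_assoc)
  also have "\<dots> = 0" using jac_inverse[OF A(1,3,2)] True N by simp
  finally show ?thesis using True by (simp add: bump_endo_def matrix_mul_scaleR)
qed (auto simp: bump_endo_def)

lemma bump_endo_det:
  assumes A: "smooth_atlas A" "d \<in> A" "c0 \<in> A" and N: "\<And>s. det (mat 1 + s *\<^sub>R N) = 1"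
  shows "det (mat 1 + s *\<^sub>R bump_endo c0 a r N d x) = 1"
proof (cases "x \<in> cdom d \<and> x \<in> cdom c0")
  case True
  then have JK: "jac c0 d x ** jac d c0 x = mat 1" using jac_inverse[OF A] by simp
  have "mat 1 + s *\<^sub>R bump_endo c0 a r N d x
    = jac c0 d x ** (mat 1 + (s * bump_at c0 a r x) *\<^sub>R N) ** jac d c0 x"
    using True by (simp add: bump_endo_def matrix_add_ldistrib matrix_add_mult_distrib matrix_mul_scaleR JK)
  then show ?thesis using arg_cong[OF JK, of det] N by (simp add: det_mul)
qed (auto simp: bump_endo_def)

lemma bump_support:
  assumes A: "smooth_atlas A" "c0 \<in> A" and r: "r > 0" "cball a r \<subseteq> cimg c0"
    and x: "x \<notin> cinv c0 ` cball a r"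
  shows "bump_at c0 a r x = 0"
proof (cases "x \<in> cdom c0")
  case True
  have "coord c0 x \<notin> ball a r"
  proof
    assume "coord c0 x \<in> ball a r"
    then have "cinv c0 (coord c0 x) \<in> cinv c0 ` cball a r" by (intro imageI) simp
    then show False using x atlas_cinv_coord[OF A True] by simp
  qed
  then show ?thesis
    using ball_bump_pos_iff[OF r(1), of a "coord c0 x"] ball_bump_nonneg[of a r "coord c0 x"]
    by (simp add: bump_at_def True)
qed (simp add: bump_at_def)

lemma closed_bump_support:
  fixes A :: "('m::t2_space, 'n::finite) chart set"
  assumes A: "smooth_atlas A" "c0 \<in> A" and r: "cball a r \<subseteq> cimg c0"
  shows "closed (cinv c0 ` cball a r)"
  by (intro compact_imp_closed compact_continuous_image continuous_on_subset[OF atlas_continuous_cinv[OF A] r]) simp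

text \<open>The chart image is covered by the overlap with \<open>c0\<close>, where the formula is
  smooth, and the part off the compact set carrying the bump, where the field vanishes. That part is
  open because compact sets are closed in a Hausdorff space.\<close>

lemma bump_endo_Ck:
  fixes A :: "('m::t2_space, 'n::finite) chart set"
  assumes A: "smooth_atlas A" "d \<in> A" "c0 \<in> A" and r: "r > 0" "cball a r \<subseteq> cimg c0"
  shows "Ck_on k (cimg d) (\<lambda>y. bump_endo c0 a r N d (cinv d y))"
proof -
  let ?K = "cinv c0 ` cball a r"
  let ?U = "overlap d c0" and ?V = "coord d ` (cdom d - ?K)"
  have U: "open ?U" by (rule overlap_open[OF A])
  have V: "open ?V"
    using atlas_open_cdom[OF A(1,2)] closed_bump_support[OF A(1,3) r(2)]
    by (intro atlas_coord_image_open[OF A(1,2)] open_Diff) auto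
  have KU: "cimg d = ?U \<union> ?V"
    using r(2) atlas_cinv_in[OF A(1,3)] unfolding cimg_def[of d] by blast
  have tr: "Ck_on k ?U (coord c0 \<circ> cinv d)" by (rule transition_Ck[OF A])
  have trU: "(coord c0 \<circ> cinv d) ` ?U \<subseteq> overlap c0 d"
    using atlas_cinv_coord[OF A(1,2)] by auto
  have J1: "Ck_on k ?U (\<lambda>y. jac d c0 (cinv d y))" by (rule jac_Ck[OF A])
  have J2: "Ck_on k ?U (\<lambda>y. jac c0 d (cinv c0 ((coord c0 \<circ> cinv d) y)))"
    by (rule Ck_on_compose[OF U overlap_open[OF A(1,3,2)] trU jac_Ck[OF A(1,3,2)] tr])
  have B: "Ck_on k ?U (\<lambda>y. ball_bump a r ((coord c0 \<circ> cinv d) y))"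
    by (rule Ck_on_compose[OF U open_UNIV _ Ck_on_ball_bump tr]) simp
  have "Ck_on k ?U (\<lambda>y. ball_bump a r ((coord c0 \<circ> cinv d) y) *\<^sub>R
     (jac c0 d (cinv c0 ((coord c0 \<circ> cinv d) y)) ** N ** jac d c0 (cinv d y)))"
    by (intro Ck_on_bilinear[OF U bounded_bilinear_scaleR B] Ck_on_bilinear[OF U bounded_bilinear_matrix_mult _ J1]
        Ck_on_bilinear[OF U bounded_bilinear_matrix_mult J2] Ck_on_const)
  then have 1: "Ck_on k ?U (\<lambda>y. bump_endo c0 a r N d (cinv d y))"
  proof (rule Ck_on_cong[OF U, rotated])
    fix y assume "y \<in> ?U"
    then obtain x where x: "x \<in> cdom d" "x \<in> cdom c0" "y = coord d x" by blast
    then show "ball_bump a r ((coord c0 \<circ> cinv d) y) *\<^sub>R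
       (jac c0 d (cinv c0 ((coord c0 \<circ> cinv d) y)) ** N ** jac d c0 (cinv d y)) = bump_endo c0 a r N d (cinv d y)"
      using atlas_cinv_coord[OF A(1,2) x(1)] atlas_cinv_coord[OF A(1,3) x(2)]
      by (simp add: bump_endo_def bump_at_def)
  qed
  have 2: "Ck_on k ?V (\<lambda>y. bump_endo c0 a r N d (cinv d y))"
  proof (rule Ck_on_cong[OF V _ Ck_on_const[of k ?V 0]])
    fix y assume "y \<in> ?V"
    then obtain x where x: "x \<in> cdom d" "x \<notin> ?K" "y = coord d x" by blast
    then show "0 = bump_endo c0 a r N d (cinv d y)"
      using atlas_cinv_coord[OF A(1,2) x(1)] bump_support[OF A(1,3) r x(2)] by (simp add: bump_endo_def)
  qed
  have "Ck_on k (\<Union>S\<in>{?U, ?V}. S) (\<lambda>y. bump_endo c0 a r N d (cinv d y))"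
    using U V 1 2 by (intro Ck_on_UN) auto
  then show ?thesis by (simp add: KU)
qed

text \<open>By Cramer's rule the entries of the inverse are quotients of determinants.\<close>

lemma continuous_on_matrix_inv:
  fixes F :: "'a::topological_space \<Rightarrow> real^'n^'n"
  assumes F: "continuous_on S F" and det: "\<And>x. x \<in> S \<Longrightarrow> det (F x) \<noteq> 0"
  shows "continuous_on S (\<lambda>x. matrix_inv (F x))"
proof -
  have entry: "matrix_inv B $ i $ j = det (\<chi> p q. if q = i then axis j 1 $ p else B $ p $ q) / det B"
    if "det B \<noteq> 0" for B :: "real^'n^'n" and i j
  proof -
    have "B *v (matrix_inv B *v axis j 1) = axis j 1"
      by (simp add: matrix_vector_mul_assoc matrix_inv_mult[OF that])
    then have "matrix_inv B *v axis j 1 = (\<chi> k. det (\<chi> p q. if q = k then axis j 1 $ p else B $ p $ q) / det B)"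
      using cramer[OF that] by blast
    then show ?thesis by (simp add: matrix_vector_mult_basis column_def vec_eq_iff)
  qed
  have "continuous_on S (\<lambda>x. \<chi> i j. det (\<chi> p q. if q = i then axis j 1 $ p else F x $ p $ q) / det (F x))"
  proof (intro continuous_on_vec_lambda continuous_on_divide continuous_on_det F)
    fix i j p q
    show "continuous_on S (\<lambda>x. if q = i then axis j 1 $ p else F x $ p $ q)"
      using F by (cases "q = i") (auto intro!: continuous_intros)
  qed (use det in auto)
  then show ?thesis
    by (rule continuous_on_cong[OF refl, THEN iffD1, rotated]) (simp add: vec_eq_iff entry det)
qed

lemma continuous_on_trace [continuous_intros]:
  fixes F :: "'a::topological_space \<Rightarrow> real^'n^'n"
  assumes "continuous_on S F"
  shows "continuous_on S (\<lambda>x. trace (F x))"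
  unfolding trace_def using assms by (intro continuous_intros)

section \<open>Velocities and integrals along smooth families\<close>

lemma smooth_family_extension:
  assumes "smooth_family A P G" "c \<in> A"
  obtains T H where "open T" "P \<times> cimg c \<subseteq> T" "\<forall>k. Ck_on k T H"
    "\<forall>p\<in>P. \<forall>y\<in>cimg c. H (p, y) = G p c (cinv c y)"
  using assms unfolding smooth_family_def smooth_on_def by fastforce

text \<open>The smooth extension \<open>H\<close> past the end times exhibits the velocity as a
  partial derivative, which is jointly continuous in time and point up to the end times, where
  \<open>velocity\<close> is one-sided.\<close>

lemma smooth_family_velocity:
  fixes A :: "('m::topological_space, 'n::finite) chart set"
  assumes A: "smooth_atlas A" and g: "smooth_family A {0..1} g" and c: "c \<in> A"
  shows "continuous_on ({0..1} \<times> cimg c) (\<lambda>(t, y). g t c (cinv c y))"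
    and "continuous_on ({0..1} \<times> cimg c) (\<lambda>(t, y). velocity g t c (cinv c y))"
    and "x \<in> cdom c \<Longrightarrow> t \<in> {0..1} \<Longrightarrow>
      ((\<lambda>s. g s c x) has_vector_derivative velocity g t c x) (at t within {0..1})"
proof -
  obtain T H where T: "open T" "{0..1} \<times> cimg c \<subseteq> T" and H0: "\<forall>k. Ck_on k T H"
    "\<forall>t\<in>{0..1}. \<forall>y\<in>cimg c. H (t, y) = g t c (cinv c y)"
    by (rule smooth_family_extension[OF g c])
  note H = H0(1)[rule_format] H0(2)[rule_format]
  have "continuous_on ({0..1} \<times> cimg c) H"
    using continuous_on_subset[OF Ck_on_continuous[OF H(1)] T(2)] .
  then show "continuous_on ({0..1} \<times> cimg c) (\<lambda>(t, y). g t c (cinv c y))"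
    by (rule continuous_on_cong[OF refl, THEN iffD1, rotated]) (auto simp: H(2))
  define D where "D p = frechet_derivative H (at p) (1, 0)" for p
  have deriv: "((\<lambda>s. g s c (cinv c y)) has_vector_derivative D (t, y)) (at t within {0..1})"
    if t: "t \<in> {0..1}" and y: "y \<in> cimg c" for t y
  proof -
    have dH: "(H has_derivative frechet_derivative H (at (t, y))) (at (t, y))"
      by (rule Ck_on_has_derivative[OF H(1)[of 1]]) (use T t y in auto)
    have "((\<lambda>s. (s, y)) has_derivative (\<lambda>h. (h, 0))) (at t within {0..1})"
      by (auto intro!: derivative_eq_intros)
    from has_derivative_compose[OF this dH]
    have "((\<lambda>s. H (s, y)) has_derivative (\<lambda>h. frechet_derivative H (at (t, y)) (h, 0))) (at t within {0..1})" .
    moreover have "frechet_derivative H (at (t, y)) (h, 0) = h *\<^sub>R D (t, y)" for h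
      using linear_scale[OF has_derivative_linear[OF dH], of h "(1, 0)"] by (simp add: D_def)
    ultimately have "((\<lambda>s. H (s, y)) has_vector_derivative D (t, y)) (at t within {0..1})"
      by (simp add: has_vector_derivative_def)
    then show ?thesis by (rule has_vector_derivative_transform[OF t, rotated]) (simp add: H(2) y)
  qed
  have vel: "velocity g t c (cinv c y) = D (t, y)" if "t \<in> {0..1}" "y \<in> cimg c" for t y
    unfolding velocity_def
    using vector_derivative_within_cbox[of 0 1 t] deriv[OF that] that by simp
  have "continuous_on T D"
    using H(1)[of "Suc 0"] unfolding Ck_on_Suc Ck_on_0 D_def by blast
  then have "continuous_on ({0..1} \<times> cimg c) D"
    using T(2) by (rule continuous_on_subset)
  then show "continuous_on ({0..1} \<times> cimg c) (\<lambda>(t, y). velocity g t c (cinv c y))"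
    by (rule continuous_on_cong[OF refl, THEN iffD1, rotated]) (auto simp: vel)
  show "((\<lambda>s. g s c x) has_vector_derivative velocity g t c x) (at t within {0..1})"
    if "x \<in> cdom c" "t \<in> {0..1}"
    using deriv[of t "coord c x"] vel[of t "coord c x"] atlas_cinv_coord[OF A c] atlas_coord_in[OF A c] that
    by simp
qed

lemma continuous_on_charts:
  fixes A :: "('m::topological_space, 'n::finite) chart set"
  assumes A: "smooth_atlas A"
    and e: "\<And>c. c \<in> A \<Longrightarrow> continuous_on ({0..1::real} \<times> cimg c) (\<lambda>(t, y). e c t (cinv c y))"
    and eq: "\<And>c t x. c \<in> A \<Longrightarrow> t \<in> {0..1} \<Longrightarrow> x \<in> cdom c \<Longrightarrow> E t x = (e c t x :: real)"
  shows "continuous_on ({0..1} \<times> UNIV) (\<lambda>(t, x). E t x)"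
proof -
  \<comment> \<open>Clamping the time to the unit interval makes the pieces
    \<open>UNIV \<times> cdom c\<close> open, so that continuity can be glued over them.\<close>
  define k :: "real \<Rightarrow> real" where "k t = max 0 (min 1 t)" for t
  have k: "k t \<in> {0..1}" "t \<in> {0..1} \<Longrightarrow> k t = t" for t by (auto simp: k_def)
  have "continuous_on (UNIV \<times> cdom c) (\<lambda>(t, x). E (k t) x)" if c: "c \<in> A" for c
  proof -
    have "continuous_on (UNIV \<times> cdom c) (\<lambda>p. (k (fst p), coord c (snd p)))"
      unfolding k_def
      by (intro continuous_intros continuous_on_compose2[OF atlas_continuous_coord[OF A c]]) auto
    then have "continuous_on (UNIV \<times> cdom c) (\<lambda>p. case (k (fst p), coord c (snd p)) of (t, y) \<Rightarrow> e c t (cinv c y))"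
      by (rule continuous_on_compose2[OF e[OF c]]) (use k atlas_coord_in[OF A c] in auto)
    then show ?thesis
      by (rule continuous_on_cong[OF refl, THEN iffD1, rotated])
         (use eq[OF c] k atlas_cinv_coord[OF A c] in auto)
  qed
  then have "continuous_on (\<Union>c\<in>A. UNIV \<times> cdom c) (\<lambda>(t, x). E (k t) x)"
    using atlas_open_cdom[OF A] by (intro continuous_on_open_UN) (auto intro!: open_Times)
  then have "continuous_on ({0..1} \<times> UNIV) (\<lambda>(t, x). E (k t) x)"
    by (rule continuous_on_subset) (use atlas_cover[OF A] in auto)
  then show ?thesis
    by (rule continuous_on_cong[OF refl, THEN iffD1, rotated]) (auto simp: k)
qed

text \<open>Compactness bounds the integrand uniformly; on a finite measure the constant bound
  serves for dominated convergence.\<close>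

lemma continuous_parametric_integral:
  fixes F :: "real \<Rightarrow> 'm::topological_space \<Rightarrow> real"
  assumes co: "compact (UNIV :: 'm set)" and \<nu>: "finite_measure \<nu>" "sets \<nu> = sets borel"
    and F: "continuous_on ({0..1} \<times> UNIV) (\<lambda>(t, x). F t x)"
  shows "t \<in> {0..1} \<Longrightarrow> integrable \<nu> (F t)" and "continuous_on {0..1} (\<lambda>t. \<integral>x. F t x \<partial>\<nu>)"
proof -
  interpret finite_measure \<nu> by fact
  have cF: "continuous_on UNIV (F t)" if "t \<in> {0..1}" for t
  proof -
    have "continuous_on UNIV (\<lambda>x. case (t, x) of (t, x) \<Rightarrow> F t x)"
      by (rule continuous_on_compose2[OF F]) (use that in \<open>auto intro!: continuous_intros\<close>)
    then show ?thesis by simp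
  qed
  have meas: "F t \<in> borel_measurable \<nu>" if "t \<in> {0..1}" for t
    using borel_measurable_continuous_onI[OF cF[OF that]] unfolding measurable_cong_sets[OF \<nu>(2) refl] .
  have "bounded ((\<lambda>(t, x). F t x) ` ({0..1} \<times> UNIV))"
    by (intro compact_imp_bounded compact_continuous_image F compact_Times co) simp
  then obtain B where B: "\<And>t x. t \<in> {0..1} \<Longrightarrow> \<bar>F t x\<bar> \<le> B"
    unfolding bounded_iff by fastforce
  show int: "integrable \<nu> (F t)" if "t \<in> {0..1}" for t
    by (rule integrable_const_bound[where B=B]) (use B that meas in auto)
  show "continuous_on {0..1} (\<lambda>t. \<integral>x. F t x \<partial>\<nu>)"
  proof (rule continuous_on_sequentiallyI)
    fix u :: "nat \<Rightarrow> real" and s assume u: "\<forall>n. u n \<in> {0..1}" "s \<in> {0..1}" "u \<longlonglongrightarrow> s"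
    show "(\<lambda>n. \<integral>x. F (u n) x \<partial>\<nu>) \<longlonglongrightarrow> (\<integral>x. F s x \<partial>\<nu>)"
    proof (rule integral_dominated_convergence[where w="\<lambda>_. B"])
      show "AE x in \<nu>. (\<lambda>n. F (u n) x) \<longlonglongrightarrow> F s x"
      proof (rule AE_I2)
        fix x
        have "continuous_on {0..1} (\<lambda>t. case (t, x) of (t, x) \<Rightarrow> F t x)"
          by (rule continuous_on_compose2[OF F]) (auto intro!: continuous_intros)
        then show "(\<lambda>n. F (u n) x) \<longlonglongrightarrow> F s x"
          using continuous_on_tendsto_compose[of "{0..1}" "\<lambda>t. F t x" u s sequentially] u by simp
      qed
    qed (use u B meas in \<open>auto\<close>)
  qed
qed

section \<open>Paths of metrics with a fixed volume form\<close>

locale metric_path =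
  fixes A :: "('m::t2_space, 'n::{finite,linorder}) chart set"
    and w :: "('m, 'n) chart \<Rightarrow> 'm \<Rightarrow> real" and g :: "real \<Rightarrow> ('m, 'n) tensor2"
  assumes co: "compact (UNIV :: 'm set)" and A: "smooth_atlas A" and w: "volume_form A w"
    and path: "smooth_path_in A w g"
begin

lemma g_in: "t \<in> {0..1} \<Longrightarrow> g t \<in> metrics_vol A w" and g_smooth: "smooth_family A {0..1} g"
  using path by (auto simp: smooth_path_in_def)

lemmas g_deriv = smooth_family_velocity(3)[OF A g_smooth]

lemma g_pd: "t \<in> {0..1} \<Longrightarrow> c \<in> A \<Longrightarrow> x \<in> cdom c \<Longrightarrow> pd (g t c x)"
  using metrics_vol_pd[OF g_in] .

lemma g_det_ne: "t \<in> {0..1} \<Longrightarrow> c \<in> A \<Longrightarrow> x \<in> cdom c \<Longrightarrow> det (g t c x) \<noteq> 0"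
  using pd_det_ne_0[OF g_pd] .

lemma g_jac: "t \<in> {0..1} \<Longrightarrow> c \<in> A \<Longrightarrow> d \<in> A \<Longrightarrow> x \<in> cdom c \<Longrightarrow> x \<in> cdom d \<Longrightarrow>
    g t c x = transpose (jac c d x) ** g t d x ** jac c d x"
  using sym_tensorsD(3)[OF metrics_vol_sym[OF g_in]] .

lemma velocity_unique:
  "t \<in> {0..1::real} \<Longrightarrow> (F has_vector_derivative u) (at t within {0..1}) \<Longrightarrow>
    (F has_vector_derivative v) (at t within {0..1}) \<Longrightarrow> u = v"
  using vector_derivative_within_cbox[of 0 1 t F u] vector_derivative_within_cbox[of 0 1 t F v] by simp

lemma velocity_sym:
  assumes "t \<in> {0..1}" "c \<in> A" "x \<in> cdom c"
  shows "transpose (velocity g t c x) = velocity g t c x"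
proof (rule velocity_unique[OF assms(1) _ g_deriv[OF assms(2,3,1)]])
  have "((\<lambda>s. transpose (g s c x)) has_vector_derivative transpose (velocity g t c x)) (at t within {0..1})"
    by (rule bounded_linear.has_vector_derivative[OF bounded_linear_transpose g_deriv[OF assms(2,3,1)]])
  then show "((\<lambda>s. g s c x) has_vector_derivative transpose (velocity g t c x)) (at t within {0..1})"
    by (rule has_vector_derivative_transform[OF assms(1), rotated])
       (use g_pd assms in \<open>auto simp: pd_def\<close>)
qed

lemma velocity_jac:
  assumes "t \<in> {0..1}" "c \<in> A" "d \<in> A" "x \<in> cdom c" "x \<in> cdom d"
  shows "velocity g t c x = transpose (jac c d x) ** velocity g t d x ** jac c d x"
proof (rule velocity_unique[OF assms(1) g_deriv[OF assms(2,4,1)]])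
  have "bounded_linear (\<lambda>B. transpose (jac c d x) ** B ** jac c d x)"
    using bounded_linear_compose[OF bounded_bilinear.bounded_linear_left[OF bounded_bilinear_matrix_mult, of "jac c d x"]
      bounded_bilinear.bounded_linear_right[OF bounded_bilinear_matrix_mult, of "transpose (jac c d x)"]] .
  from bounded_linear.has_vector_derivative[OF this g_deriv[OF assms(3,5,1)]]
  have "((\<lambda>s. transpose (jac c d x) ** g s d x ** jac c d x) has_vector_derivative
      transpose (jac c d x) ** velocity g t d x ** jac c d x) (at t within {0..1})" .
  then show "((\<lambda>s. g s c x) has_vector_derivative
      transpose (jac c d x) ** velocity g t d x ** jac c d x) (at t within {0..1})"
    by (rule has_vector_derivative_transform[OF assms(1), rotated]) (rule g_jac[OF _ assms(2-5)])
qed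

definition X :: "real \<Rightarrow> ('m, 'n) tensor2" where
  "X t c x = matrix_inv (g t c x) ** velocity g t c x"

lemma g_X: "t \<in> {0..1} \<Longrightarrow> c \<in> A \<Longrightarrow> x \<in> cdom c \<Longrightarrow> g t c x ** X t c x = velocity g t c x"
  by (simp add: X_def matrix_mul_assoc matrix_inv_mult g_det_ne)

lemma matrix_inv_g_jac:
  assumes "t \<in> {0..1}" "c \<in> A" "d \<in> A" "x \<in> cdom c" "x \<in> cdom d"
  shows "jac c d x ** matrix_inv (g t c x) = matrix_inv (g t d x) ** transpose (jac d c x)"
proof -
  have JK: "jac c d x ** jac d c x = mat 1" by (rule jac_inverse[OF A assms(3,2,5,4)])
  show ?thesis
    unfolding g_jac[OF assms] matrix_inv_congruence[OF g_det_ne[OF assms(1,3,5)] JK]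
    by (simp add: matrix_mul_assoc JK)
qed

lemma X_jac:
  assumes "t \<in> {0..1}" "c \<in> A" "d \<in> A" "x \<in> cdom c" "x \<in> cdom d"
  shows "jac c d x ** X t c x = X t d x ** jac c d x"
proof -
  have JK: "transpose (jac d c x) ** transpose (jac c d x) = mat 1"
    using arg_cong[OF jac_inverse[OF A assms(3,2,5,4)], of transpose] by (simp add: matrix_transpose_mul)
  have "jac c d x ** X t c x = matrix_inv (g t d x) ** (transpose (jac d c x) ** transpose (jac c d x)) ** velocity g t d x ** jac c d x"
    unfolding X_def velocity_jac[OF assms]
    by (simp add: matrix_mul_assoc matrix_inv_g_jac[OF assms])
  then show ?thesis by (simp add: JK X_def)
qed

lemma continuous_matrix_inv_g:
  assumes c: "c \<in> A"
  shows "continuous_on ({0..1} \<times> cimg c) (\<lambda>(t, y). matrix_inv (g t c (cinv c y)))"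
proof -
  have "continuous_on ({0..1} \<times> cimg c) (\<lambda>p. matrix_inv (case p of (t, y) \<Rightarrow> g t c (cinv c y)))"
    by (rule continuous_on_matrix_inv[OF smooth_family_velocity(1)[OF A g_smooth c]])
       (use g_det_ne[OF _ c] atlas_cinv_in[OF A c] in auto)
  then show ?thesis by (simp add: split_def)
qed

lemma continuous_X:
  assumes c: "c \<in> A"
  shows "continuous_on ({0..1} \<times> cimg c) (\<lambda>(t, y). X t c (cinv c y))"
  using continuous_on_matrix_mult[OF continuous_matrix_inv_g[OF c] smooth_family_velocity(2)[OF A g_smooth c]]
  by (simp add: split_def X_def)

definition \<nu> :: "'m measure" where "\<nu> = volume_measure A w"

lemma \<nu>: "is_volume_measure A w \<nu>"
  unfolding \<nu>_def by (rule volume_measure[OF co A w refl])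

lemma finite_\<nu>: "finite_measure \<nu>" by (rule volume_measure_finite[OF co A w \<nu>])

lemma sets_\<nu>: "sets \<nu> = sets borel" using \<nu> by (simp add: is_volume_measure_def)

text \<open>All metrics of \<open>metrics_vol A w\<close> integrate against one measure, so along a
  variation the \<open>L2_metric\<close> changes through its integrand only.\<close>

lemma metric_volume_measure:
  assumes "h \<in> metrics_vol A w"
  shows "volume_measure A (\<lambda>c x. sqrt (det (h c x))) = \<nu>"
  unfolding \<nu>_def by (rule volume_measure_cong[OF co A w]) (simp add: metrics_vol_det(1)[OF w assms])

end

section \<open>Variation of a path by a nilpotent field\<close>

locale bump_variation = metric_path A w g
  for A :: "('m::t2_space, 'n::{finite,linorder}) chart set" and w g +
  fixes c0 :: "('m, 'n) chart" and a :: "'n rvec" and r :: real and N :: "'n sqmat"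
  assumes c0: "c0 \<in> A" and r: "r > 0" "cball a r \<subseteq> cimg c0"
    and N: "N ** N = 0" "\<And>s. det (mat 1 + s *\<^sub>R N) = 1"
begin

abbreviation "Y \<equiv> bump_endo c0 a r N"

text \<open>Twice the part of \<open>Y\<close> that is self-adjoint for \<open>g t\<close>.\<close>

definition Z :: "real \<Rightarrow> ('m, 'n) tensor2" where
  "Z t c x = Y c x + matrix_inv (g t c x) ** transpose (Y c x) ** g t c x"

lemma Z_jac:
  assumes "t \<in> {0..1}" "c \<in> A" "d \<in> A" "x \<in> cdom c" "x \<in> cdom d"
  shows "jac c d x ** Z t c x = Z t d x ** jac c d x"
proof -
  let ?J = "jac c d x" and ?K = "jac d c x"
  have JK: "?J ** ?K = mat 1" by (rule jac_inverse[OF A assms(3,2,5,4)])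
  have YJ: "?J ** Y c x = Y d x ** ?J" by (rule bump_endo_jac[OF A assms(2,3) c0 assms(4,5)])
  have "transpose ?K ** transpose (Y c x) ** transpose ?J = transpose (?J ** Y c x ** ?K)"
    by (simp add: matrix_transpose_mul matrix_mul_assoc)
  also have "\<dots> = transpose (Y d x)" by (simp add: YJ JK matrix_mul_assoc[symmetric])
  finally have 1: "transpose ?K ** transpose (Y c x) ** transpose ?J = transpose (Y d x)" .
  have "?J ** (matrix_inv (g t c x) ** transpose (Y c x) ** g t c x)
     = matrix_inv (g t d x) ** (transpose ?K ** transpose (Y c x) ** transpose ?J) ** g t d x ** ?J"
  proof -
    have "?J ** (matrix_inv (g t c x) ** transpose (Y c x) ** g t c x)
      = matrix_inv (g t d x) ** transpose ?K ** transpose (Y c x) ** g t c x"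
      by (simp only: matrix_mul_assoc matrix_inv_g_jac[OF assms])
    then show ?thesis by (subst (asm) (2) g_jac[OF assms]) (simp only: matrix_mul_assoc)
  qed
  then show ?thesis by (simp add: Z_def matrix_add_ldistrib matrix_add_mult_distrib YJ 1)
qed

lemma continuous_Y:
  assumes c: "c \<in> A"
  shows "continuous_on ({0..1} \<times> cimg c) (\<lambda>(t::real, y). Y c (cinv c y))"
  unfolding split_def
  by (rule continuous_on_compose2[OF Ck_on_continuous[OF bump_endo_Ck[OF A c c0 r]] continuous_on_snd[OF continuous_on_id]]) auto

lemma continuous_Z:
  assumes c: "c \<in> A"
  shows "continuous_on ({0..1} \<times> cimg c) (\<lambda>(t, y). Z t c (cinv c y))"
proof -
  have "continuous_on ({0..1} \<times> cimg c) (\<lambda>p. transpose (case p of (t::real, y) \<Rightarrow> Y c (cinv c y)))"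
    by (rule bounded_linear.continuous_on[OF bounded_linear_transpose continuous_Y[OF c]])
  from continuous_on_add[OF continuous_Y[OF c] continuous_on_matrix_mult[OF
      continuous_on_matrix_mult[OF continuous_matrix_inv_g[OF c] this] smooth_family_velocity(1)[OF A g_smooth c]]]
  show ?thesis by (simp add: split_def Z_def)
qed

text \<open>\<open>e0\<close>, \<open>4 * e1\<close> and \<open>e2\<close> are the coefficients of
  the squared speed of the variation as a polynomial in \<open>s * \<phi>'\<close>. They are read
  off in \<open>chart_at A x\<close> to match \<open>L2_metric\<close>.\<close>

definition e0 where "e0 t x = (let c = chart_at A x in trace (X t c x ** X t c x))"
definition e1 where "e1 t x = (let c = chart_at A x in trace (X t c x ** Y c x))"
definition e2 where "e2 t x = (let c = chart_at A x in trace (Z t c x ** Z t c x))"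

lemma trace_chart:
  assumes "\<And>d. d \<in> A \<Longrightarrow> x \<in> cdom d \<Longrightarrow> jac c d x ** F c = F d ** jac c d x"
    "\<And>d. d \<in> A \<Longrightarrow> x \<in> cdom d \<Longrightarrow> jac c d x ** F' c = F' d ** jac c d x" "c \<in> A" "x \<in> cdom c"
  shows "trace (F (chart_at A x) ** F' (chart_at A x)) = trace (F c ** F' c)"
  using assms(1,2)[OF chart_at[OF A]] jac_inverse[OF A assms(3) chart_at(1)[OF A] assms(4) chart_at(2)[OF A]]
  by (intro trace_conj[symmetric])

lemma e_chart:
  assumes "c \<in> A" "t \<in> {0..1}" "x \<in> cdom c"
  shows "e0 t x = trace (X t c x ** X t c x)" "e1 t x = trace (X t c x ** Y c x)"
    "e2 t x = trace (Z t c x ** Z t c x)"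
proof -
  have X: "jac c d x ** X t c x = X t d x ** jac c d x" if "d \<in> A" "x \<in> cdom d" for d
    by (rule X_jac[OF assms(2,1) that(1) assms(3) that(2)])
  have Z: "jac c d x ** Z t c x = Z t d x ** jac c d x" if "d \<in> A" "x \<in> cdom d" for d
    by (rule Z_jac[OF assms(2,1) that(1) assms(3) that(2)])
  have Y: "jac c d x ** Y c x = Y d x ** jac c d x" if "d \<in> A" "x \<in> cdom d" for d
    by (rule bump_endo_jac[OF A assms(1) that(1) c0 assms(3) that(2)])
  show "e0 t x = trace (X t c x ** X t c x)" unfolding e0_def Let_def
    by (rule trace_chart[where F="\<lambda>c. X t c x" and F'="\<lambda>c. X t c x", OF X X assms(1,3)])
  show "e1 t x = trace (X t c x ** Y c x)" unfolding e1_def Let_def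
    by (rule trace_chart[where F="\<lambda>c. X t c x" and F'="\<lambda>c. Y c x", OF X Y assms(1,3)])
  show "e2 t x = trace (Z t c x ** Z t c x)" unfolding e2_def Let_def
    by (rule trace_chart[where F="\<lambda>c. Z t c x" and F'="\<lambda>c. Z t c x", OF Z Z assms(1,3)])
qed

lemma continuous_e:
  shows "continuous_on ({0..1} \<times> UNIV) (\<lambda>(t, x). e0 t x)" "continuous_on ({0..1} \<times> UNIV) (\<lambda>(t, x). e1 t x)"
    "continuous_on ({0..1} \<times> UNIV) (\<lambda>(t, x). e2 t x)"
proof -
  show "continuous_on ({0..1} \<times> UNIV) (\<lambda>(t, x). e0 t x)"
  proof (rule continuous_on_charts[OF A _ e_chart(1)])
    fix c assume c: "c \<in> A"
    from continuous_on_trace[OF continuous_on_matrix_mult[OF continuous_X[OF c] continuous_X[OF c]]]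
    show "continuous_on ({0..1} \<times> cimg c) (\<lambda>(t, y). trace (X t c (cinv c y) ** X t c (cinv c y)))"
      by (simp add: split_def)
  qed
  show "continuous_on ({0..1} \<times> UNIV) (\<lambda>(t, x). e1 t x)"
  proof (rule continuous_on_charts[OF A _ e_chart(2)])
    fix c assume c: "c \<in> A"
    from continuous_on_trace[OF continuous_on_matrix_mult[OF continuous_X[OF c] continuous_Y[OF c]]]
    show "continuous_on ({0..1} \<times> cimg c) (\<lambda>(t, y). trace (X t c (cinv c y) ** Y c (cinv c y)))"
      by (simp add: split_def)
  qed
  show "continuous_on ({0..1} \<times> UNIV) (\<lambda>(t, x). e2 t x)"
  proof (rule continuous_on_charts[OF A _ e_chart(3)])
    fix c assume c: "c \<in> A"
    from continuous_on_trace[OF continuous_on_matrix_mult[OF continuous_Z[OF c] continuous_Z[OF c]]]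
    show "continuous_on ({0..1} \<times> cimg c) (\<lambda>(t, y). trace (Z t c (cinv c y) ** Z t c (cinv c y)))"
      by (simp add: split_def)
  qed
qed

lemmas integrable_e = continuous_e[THEN continuous_parametric_integral(1)[OF co finite_\<nu> sets_\<nu>]]
lemmas continuous_integral_e = continuous_e[THEN continuous_parametric_integral(2)[OF co finite_\<nu> sets_\<nu>]]

definition P where "P \<sigma> c x = mat 1 + \<sigma> *\<^sub>R Y c x"

definition G :: "(real \<Rightarrow> real) \<Rightarrow> real \<Rightarrow> real \<Rightarrow> ('m, 'n) tensor2" where
  "G \<phi> s t c x = transpose (P (s * \<phi> t) c x) ** g t c x ** P (s * \<phi> t) c x"

lemma P_det: "c \<in> A \<Longrightarrow> det (P \<sigma> c x) = 1"
  unfolding P_def by (rule bump_endo_det[OF A _ c0 N(2)])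

lemma P_0: "P 0 c x = mat 1" by (simp add: P_def)

lemma P_Ck: "c \<in> A \<Longrightarrow> Ck_on k (cimg c) (\<lambda>y. P \<sigma> c (cinv c y))"
  unfolding P_def
  by (intro Ck_on_add[OF atlas_open_cimg[OF A]] Ck_on_const
      Ck_on_bounded_linear[OF atlas_open_cimg[OF A] bounded_linear_scaleR_right] bump_endo_Ck[OF A _ c0 r])

lemma P_jac:
  assumes "c \<in> A" "d \<in> A" "x \<in> cdom c" "x \<in> cdom d"
  shows "jac c d x ** P \<sigma> c x = P \<sigma> d x ** jac c d x"
  using bump_endo_jac[OF A assms(1,2) c0 assms(3,4)]
  by (simp add: P_def matrix_add_ldistrib matrix_add_mult_distrib matrix_mul_scaleR)

lemma G_in:
  assumes t: "t \<in> {0..1}"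
  shows "G \<phi> s t \<in> metrics_vol A w"
proof (rule metrics_volI[OF _ _ _ g_in[OF t]])
  note gt = sym_tensorsD[OF metrics_vol_sym[OF g_in[OF t]]]
  show "G \<phi> s t \<in> sym_tensors A"
    unfolding sym_tensors_def mem_Collect_eq
  proof (intro conjI allI impI ballI)
    show "G \<phi> s t c x = 0" if "c \<notin> A \<or> x \<notin> cdom c" for c x
      using gt(1)[OF that] by (simp add: G_def)
    show "transpose (G \<phi> s t c x) = G \<phi> s t c x" if "c \<in> A" "x \<in> cdom c" for c x
      unfolding G_def by (rule transpose_congruence[OF gt(2)[OF that]])
    show "G \<phi> s t c x = transpose (jac c d x) ** G \<phi> s t d x ** jac c d x"
      if "c \<in> A" "d \<in> A" "x \<in> cdom c \<inter> cdom d" for c d x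
    proof -
      have x: "x \<in> cdom c" "x \<in> cdom d" using that by auto
      have 1: "jac c d x ** P (s * \<phi> t) c x = P (s * \<phi> t) d x ** jac c d x" by (rule P_jac[OF that(1,2) x])
      have "G \<phi> s t c x = transpose (jac c d x ** P (s * \<phi> t) c x) ** g t d x ** (jac c d x ** P (s * \<phi> t) c x)"
        unfolding G_def gt(3)[OF that(1,2) x] by (simp add: matrix_transpose_mul matrix_mul_assoc)
      then show ?thesis unfolding 1 G_def by (simp add: matrix_transpose_mul matrix_mul_assoc)
    qed
    show "smooth_on (cimg c) (\<lambda>y. G \<phi> s t c (cinv c y))" if c: "c \<in> A" for c
      using gt(4)[OF c] unfolding smooth_on_open[OF atlas_open_cimg[OF A c]] G_def
      by (intro allI Ck_on_bilinear[OF atlas_open_cimg[OF A c] bounded_bilinear_matrix_mult]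
          Ck_on_bounded_linear[OF atlas_open_cimg[OF A c] bounded_linear_transpose] P_Ck[OF c]) simp
  qed
  show "pd (G \<phi> s t c x)" if "c \<in> A" "x \<in> cdom c" for c x
    unfolding G_def by (rule pd_congruence[OF g_pd[OF t that]]) (simp add: P_det that)
  show "det (G \<phi> s t c x) = det (g t c x)" if "c \<in> A" "x \<in> cdom c" for c x
    by (simp add: G_def det_mul P_det that)
qed

lemma G_smooth:
  assumes \<phi>: "real_polynomial_function \<phi>"
  shows "smooth_family A ({-1<..<1} \<times> {0..1}) (\<lambda>(s, t). G \<phi> s t)"
  unfolding smooth_family_def
proof
  fix c assume c: "c \<in> A"
  obtain T H where T: "open T" "{0..1} \<times> cimg c \<subseteq> T" and H0: "\<forall>k. Ck_on k T H"
    "\<forall>t\<in>{0..1}. \<forall>y\<in>cimg c. H (t, y) = g t c (cinv c y)"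
    by (rule smooth_family_extension[OF g_smooth c])
  note H = H0(1)[rule_format] H0(2)[rule_format]
  let ?p1 = "\<lambda>q :: (real \<times> real) \<times> 'n rvec. fst (fst q)"
  let ?p2 = "\<lambda>q :: (real \<times> real) \<times> 'n rvec. snd (fst q)"
  \<comment> \<open>An open set of parameters and points on which the extension \<open>H\<close> is
    defined and the point lies in the chart image; it contains times slightly outside the unit
    interval, where the polynomial \<open>\<phi>\<close> is defined as well.\<close>
  define T' where "T' = {q. (?p2 q, snd q) \<in> T \<and> snd q \<in> cimg c}"
  have "continuous_on UNIV (\<lambda>q. (?p2 q, snd q))" by (intro continuous_intros)
  from open_vimage[OF T(1) this] open_vimage[OF atlas_open_cimg[OF A c] continuous_on_snd[OF continuous_on_id]]
  have T': "open T'" unfolding T'_def by (auto simp: vimage_def Collect_conj_eq)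
  define Q where "Q q = mat 1 + (?p1 q * \<phi> (?p2 q)) *\<^sub>R Y c (cinv c (snd q))" for q
  have l1: "bounded_linear ?p1" and l2: "bounded_linear ?p2"
    by (intro bounded_linear_compose[OF bounded_linear_fst bounded_linear_fst]
        bounded_linear_compose[OF bounded_linear_snd bounded_linear_fst])+
  have Q: "Ck_on k T' Q" for k
    unfolding Q_def
  proof (intro Ck_on_add[OF T'] Ck_on_const Ck_on_bilinear[OF T' bounded_bilinear_scaleR]
      Ck_on_bilinear[OF T' bounded_bilinear_mult] Ck_on_linear[OF T' l1])
    show "Ck_on k T' (\<lambda>q. \<phi> (?p2 q))"
      by (rule Ck_on_compose[OF T' open_UNIV _ real_polynomial_function_Ck_on[OF \<phi> open_UNIV] Ck_on_linear[OF T' l2]]) simp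
    show "Ck_on k T' (\<lambda>q. Y c (cinv c (snd q)))"
      by (rule Ck_on_compose[OF T' atlas_open_cimg[OF A c] _ bump_endo_Ck[OF A c c0 r] Ck_on_linear[OF T' bounded_linear_snd]])
         (auto simp: T'_def)
  qed
  have H': "Ck_on k T' (\<lambda>q. H (?p2 q, snd q))" for k
    by (rule Ck_on_compose[OF T' T(1) _ H(1) Ck_on_linear[OF T' bounded_linear_Pair[OF l2 bounded_linear_snd]]])
       (auto simp: T'_def)
  show "smooth_on (({-1<..<1} \<times> {0..1}) \<times> cimg c) (\<lambda>(p, y). (case p of (s, t) \<Rightarrow> G \<phi> s t) c (cinv c y))"
    unfolding smooth_on_def
  proof (intro exI[of _ T'] exI[of _ "\<lambda>q. transpose (Q q) ** H (?p2 q, snd q) ** Q q"] conjI allI ballI T')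
    show "({-1<..<1} \<times> {0..1}) \<times> cimg c \<subseteq> T'" using T(2) by (auto simp: T'_def)
    show "Ck_on k T' (\<lambda>q. transpose (Q q) ** H (?p2 q, snd q) ** Q q)" for k
      by (intro Ck_on_bilinear[OF T' bounded_bilinear_matrix_mult]
          Ck_on_bounded_linear[OF T' bounded_linear_transpose] Q H')
    show "transpose (Q q) ** H (?p2 q, snd q) ** Q q = (case q of (p, y) \<Rightarrow> (case p of (s, t) \<Rightarrow> G \<phi> s t) c (cinv c y))"
      if "q \<in> ({-1<..<1} \<times> {0..1}) \<times> cimg c" for q
      using that by (auto simp: G_def P_def Q_def H(2))
  qed
qed

lemma G_proper:
  assumes "real_polynomial_function \<phi>" "\<phi> 0 = 0" "\<phi> 1 = 0"
  shows "proper_variation A w g (G \<phi>)"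
  unfolding proper_variation_def
proof (intro conjI ballI exI[of _ "1::real"])
  show "G \<phi> 0 t = g t" for t by (intro ext) (simp add: G_def P_0)
  show "G \<phi> s 0 = g 0" "G \<phi> s 1 = g 1" for s
    by (intro ext; simp add: G_def P_0 assms)+
  show "G \<phi> s t \<in> metrics_vol A w" if "t \<in> {0..1}" for s t by (rule G_in[OF that])
  show "smooth_family A ({- 1<..<1} \<times> {0..1}) (\<lambda>(s, t). G \<phi> s t)" by (rule G_smooth[OF assms(1)])
qed simp

lemma G_velocity:
  assumes t: "t \<in> {0..1}" and c: "c \<in> A" "x \<in> cdom c" and \<phi>: "(\<phi> has_real_derivative \<phi>') (at t)"
  shows "velocity (G \<phi> s) t c x = (s * \<phi>') *\<^sub>R (transpose (Y c x) ** g t c x ** P (s * \<phi> t) c x)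
    + transpose (P (s * \<phi> t) c x) ** velocity g t c x ** P (s * \<phi> t) c x
    + (s * \<phi>') *\<^sub>R (transpose (P (s * \<phi> t) c x) ** g t c x ** Y c x)"
proof -
  note bil = bounded_bilinear.has_vector_derivative[OF bounded_bilinear_matrix_mult]
  have "((\<lambda>t. s * \<phi> t) has_vector_derivative (s * \<phi>')) (at t within {0..1})"
    using has_field_derivative_at_within[OF DERIV_cmult[OF \<phi>, of s], of "{0..1}"] by (simp add: has_real_derivative_iff_has_vector_derivative)
  note Y' = bounded_linear.has_vector_derivative[OF bounded_linear_scaleR_left this, of "Y c x"]
  have P: "((\<lambda>t. P (s * \<phi> t) c x) has_vector_derivative ((s * \<phi>') *\<^sub>R Y c x)) (at t within {0..1})"
    unfolding P_def using has_vector_derivative_add[OF has_vector_derivative_const Y'] by simp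
  note TP = bounded_linear.has_vector_derivative[OF bounded_linear_transpose P]
  have "((\<lambda>t. G \<phi> s t c x) has_vector_derivative
      (transpose (P (s * \<phi> t) c x) ** g t c x ** ((s * \<phi>') *\<^sub>R Y c x) +
       (transpose (P (s * \<phi> t) c x) ** velocity g t c x + transpose ((s * \<phi>') *\<^sub>R Y c x) ** g t c x) ** P (s * \<phi> t) c x))
     (at t within {0..1})"
    unfolding G_def by (intro bil TP P g_deriv c t)
  from vector_derivative_within_cbox[OF zero_less_one _ this[folded cbox_interval]] t
  show ?thesis
    unfolding velocity_def[of "G \<phi> s"] by (simp add: transpose_scalar matrix_mul_scaleR matrix_add_mult_distrib)
qed

lemma G_L2:
  assumes t: "t \<in> {0..1}" and \<phi>: "(\<phi> has_real_derivative \<phi>') (at t)"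
  shows "L2_metric A (G \<phi> s t) (velocity (G \<phi> s) t) (velocity (G \<phi> s) t) =
    (\<integral>x. e0 t x \<partial>\<nu>) + 4 * (s * \<phi>') * (\<integral>x. e1 t x \<partial>\<nu>) + (s * \<phi>')\<^sup>2 * (\<integral>x. e2 t x \<partial>\<nu>)"
proof -
  have "(let c = chart_at A x in trace (matrix_inv (G \<phi> s t c x) ** velocity (G \<phi> s) t c x **
      matrix_inv (G \<phi> s t c x) ** velocity (G \<phi> s) t c x))
    = e0 t x + 4 * (s * \<phi>') * e1 t x + (s * \<phi>')\<^sup>2 * e2 t x" for x
  proof -
    define c where "c = chart_at A x"
    have c: "c \<in> A" "x \<in> cdom c" unfolding c_def by (rule chart_at[OF A])+
    show ?thesis
      unfolding e0_def e1_def e2_def Let_def c_def[symmetric] G_velocity[OF t c \<phi>] X_def Z_def G_def P_def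
      using g_pd[OF t c] by (intro variation_speed g_det_ne[OF t c] velocity_sym[OF t c] bump_endo_square[OF A c(1) c0 N(1)])
        (simp add: pd_def)
  qed
  then show ?thesis
    unfolding L2_metric_def metric_volume_measure[OF G_in[OF t]] using integrable_e[OF t] by simp
qed

lemma first_variation:
  assumes geo: "geodesic_segment A w g"
    and \<phi>: "real_polynomial_function \<phi>" "\<phi> 0 = 0" "\<phi> 1 = 0"
    and \<phi>': "\<And>t. (\<phi> has_real_derivative \<phi>' t) (at t)" "continuous_on {0..1} \<phi>'"
  shows "integral {0..1} (\<lambda>t. \<phi>' t * (\<integral>x. e1 t x \<partial>\<nu>)) = 0"
proof -
  define I0 where "I0 = integral {0..1} (\<lambda>t. \<integral>x. e0 t x \<partial>\<nu>)"
  define I1 where "I1 = integral {0..1} (\<lambda>t. \<phi>' t * (\<integral>x. e1 t x \<partial>\<nu>))"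
  define I2 where "I2 = integral {0..1} (\<lambda>t. (\<phi>' t)\<^sup>2 * (\<integral>x. e2 t x \<partial>\<nu>))"
  have E: "energy A (G \<phi> s) = 1/2 * (I0 + (4 * s) * I1 + s\<^sup>2 * I2)" for s
  proof -
    have "integral {0..1} (\<lambda>t. L2_metric A (G \<phi> s t) (velocity (G \<phi> s) t) (velocity (G \<phi> s) t))
      = integral {0..1} (\<lambda>t. (\<integral>x. e0 t x \<partial>\<nu>) + (4 * s) * (\<phi>' t * (\<integral>x. e1 t x \<partial>\<nu>)) + s\<^sup>2 * ((\<phi>' t)\<^sup>2 * (\<integral>x. e2 t x \<partial>\<nu>)))"
      by (rule integral_cong) (simp add: G_L2[OF _ \<phi>'(1)] power_mult_distrib)
    also have "\<dots> = I0 + (4 * s) * I1 + s\<^sup>2 * I2"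
      unfolding I0_def I1_def I2_def
      by (intro integral_unique has_integral_add has_integral_mult_right integrable_integral
          integrable_continuous_interval continuous_intros continuous_integral_e \<phi>'(2))
    finally show ?thesis by (simp add: energy_def)
  qed
  have "((\<lambda>s. 1/2 * (I0 + (4 * s) * I1 + s\<^sup>2 * I2)) has_real_derivative 2 * I1) (at 0)"
    by (auto intro!: derivative_eq_intros)
  moreover have "((\<lambda>s. energy A (G \<phi> s)) has_real_derivative 0) (at 0)"
    using geo G_proper[OF \<phi>] unfolding geodesic_segment_def by blast
  ultimately have "2 * I1 = 0" unfolding E by (rule DERIV_unique)
  then show ?thesis by (simp add: I1_def)
qed

end

section \<open>Geodesics\<close>

text \<open>Polynomial test functions suffice: minus its mean, \<open>b\<close> is orthogonal to all
  polynomials, hence to itself by uniform approximation.\<close>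

lemma du_bois_reymond:
  fixes b :: "real \<Rightarrow> real"
  assumes b: "continuous_on {0..1} b"
    and orth: "\<And>\<phi> \<phi>'. real_polynomial_function \<phi> \<Longrightarrow> \<phi> 0 = 0 \<Longrightarrow> \<phi> 1 = 0 \<Longrightarrow>
      (\<And>t. (\<phi> has_real_derivative \<phi>' t) (at t)) \<Longrightarrow> continuous_on {0..1} \<phi>' \<Longrightarrow>
      integral {0..1} (\<lambda>t. \<phi>' t * b t) = 0"
    and st: "s \<in> {0..1}" "t \<in> {0..1}"
  shows "b s = b t"
proof -
  define m where "m = integral {0..1} b"
  define B where "B t = b t - m" for t
  have B: "continuous_on {0..1} B" unfolding B_def by (intro continuous_intros b)
  note int = integrable_continuous_interval
  have poly: "integral {0..1} (\<lambda>t. q t * B t) = 0" and qc: "continuous_on {0..1} q"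
    if "real_polynomial_function q" for q
  proof -
    obtain a n where q: "q = (\<lambda>x. \<Sum>i\<le>n. a i * x ^ i)"
      using \<open>real_polynomial_function q\<close> real_polynomial_function_iff_sum by blast
    define Q where "Q x = (\<Sum>i\<le>n. a i / real (Suc i) * x ^ Suc i)" for x
    have Qp: "real_polynomial_function Q"
      unfolding Q_def
      by (rule real_polynomial_function_sum[OF finite_atMost], rule real_polynomial_function.intros(4)[OF real_polynomial_function.intros(2)],
          rule real_polynomial_function_power, rule real_polynomial_function.intros(1)[OF bounded_linear_ident])
    have "((\<lambda>x. a i / real (Suc i) * x ^ Suc i) has_real_derivative a i * t ^ i) (at t)" for i t
      using DERIV_cmult[OF DERIV_pow[of "Suc i" t UNIV], of "a i / real (Suc i)"] by simp
    then have dQ: "(Q has_real_derivative q t) (at t)" for t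
      unfolding Q_def q by (intro DERIV_sum)
    show qc: "continuous_on {0..1} q" unfolding q by (intro continuous_intros)
    \<comment> \<open>The antiderivative \<open>Q\<close> vanishes at 0 but not at 1. The correction
      \<open>t * Q 1\<close> repairs this and leaves a constant in the derivative, which the mean
      subtracted in \<open>B\<close> compensates.\<close>
    have "integral {0..1} (\<lambda>t. (q t - Q 1) * b t) = 0"
    proof (rule orth[of "\<lambda>t. Q t - t * Q 1"])
      show "real_polynomial_function (\<lambda>t. Q t - t * Q 1)"
        by (rule real_polynomial_function_diff[OF Qp real_polynomial_function.intros(4)[OF
            real_polynomial_function.intros(1)[OF bounded_linear_ident] real_polynomial_function.intros(2)]])
      show "((\<lambda>t. Q t - t * Q 1) has_real_derivative q t - Q 1) (at t)" for t
        by (auto intro!: derivative_eq_intros dQ)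
    qed (auto simp: Q_def intro!: continuous_intros qc)
    moreover have "integral {0..1} q = Q 1"
      using fundamental_theorem_of_calculus[of 0 1 Q q] dQ
      by (intro integral_unique) (auto simp: Q_def has_real_derivative_iff_has_vector_derivative[symmetric]
          intro: has_field_derivative_at_within)
    moreover have "integral {0..1} (\<lambda>t. (q t - Q 1) * b t) = integral {0..1} (\<lambda>t. q t * b t) - Q 1 * m"
    proof -
      have "(\<lambda>t. (q t - Q 1) * b t) = (\<lambda>t. q t * b t - Q 1 * b t)" by (simp add: algebra_simps)
      then show ?thesis unfolding m_def
        by (simp only:) (intro integral_unique has_integral_diff has_integral_mult_right integrable_integral int continuous_intros b qc)
    qed
    moreover have "integral {0..1} (\<lambda>t. q t * B t) = integral {0..1} (\<lambda>t. q t * b t) - m * integral {0..1} q"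
    proof -
      have "(\<lambda>t. q t * B t) = (\<lambda>t. q t * b t - m * q t)" by (simp add: B_def algebra_simps)
      then show ?thesis
        by (simp only:) (intro integral_unique has_integral_diff has_integral_mult_right integrable_integral int continuous_intros b qc)
    qed
    ultimately show "integral {0..1} (\<lambda>t. q t * B t) = 0" by simp
  qed
  define K where "K = integral {0..1} (\<lambda>t. \<bar>B t\<bar>)"
  have "integral {0..1} (\<lambda>t. B t * B t) \<le> e * K" if "e > 0" for e
  proof -
    obtain q where q: "real_polynomial_function q" "\<And>x. x \<in> {0..1} \<Longrightarrow> \<bar>B x - q x\<bar> < e"
      using Stone_Weierstrass_real_polynomial_function[OF _ B \<open>e > 0\<close>] by auto
    have "integral {0..1} (\<lambda>t. B t * B t) = integral {0..1} (\<lambda>t. B t * B t) - integral {0..1} (\<lambda>t. q t * B t)"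
      using poly[OF q(1)] by simp
    also have "\<dots> = integral {0..1} (\<lambda>t. B t * B t - q t * B t)"
      by (rule integral_diff[symmetric]) (intro int continuous_intros B qc[OF q(1)])+
    also have "\<dots> \<le> integral {0..1} (\<lambda>t. e * \<bar>B t\<bar>)"
    proof (rule integral_le)
      show "B t * B t - q t * B t \<le> e * \<bar>B t\<bar>" if "t \<in> {0..1}" for t
      proof -
        have "B t * B t - q t * B t \<le> \<bar>B t - q t\<bar> * \<bar>B t\<bar>"
          unfolding abs_mult[symmetric] by (rule order_trans[OF _ abs_ge_self]) (simp add: algebra_simps)
        also have "\<dots> \<le> e * \<bar>B t\<bar>" using q(2)[OF that] by (intro mult_right_mono) auto
        finally show ?thesis .
      qed
    qed (intro int continuous_intros B qc[OF q(1)])+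
    finally show ?thesis by (simp add: K_def)
  qed
  note small = this
  have K: "K \<ge> 0" unfolding K_def by (intro integral_nonneg int continuous_intros B) auto
  have "integral {0..1} (\<lambda>t. B t * B t) \<le> 0"
  proof (rule field_le_epsilon)
    fix e :: real assume "e > 0"
    then have "integral {0..1} (\<lambda>t. B t * B t) \<le> e / (K + 1) * K" using K by (intro small) simp
    also have "\<dots> \<le> 0 + e" using K \<open>e > 0\<close> by (simp add: field_simps)
    finally show "integral {0..1} (\<lambda>t. B t * B t) \<le> 0 + e" .
  qed
  moreover have "0 \<le> integral {0..1} (\<lambda>t. B t * B t)" by (intro integral_nonneg int continuous_intros B) auto
  ultimately have "integral {0..1} (\<lambda>t. B t * B t) = 0" by simp
  then have "\<forall>x\<in>{0..1}. B x * B x = 0"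
    by (subst (asm) integral_eq_0_iff) (auto intro!: continuous_intros B)
  then show ?thesis using st by (simp add: B_def)
qed

text \<open>The test directions for the variation. Their traces against \<open>X\<close> read off
  \<open>v \<bullet> (X *v u)\<close> for all orthogonal pairs of vectors.\<close>

lemma rank_one_nilpotent:
  fixes u v :: "real^'n"
  assumes uv: "u \<bullet> v = 0"
  defines "N \<equiv> (\<chi> i j. u $ i * v $ j)"
  shows "N ** N = 0" and "det (mat 1 + s *\<^sub>R N) = 1" and "trace (X ** N) = v \<bullet> (X *v u)"
proof -
  have vu: "(\<Sum>k\<in>UNIV. v $ k * u $ k) = 0" using uv by (simp add: inner_vec_def mult.commute)
  have "(N ** N) $ i $ j = u $ i * (\<Sum>k\<in>UNIV. v $ k * u $ k) * v $ j" for i j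
    by (simp add: N_def matrix_matrix_mult_def sum_distrib_left sum_distrib_right mult_ac)
  then show "N ** N = 0" by (simp add: vec_eq_iff vu)
  \<comment> \<open>An arbitrary index: \<open>A\<close> holds a multiple of \<open>u\<close> as its
    only nonzero column and \<open>B\<close> holds \<open>v\<close> as its only nonzero row. Thus
    \<open>A ** B\<close> is \<open>s *\<^sub>R N\<close> while \<open>B ** A\<close> is zero, and
    \<open>det_one_plus_mult_commute\<close> gives the determinant.\<close>
  define k0 :: 'n where "k0 = undefined"
  define A :: "real^'n^'n" where "A = (\<chi> i j. if j = k0 then s * u $ i else 0)"
  define B :: "real^'n^'n" where "B = (\<chi> i j. if i = k0 then v $ j else 0)"
  have "A ** B = s *\<^sub>R N"
    by (simp add: A_def B_def N_def matrix_matrix_mult_def vec_eq_iff if_distrib if_distribR cong: if_cong)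
  moreover have "(B ** A) $ i $ j = 0" for i j
  proof (cases "i = k0 \<and> j = k0")
    case True
    then have "(B ** A) $ i $ j = s * (\<Sum>k\<in>UNIV. v $ k * u $ k)"
      by (simp add: A_def B_def matrix_matrix_mult_def sum_distrib_left mult_ac)
    then show ?thesis by (simp add: vu)
  qed (auto simp: A_def B_def matrix_matrix_mult_def)
  then have "B ** A = 0" by (simp add: vec_eq_iff)
  ultimately show "det (mat 1 + s *\<^sub>R N) = 1" using det_one_plus_mult_commute[of A B] by simp
  show "trace (X ** N) = v \<bullet> (X *v u)"
    by (simp add: trace_def N_def matrix_matrix_mult_def inner_vec_def matrix_vector_mult_def
        sum_distrib_left mult_ac)
qed

text \<open>Coordinate vectors kill the off-diagonal entries, and the orthogonal pair of a sum and a
  difference of two of them equates the diagonal ones. What remains is scalar and is killed by the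
  trace.\<close>

lemma scalar_matrix_of_orthogonal:
  fixes Z :: "real^'n^'n"
  assumes Z: "\<And>u v. u \<bullet> v = 0 \<Longrightarrow> v \<bullet> (Z *v u) = 0" and tr: "trace Z = 0"
  shows "Z = 0"
proof -
  have off: "Z $ i $ j = 0" if "i \<noteq> j" for i j
    unfolding matrix_entry_form by (rule Z) (use that in \<open>simp add: inner_axis_axis\<close>)
  have diag: "Z $ i $ i = Z $ j $ j" for i j
  proof (cases "i = j")
    case False
    have "(axis i 1 - axis j 1) \<bullet> (Z *v (axis i 1 + axis j 1)) = 0"
      by (rule Z) (simp add: inner_add_left inner_diff_right inner_axis_axis)
    then have "Z $ i $ i + Z $ i $ j - Z $ j $ i - Z $ j $ j = 0"
      by (simp add: matrix_entry_form matrix_vector_right_distrib inner_diff_left inner_add_right)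
    then show ?thesis using off[OF False] off[of j i] False by simp
  qed simp
  have "of_nat CARD('n) * Z $ i $ i = 0" for i
  proof -
    have "trace Z = (\<Sum>k\<in>(UNIV :: 'n set). Z $ i $ i)"
      unfolding trace_def by (rule sum.cong) (auto intro: diag)
    then show ?thesis using tr by simp
  qed
  then have "Z $ i $ j = 0" for i j using off[of i j] by (cases "i = j") auto
  then show ?thesis by (simp add: vec_eq_iff)
qed

text \<open>The inequality of arithmetic and geometric means for the relative eigenvalues, whose
  product is 1; it comes from \<open>ln x \<le> x - 1\<close>.\<close>

lemma trace_inv_mult_ge:
  fixes G K :: "'n::{finite,linorder} sqmat"
  assumes G: "pd G" and K: "pd K" and det: "det G = det K"
  shows "real CARD('n) \<le> trace (matrix_inv G ** K)"
proof -
  obtain W l where W: "eigenbasis G K W l" using eigenbasis_exists[OF G] K by (auto simp: pd_def)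
  note W = W eigenbasisD[OF W]
  have lp: "0 < l i" for i by (rule eigenbasis_pos[OF W(1) K])
  have "W ** (transpose W ** G) = mat 1"
    using W(2) matrix_left_right_inverse[of "transpose W ** G" W] by (simp add: matrix_mul_assoc)
  then have "matrix_inv G = W ** transpose W"
    using matrix_left_right_inverse[of G "W ** transpose W"]
    by (intro matrix_inv_unique) (simp add: matrix_mul_assoc)
  then have "trace (matrix_inv G ** K) = trace (transpose W ** K ** W)"
    using trace_mul_sym[of W "transpose W ** K"] by (simp add: matrix_mul_assoc)
  also have "\<dots> = (\<Sum>i\<in>UNIV. l i)" by (simp add: W(5) trace_def diag_def)
  finally have tr: "trace (matrix_inv G ** K) = (\<Sum>i\<in>UNIV. l i)" .
  have "prod l UNIV = 1"
    using det_diag_congruence[OF W(5)] det_diag_congruence[of W G "\<lambda>_. 1"] W(2) det by (simp add: diag_one)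
  moreover have "l i \<noteq> 0" for i using lp[of i] by simp
  ultimately have "0 = (\<Sum>i\<in>UNIV. ln (l i))" using ln_prod[of UNIV l] by simp
  also have "\<dots> \<le> (\<Sum>i\<in>UNIV. l i - 1)" by (intro sum_mono ln_le_minus_one lp)
  finally show ?thesis by (simp add: tr sum_subtractf)
qed

section \<open>The logarithmic velocity is constant along geodesics; geometric means\<close>

context metric_path
begin

text \<open>Localisation: if the traces differed at \<open>x0\<close>, their difference would keep
  its sign on a small ball. Against a bump supported there its integral is zero by the first
  variation, although the integrand is nonnegative and positive on an open set.\<close>

lemma trace_X_const:
  assumes geo: "geodesic_segment A w g" and c0: "c0 \<in> A" "x0 \<in> cdom c0"
    and N: "N ** N = 0" "\<And>s. det (mat 1 + s *\<^sub>R N) = 1" and st: "s \<in> {0..1}" "t \<in> {0..1}"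
  shows "trace (X t c0 x0 ** N) = trace (X s c0 x0 ** N)"
proof (rule ccontr)
  assume neq: "trace (X t c0 x0 ** N) \<noteq> trace (X s c0 x0 ** N)"
  define a where "a = coord c0 x0"
  have a: "a \<in> cimg c0" "cinv c0 a = x0"
    using atlas_coord_in[OF A c0] atlas_cinv_coord[OF A c0] by (auto simp: a_def)
  define D where "D y = trace (X t c0 (cinv c0 y) ** N) - trace (X s c0 (cinv c0 y) ** N)" for y
  have cX: "continuous_on (cimg c0) (\<lambda>y. X t c0 (cinv c0 y))" if "t \<in> {0..1}" for t
  proof -
    have "continuous_on (cimg c0) (\<lambda>y. case (t, y) of (t, y) \<Rightarrow> X t c0 (cinv c0 y))"
      by (rule continuous_on_compose2[OF continuous_X[OF c0(1)] continuous_on_Pair[OF continuous_on_const continuous_on_id]])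
         (use that in auto)
    then show ?thesis by simp
  qed
  \<comment> \<open>Multiplying by the constant \<open>D a\<close> normalises the sign of the
    difference to be positive near \<open>a\<close>.\<close>
  have "continuous_on (cimg c0) (\<lambda>y. D y * D a)"
    unfolding D_def by (intro continuous_intros cX st)
  then have "open (cimg c0 \<inter> (\<lambda>y. D y * D a) -` {0<..})"
    by (rule continuous_open_preimage[OF _ atlas_open_cimg[OF A c0(1)] open_greaterThan])
  moreover have "cimg c0 \<inter> (\<lambda>y. D y * D a) -` {0<..} = {y \<in> cimg c0. 0 < D y * D a}" by auto
  ultimately have o: "open {y \<in> cimg c0. 0 < D y * D a}" by simp
  have Da: "D a \<noteq> 0" using neq by (simp add: D_def a)
  then have "0 < D a * D a" using not_real_square_gt_zero by blast
  then have "a \<in> {y \<in> cimg c0. 0 < D y * D a}" using a by simp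
  then obtain r where rr: "r > 0" "cball a r \<subseteq> {y \<in> cimg c0. 0 < D y * D a}"
    using o[unfolded open_contains_cball, rule_format] by blast
  have rc: "cball a r \<subseteq> cimg c0" using rr(2) by blast
  interpret bump_variation A w g c0 a r N
    by unfold_locales (use c0 rr rc N in auto)
  have "(\<integral>x. e1 s x \<partial>\<nu>) = (\<integral>x. e1 t x \<partial>\<nu>)"
    by (rule du_bois_reymond[OF continuous_integral_e(2) first_variation[OF geo] st])
  define f where "f x = (e1 t x - e1 s x) * D a" for x
  have f_int: "integrable \<nu> f" unfolding f_def by (intro integrable_mult_left Bochner_Integration.integrable_diff integrable_e st)
  have f0: "(\<integral>x. f x \<partial>\<nu>) = 0"
    unfolding f_def using integrable_e(2) st \<open>(\<integral>x. e1 s x \<partial>\<nu>) = (\<integral>x. e1 t x \<partial>\<nu>)\<close> by simp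
  have f_in: "f x = ball_bump a r (coord c0 x) * (D (coord c0 x) * D a)" if x: "x \<in> cdom c0" for x
    using e_chart(2)[OF c0(1) st(1) x] e_chart(2)[OF c0(1) st(2) x] jac_self[OF A c0(1) x] atlas_cinv_coord[OF A c0(1) x] x
    by (simp add: f_def D_def bump_endo_def bump_at_def matrix_mul_scaleR trace_scaleR algebra_simps)
  have f_out: "f x = 0" if "x \<notin> cdom c0" for x
    using that by (simp add: f_def e1_def bump_endo_def trace_0[symmetric] mat_0)
  have bb: "0 < ball_bump a r y \<longleftrightarrow> y \<in> ball a r" for y by (rule ball_bump_pos_iff[OF r(1)])
  have f_pos: "0 < f x" if "x \<in> cdom c0" "coord c0 x \<in> ball a r" for x
  proof -
    have "coord c0 x \<in> cball a r" using that(2) by simp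
    from subsetD[OF rr(2) this] have h1: "0 < D (coord c0 x) * D a" by (simp only: mem_Collect_eq)
    have h2: "0 < ball_bump a r (coord c0 x)" using that(2) bb by (simp only:)
    show ?thesis unfolding f_in[OF that(1)] by (rule mult_pos_pos[OF h2 h1])
  qed
  have f_nn: "0 \<le> f x" for x
  proof (cases "x \<in> cdom c0 \<and> coord c0 x \<in> ball a r")
    case False
    then have "x \<notin> cdom c0 \<or> ball_bump a r (coord c0 x) = 0"
      using bb[of "coord c0 x"] ball_bump_nonneg[of a r "coord c0 x"] by auto
    then show ?thesis using f_in[of x] f_out[of x] by (cases "x \<in> cdom c0") auto
  qed (use f_pos[of x] in auto)
  have "AE x in \<nu>. f x = 0"
    using integral_nonneg_eq_0_iff_AE[OF f_int] f_nn f0 by simp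
  define U where "U = cinv c0 ` ball a r"
  have U: "open U" "U \<noteq> {}"
    unfolding U_def using rc r(1) by (auto intro!: atlas_cinv_image_open[OF A c0(1)])
  have Uf: "0 < f x" if "x \<in> U" for x
  proof -
    obtain y where y: "y \<in> ball a r" "x = cinv c0 y" using \<open>x \<in> U\<close> by (auto simp: U_def)
    then have yc: "y \<in> cimg c0" using rc by auto
    show ?thesis unfolding y(2)
      by (rule f_pos) (use y(1) atlas_cinv_in[OF A c0(1) yc] atlas_coord_cinv[OF A c0(1) yc] in auto)
  qed
  have Us: "U \<in> sets \<nu>" using U(1) by (simp add: sets_\<nu>)
  have "AE x in \<nu>. x \<notin> U"
    using \<open>AE x in \<nu>. f x = 0\<close> by (rule eventually_mono) (use Uf in fastforce)
  then have "U \<in> null_sets \<nu>" using AE_iff_null_sets[OF Us] by simp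
  then show False using volume_measure_open_pos[OF A w \<nu> U] by (simp add: null_sets_def)
qed

text \<open>The function \<open>s \<mapsto> tr (g\<^sub>t\<^sup>-\<^sup>1 g\<^sub>s)\<close> is minimal at \<open>s = t\<close> because all \<open>g\<^sub>s\<close> have the same
  determinant; this replaces differentiating the determinant.\<close>

lemma trace_X_zero:
  assumes c: "c \<in> A" "x \<in> cdom c" and t: "0 < t" "t < 1"
  shows "trace (X t c x) = 0"
proof -
  have t': "t \<in> {0..1}" using t by simp
  define h where "h s = trace (matrix_inv (g t c x) ** g s c x)" for s
  have "bounded_linear (\<lambda>B. trace (matrix_inv (g t c x) ** B))"
    by (intro linear_conv_bounded_linear[THEN iffD1] linearI)
       (simp_all add: matrix_add_ldistrib trace_add matrix_mul_scaleR trace_scaleR)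
  from bounded_linear.has_vector_derivative[OF this g_deriv[OF c t']]
  have "(h has_real_derivative trace (X t c x)) (at t)"
    unfolding h_def X_def has_real_derivative_iff_has_vector_derivative using t by (simp add: at_within_Icc_at)
  moreover have "h t \<le> h s" if s: "s \<in> {0..1}" for s
  proof -
    have "h t = real CARD('n)"
      using g_det_ne[OF t' c] by (simp add: h_def matrix_inv_mult trace_I)
    also have "\<dots> \<le> h s"
      unfolding h_def using metrics_vol_det(2)[OF w g_in c] t' s
      by (intro trace_inv_mult_ge g_pd c) auto
    finally show ?thesis .
  qed
  ultimately show ?thesis
    using t by (intro DERIV_local_min[of h _ t "min t (1 - t)"]) (auto simp: abs_less_iff)
qed

text \<open>The difference is trace-free and annihilated by all rank-one nilpotent test matrices.
  Times are interior because \<open>trace_X_zero\<close> uses a two-sided minimum; the end times are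
  reached later by continuity.\<close>

lemma X_const:
  assumes geo: "geodesic_segment A w g" and c: "c \<in> A" "x \<in> cdom c"
    and st: "0 < s" "s < 1" "0 < t" "t < 1"
  shows "X t c x = X s c x"
proof -
  have "X t c x - X s c x = 0"
  proof (rule scalar_matrix_of_orthogonal)
    show "trace (X t c x - X s c x) = 0" using trace_X_zero[OF c] st by (simp add: trace_sub)
    fix u v :: "'n rvec" assume uv: "u \<bullet> v = 0"
    show "v \<bullet> ((X t c x - X s c x) *v u) = 0"
      using trace_X_const[OF geo c rank_one_nilpotent(1,2)[OF uv], of s t] st
      by (simp add: rank_one_nilpotent(3)[OF uv] matrix_vector_mult_diff_rdistrib inner_diff_right)
  qed
  then show ?thesis by simp
qed

text \<open>For \<open>g\<^sub>t = g\<^sub>0 exp (t X)\<close> the expression \<open>g\<^sub>m\<^sub>+\<^sub>h g\<^sub>m\<^sup>-\<^sup>1 g\<^sub>m\<^sub>-\<^sub>h\<close> does not depend on \<open>h\<close>. Proving this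
  by differentiation avoids the matrix exponential.\<close>

lemma geodesic_mean:
  assumes geo: "geodesic_segment A w g" and c: "c \<in> A" "x \<in> cdom c"
    and m: "0 < m" "m < 1" and k: "0 < k" "0 \<le> m - k" "m + k \<le> 1"
  shows "g m c x ** matrix_inv (g (m - k) c x) ** g m c x = g (m + k) c x"
proof -
  let ?g = "\<lambda>t. g t c x"
  define Gi where "Gi = matrix_inv (?g m)"
  define X0 where "X0 = X m c x"
  have vel: "velocity g t c x = ?g t ** X0" "?g t ** X0 = transpose X0 ** ?g t" if "0 < t" "t < 1" for t
  proof -
    have t: "t \<in> {0..1}" using that by simp
    show 1: "velocity g t c x = ?g t ** X0"
      unfolding X0_def X_const[OF geo c that m] using g_X[OF t c] by simp
    show "?g t ** X0 = transpose X0 ** ?g t"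
      using velocity_sym[OF t c] g_pd[OF t c] unfolding 1 by (simp add: matrix_transpose_mul pd_def)
  qed
  have gi: "?g m ** Gi = mat 1" "Gi ** ?g m = mat 1"
    using matrix_inv_mult[OF g_det_ne[OF _ c, of m]] m by (auto simp: Gi_def)
  \<comment> \<open>Symmetry of \<open>?g m ** X0\<close>, rewritten for the inverse of
    \<open>?g m\<close>. It lets the two terms of the derivative of \<open>F\<close> cancel.\<close>
  have comm: "Gi ** transpose X0 = X0 ** Gi"
  proof -
    have "Gi ** (transpose X0 ** ?g m) ** Gi = Gi ** (?g m ** X0) ** Gi" using vel(2)[OF m] by simp
    then have "Gi ** transpose X0 ** (?g m ** Gi) = (Gi ** ?g m) ** X0 ** Gi" by (simp only: matrix_mul_assoc)
    then show ?thesis by (simp add: gi)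
  qed
  define F where "F h = ?g (m + h) ** Gi ** ?g (m - h)" for h
  have dF: "(F has_vector_derivative 0) (at h)" if h: "0 < h" "h < k" for h
  proof -
    have i: "0 < m + h" "m + h < 1" "0 < m - h" "m - h < 1" using h k m by auto
    have d: "(?g has_vector_derivative ?g t ** X0) (at t)" if "0 < t" "t < 1" for t
      using g_deriv[OF c, of t] vel(1)[OF that] that by (simp add: at_within_Icc_at)
    have "((\<lambda>h. m + h) has_vector_derivative 1) (at h)" by (auto intro!: derivative_eq_intros)
    from vector_diff_chain_at[OF this d[OF i(1,2)]]
    have d1: "((\<lambda>h. ?g (m + h)) has_vector_derivative ?g (m + h) ** X0) (at h)" by (simp add: o_def)
    have "((\<lambda>h. m - h) has_vector_derivative - 1) (at h)" by (auto intro!: derivative_eq_intros)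
    from vector_diff_chain_at[OF this d[OF i(3,4)]]
    have d2: "((\<lambda>h. ?g (m - h)) has_vector_derivative - (?g (m - h) ** X0)) (at h)" by (simp add: o_def)
    note bil = bounded_bilinear.has_vector_derivative[OF bounded_bilinear_matrix_mult]
    have "(F has_vector_derivative (?g (m + h) ** Gi ** (- (?g (m - h) ** X0)) +
        (?g (m + h) ** 0 + ?g (m + h) ** X0 ** Gi) ** ?g (m - h))) (at h)"
      unfolding F_def by (intro bil d1 d2 has_vector_derivative_const)
    moreover have "?g (m + h) ** Gi ** (- (?g (m - h) ** X0)) + (?g (m + h) ** 0 + ?g (m + h) ** X0 ** Gi) ** ?g (m - h) = 0"
    proof -
      have "?g (m + h) ** Gi ** (?g (m - h) ** X0) = ?g (m + h) ** (Gi ** transpose X0) ** ?g (m - h)"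
        unfolding vel(2)[OF i(3,4)] by (simp only: matrix_mul_assoc)
      then have "?g (m + h) ** Gi ** (?g (m - h) ** X0) = ?g (m + h) ** X0 ** Gi ** ?g (m - h)"
        unfolding comm by (simp only: matrix_mul_assoc)
      moreover have "B ** (- C) = - (B ** C)" for B C :: "'n sqmat"
        using matrix_mul_scaleR(2)[of B "- 1" C] by simp
      ultimately show ?thesis by simp
    qed
    ultimately show ?thesis by simp
  qed
  have cg: "continuous_on {0..1} ?g"
    using g_deriv[OF c] by (intro continuous_on_vector_derivative) auto
  \<comment> \<open>The derivative is used only strictly between 0 and \<open>k\<close>, where both
    times are interior; continuity of \<open>F\<close> covers the case that \<open>m - k\<close> or
    \<open>m + k\<close> is an end time.\<close>
  have "F k = F 0"
  proof -
    have "F k $ i $ j = F 0 $ i $ j" for i j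
    proof (rule DERIV_isconst_end[OF k(1)])
      have c1: "continuous_on {0..k} (\<lambda>h. ?g (m + h))" "continuous_on {0..k} (\<lambda>h. ?g (m - h))"
        using k m by (auto intro!: continuous_on_compose2[OF cg] continuous_intros)
      show "continuous_on {0..k} (\<lambda>h. F h $ i $ j)"
        unfolding F_def by (intro continuous_intros c1)
      show "((\<lambda>h. F h $ i $ j) has_real_derivative 0) (at h)" if "0 < h" "h < k" for h
        using bounded_linear.has_vector_derivative[OF bounded_linear_compose[OF bounded_linear_vec_nth bounded_linear_vec_nth] dF[OF that], of i j]
        unfolding has_real_derivative_iff_has_vector_derivative by simp
    qed
    then show ?thesis by (simp add: vec_eq_iff)
  qed
  then have 1: "?g (m + k) ** Gi ** ?g (m - k) = ?g m" by (simp add: F_def gi)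
  have inv: "?g (m - k) ** matrix_inv (?g (m - k)) = mat 1"
    by (rule matrix_inv_mult[OF g_det_ne[OF _ c]]) (use k m in auto)
  have "?g m ** matrix_inv (?g (m - k)) = ?g (m + k) ** Gi ** (?g (m - k) ** matrix_inv (?g (m - k)))"
    unfolding matrix_mul_assoc 1 ..
  then have "?g m ** matrix_inv (?g (m - k)) ** ?g m = ?g (m + k) ** (Gi ** ?g m)"
    by (simp add: inv matrix_mul_assoc)
  then show ?thesis by (simp add: gi)
qed

end

section \<open>Logarithmic singular values\<close>

text \<open>Comparison with constant 1 in both directions equates the products over initial
  segments. A single eigenvalue is the quotient of the products over \<open>{..k}\<close> and
  \<open>{..<k}\<close>.\<close>

lemma eigenvalues_unique:
  fixes G :: "'n::{finite,linorder} sqmat"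
  assumes pd: "pd G" "pd K" and W: "eigenbasis G K W l" "eigenbasis G K W' l'"
  shows "l = l'"
proof
  fix k :: 'n
  have eq: "prod l I = prod l' I" if "down_closed I" for I
    using eigenvalues_compare[OF pd pd, of 1 W l W' l' I] eigenvalues_compare[OF pd pd, of 1 W' l' W l I] W that
    by simp
  have "down_closed {..k}" "down_closed {..<k}" by (auto simp: down_closed_def)
  then have "prod l {..k} = prod l' {..k}" "prod l {..<k} = prod l' {..<k}" using eq by auto
  moreover have "{..k} = insert k {..<k}" by auto
  ultimately have "l k * prod l {..<k} = l' k * prod l {..<k}" by simp
  moreover have "0 < prod l {..<k}" using eigenbasis_pos[OF W(1) pd(2)] by (intro prod_pos) auto
  ultimately show "l k = l' k" by (metis less_irrefl mult_right_cancel)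
qed

text \<open>The vector of logarithms of the singular values of the identity from \<open>G\<close> to \<open>K\<close>.\<close>

definition log_sv :: "'n::{finite,linorder} sqmat \<Rightarrow> 'n sqmat \<Rightarrow> 'n rvec" where
  "log_sv G K = (\<chi> i. ln ((THE l. \<exists>W. eigenbasis G K W l) i) / 2)"

lemma log_sv_eq:
  assumes pd: "pd G" "pd K" and W: "eigenbasis G K W l"
  shows "log_sv G K = (\<chi> i. ln (l i) / 2)"
proof -
  have "(THE l. \<exists>W. eigenbasis G K W l) = l"
    using W eigenvalues_unique[OF pd] by (intro the_equality) auto
  then show ?thesis by (simp add: log_sv_def)
qed

lemma sum_log_sv:
  assumes pd: "pd G" "pd K" and W: "eigenbasis G K W l"
  shows "(\<Sum>i\<in>I. log_sv G K $ i) = ln (prod l I) / 2"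
proof -
  have "0 < l i" for i by (rule eigenbasis_pos[OF W pd(2)])
  then have "l i \<noteq> 0" for i by (metis less_irrefl)
  then show ?thesis using ln_prod[of I l] by (simp add: log_sv_eq[OF assms] sum_divide_distrib)
qed

lemma pd_eigenbasis:
  assumes "pd G" "pd K"
  obtains W l where "eigenbasis G K W l"
  using eigenbasis_exists[OF assms(1), of K] assms(2) by (auto simp: pd_def)

lemma log_sv_a_plus:
  assumes pd: "pd G" "pd K"
  shows "log_sv G K \<in> a_plus"
proof -
  obtain W l where W: "eigenbasis G K W l" using pd_eigenbasis[OF pd] .
  have "l j \<le> l i" if "i \<le> j" for i j using eigenbasisD(3)[OF W] that by (rule antimonoD)
  moreover have "0 < l i" for i by (rule eigenbasis_pos[OF W pd(2)])
  ultimately show ?thesis by (simp add: log_sv_eq[OF pd W] a_plus_def)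
qed

lemma sum_log_sv_UNIV:
  fixes G :: "'n::{finite,linorder} sqmat"
  assumes pd: "pd G" "pd K"
  shows "(\<Sum>i\<in>UNIV. log_sv G K $ i) = (ln (det K) - ln (det G)) / 2"
proof -
  obtain W l where W: "eigenbasis G K W l" using pd_eigenbasis[OF pd] .
  have W2: "(det W)\<^sup>2 * det K = prod l UNIV" "(det W)\<^sup>2 * det G = 1"
    using det_diag_congruence[OF eigenbasisD(4)[OF W]] det_diag_congruence[of W G "\<lambda>_. 1"] eigenbasisD(1)[OF W]
    by (simp_all add: diag_one)
  then have "(det W)\<^sup>2 = 1 / det G" using pd_det_pos[OF pd(1)] by (simp add: field_simps)
  with W2(1) have "prod l UNIV = det K / det G" by simp
  then show ?thesis
    using pd_det_pos[OF pd(1)] pd_det_pos[OF pd(2)] by (simp add: sum_log_sv[OF pd W] ln_div)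
qed

text \<open>An eigenbasis is carried along by the inverse of \<open>J\<close> with the same
  eigenvalues. This is the independence of the chart at the source.\<close>

lemma log_sv_congruence:
  fixes G :: "'n::{finite,linorder} sqmat"
  assumes pd: "pd G" "pd K" and J: "det J \<noteq> 0"
  shows "log_sv (transpose J ** G ** J) (transpose J ** K ** J) = log_sv G K"
proof -
  obtain W l where W: "eigenbasis G K W l" using pd_eigenbasis[OF pd] .
  define V where "V = matrix_inv J ** W"
  have JV: "J ** V = W" by (simp add: V_def matrix_mul_assoc matrix_inv_mult[OF J])
  have "eigenbasis (transpose J ** G ** J) (transpose J ** K ** J) V l"
    unfolding eigenbasis_def
  proof (intro conjI eigenbasisD(3)[OF W])
    have "transpose V ** (transpose J ** G ** J) ** V = transpose (J ** V) ** G ** (J ** V)"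
      by (simp add: matrix_transpose_mul matrix_mul_assoc)
    then show "transpose V ** (transpose J ** G ** J) ** V = mat 1"
      unfolding JV using eigenbasisD(1)[OF W] by simp
    have "transpose J ** K ** J ** V = transpose J ** (K ** (J ** V))" by (simp add: matrix_mul_assoc)
    also have "\<dots> = transpose J ** G ** (J ** V) ** diag l"
      unfolding JV eigenbasisD(2)[OF W] by (simp add: matrix_mul_assoc)
    finally show "transpose J ** K ** J ** V = transpose J ** G ** J ** V ** diag l"
      by (simp add: matrix_mul_assoc)
  qed
  then show ?thesis
    using log_sv_eq[OF pd W] log_sv_eq[OF pd_congruence[OF pd(1) J] pd_congruence[OF pd(2) J]] by simp
qed

text \<open>Multiplying the eigenvalue equation by \<open>G\<close> turns the operator of
  \<open>L\<close> and its adjoint into the pair of forms \<open>G\<close> and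
  \<open>transpose L ** H ** L\<close>, both on the source; the vectors \<open>u i\<close> become
  the columns of \<open>W\<close>.\<close>

lemma is_singular_values_iff:
  fixes G :: "'n::{finite,linorder} sqmat"
  assumes G: "pd G"
  shows "is_singular_values G H L \<alpha> \<longleftrightarrow> (\<forall>i. 0 \<le> \<alpha> $ i) \<and>
    (\<exists>W. eigenbasis G (transpose L ** H ** L) W (\<lambda>i. (\<alpha> $ i)\<^sup>2))" (is "?l \<longleftrightarrow> ?r")
proof -
  let ?K = "transpose L ** H ** L"
  have inv: "G ** matrix_inv G = mat 1" "matrix_inv G ** G = mat 1"
    using matrix_inv_mult[OF pd_det_ne_0[OF G]] by auto
  have eig: "(matrix_inv G ** transpose L ** H ** L) *v v = k *\<^sub>R v \<longleftrightarrow> ?K *v v = k *\<^sub>R (G *v v)" for v k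
  proof -
    have 1: "matrix_inv G ** transpose L ** H ** L = matrix_inv G ** ?K" by (simp add: matrix_mul_assoc)
    show ?thesis
    proof
      assume "(matrix_inv G ** transpose L ** H ** L) *v v = k *\<^sub>R v"
      then have "G *v (matrix_inv G *v (?K *v v)) = G *v (k *\<^sub>R v)"
        unfolding 1 by (simp add: matrix_vector_mul_assoc)
      then show "?K *v v = k *\<^sub>R (G *v v)"
        by (simp add: matrix_vector_mul_assoc[of G] inv matrix_vector_mult_scaleR)
    next
      assume "?K *v v = k *\<^sub>R (G *v v)"
      then have "matrix_inv G *v (?K *v v) = k *\<^sub>R v"
        by (simp add: matrix_vector_mult_scaleR matrix_vector_mul_assoc inv)
      then show "(matrix_inv G ** transpose L ** H ** L) *v v = k *\<^sub>R v"
        unfolding 1 by (simp add: matrix_vector_mul_assoc)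
    qed
  qed
  have dax: "diag l *v axis j 1 = l j *\<^sub>R axis j 1" for l j
    by (auto simp: vec_eq_iff diag_vector_mult axis_def)
  have matrix_eq_axis: "B = C \<longleftrightarrow> (\<forall>j. B *v axis j 1 = C *v axis j 1)" for B C :: "'n sqmat"
    by (auto simp: matrix_vector_mult_basis column_def vec_eq_iff)
  have one: "(mat 1 :: 'n sqmat) $ i $ j = (if i = j then 1 else 0)" for i j by (simp add: mat_def)
  have basis: "(\<forall>i j. (W *v axis i 1) \<bullet> (G *v (W *v axis j 1)) = (if i = j then 1 else 0))
      \<longleftrightarrow> transpose W ** G ** W = mat 1" for W :: "'n sqmat"
    unfolding vec_eq_iff[of "transpose W ** G ** W"] vec_eq_iff[of "(transpose W ** G ** W) $ _"] one
      matrix_entry_form[of "transpose W ** G ** W"] congruence_form ..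
  have eigm: "(\<forall>i. ?K *v (W *v axis i 1) = (\<alpha> $ i)\<^sup>2 *\<^sub>R (G *v (W *v axis i 1)))
      \<longleftrightarrow> ?K ** W = G ** W ** diag (\<lambda>i. (\<alpha> $ i)\<^sup>2)" for W :: "'n sqmat"
    unfolding matrix_eq_axis[of "?K ** W"]
    by (simp add: matrix_vector_mul_assoc[symmetric] dax matrix_vector_mult_scaleR)
  have mono: "(\<forall>i j. i \<le> j \<longrightarrow> \<alpha> $ j \<le> \<alpha> $ i) \<longleftrightarrow> antimono (\<lambda>i. (\<alpha> $ i)\<^sup>2)" if "\<forall>i. 0 \<le> \<alpha> $ i"
    using that by (auto simp: monotone_on_def abs_le_square_iff[symmetric])
  have surj: "(\<exists>u. Q u) \<longleftrightarrow> (\<exists>W :: 'n sqmat. Q (\<lambda>j. W *v axis j 1))" for Q :: "('n \<Rightarrow> 'n rvec) \<Rightarrow> bool"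
  proof
    assume "\<exists>u. Q u"
    then obtain u where "Q u" by blast
    moreover have "(\<lambda>j. (\<chi> p q. u q $ p) *v axis j 1) = u"
      by (simp add: fun_eq_iff matrix_vector_mult_basis column_def vec_eq_iff)
    ultimately show "\<exists>W :: 'n sqmat. Q (\<lambda>j. W *v axis j 1)" by metis
  qed blast
  show ?thesis
    unfolding is_singular_values_def eig surj basis eigm eigenbasis_def using mono by auto
qed

lemma singular_values_log:
  fixes G :: "'n::{finite,linorder} sqmat"
  assumes pd: "pd G" "pd H" and L: "det L \<noteq> 0"
  shows "(\<chi> i. ln (singular_values G H L $ i)) = log_sv G (transpose L ** H ** L)"
proof -
  let ?K = "transpose L ** H ** L"
  have K: "pd ?K" by (rule pd_congruence[OF pd(2) L])
  obtain W l where W: "eigenbasis G ?K W l" using pd_eigenbasis[OF pd(1) K] .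
  have lp: "0 < l i" for i by (rule eigenbasis_pos[OF W K])
  define \<alpha> where "\<alpha> = (\<chi> i. sqrt (l i))"
  have a2: "(\<lambda>i. (\<alpha> $ i)\<^sup>2) = l" using lp by (simp add: \<alpha>_def less_imp_le)
  have sv: "is_singular_values G H L \<alpha>"
    unfolding is_singular_values_iff[OF pd(1)] a2 using W lp by (auto simp: \<alpha>_def less_imp_le)
  have "\<beta> = \<alpha>" if b: "is_singular_values G H L \<beta>" for \<beta>
  proof -
    obtain V where V: "eigenbasis G ?K V (\<lambda>i. (\<beta> $ i)\<^sup>2)" and nn: "\<forall>i. 0 \<le> \<beta> $ i"
      using b unfolding is_singular_values_iff[OF pd(1)] by blast
    have "(\<lambda>i. (\<beta> $ i)\<^sup>2) = l" by (rule eigenvalues_unique[OF pd(1) K V W])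
    then have "\<beta> $ i = \<alpha> $ i" for i using nn by (auto simp: \<alpha>_def fun_eq_iff intro!: real_sqrt_unique[symmetric])
    then show ?thesis by (simp add: vec_eq_iff)
  qed
  then have "singular_values G H L = \<alpha>"
    unfolding singular_values_def using sv by (rule the_equality[rotated])
  moreover have "(\<lambda>i. ln (sqrt (l i))) = (\<lambda>i. ln (l i) / 2)"
    by (intro ext ln_sqrt less_imp_le lp)
  ultimately show ?thesis unfolding log_sv_eq[OF pd(1) K W] \<alpha>_def by (simp only: vec_lambda_beta)
qed

text \<open>Closeness of forms measured by a factor. Unlike closeness of matrix entries it is
  invariant under congruence, so it passes unchanged between charts and to pullbacks.\<close>

definition comparable :: "real \<Rightarrow> real^'n^'n \<Rightarrow> real^'n^'n \<Rightarrow> bool" where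
  "comparable c G G' \<longleftrightarrow> (\<forall>x. x \<bullet> (G *v x) \<le> c * (x \<bullet> (G' *v x)) \<and> x \<bullet> (G' *v x) \<le> c * (x \<bullet> (G *v x)))"

lemma comparable_congruence:
  fixes G J :: "real^'n^'n"
  shows "comparable c G G' \<Longrightarrow> comparable c (transpose J ** G ** J) (transpose J ** G' ** J)"
  unfolding comparable_def congruence_form by blast

text \<open>Each partial sum over an initial segment moves by at most
  \<open>real CARD('n) * ln c\<close>; a coordinate is a difference of two such sums, hence the
  factor 2.\<close>

lemma log_sv_close:
  fixes G :: "'n::{finite,linorder} sqmat"
  assumes pd: "pd G" "pd K" "pd G'" "pd K'" and c: "1 \<le> c"
    and cmp: "comparable c G G'" "comparable c K K'"
  shows "\<bar>log_sv G' K' $ k - log_sv G K $ k\<bar> \<le> 2 * real CARD('n) * ln c"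
proof -
  obtain W l where W: "eigenbasis G K W l" using pd_eigenbasis[OF pd(1,2)] .
  obtain W' l' where W': "eigenbasis G' K' W' l'" using pd_eigenbasis[OF pd(3,4)] .
  have c0: "0 < c" using c by simp
  have close: "\<bar>(\<Sum>i\<in>I. log_sv G' K' $ i) - (\<Sum>i\<in>I. log_sv G K $ i)\<bar> \<le> real CARD('n) * ln c"
    if I: "down_closed I" for I
  proof -
    have pos: "0 < prod l I" "0 < prod l' I"
      using eigenbasis_pos[OF W pd(2)] eigenbasis_pos[OF W' pd(4)] by (auto intro!: prod_pos)
    have "prod l' I \<le> c ^ (2 * card I) * prod l I" "prod l I \<le> c ^ (2 * card I) * prod l' I"
      using cmp unfolding comparable_def
      by (auto intro!: eigenvalues_compare[OF pd c0 _ _ W W' I] eigenvalues_compare[OF pd(3,4,1,2) c0 _ _ W' W I])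
    then have "ln (prod l' I) \<le> ln (c ^ (2 * card I) * prod l I)" "ln (prod l I) \<le> ln (c ^ (2 * card I) * prod l' I)"
      using pos c0 by (simp_all only: ln_le_cancel_iff zero_less_power mult_pos_pos)
    moreover have "ln (c ^ (2 * card I) * p) = 2 * (real (card I) * ln c) + ln p" if "0 < p" for p
      using that c0 by (simp add: ln_mult ln_realpow)
    ultimately have "\<bar>ln (prod l' I) - ln (prod l I)\<bar> \<le> 2 * (real (card I) * ln c)"
      using pos unfolding abs_le_iff by (metis add.commute diff_le_eq minus_diff_eq)
    moreover have "real (card I) * ln c \<le> real CARD('n) * ln c"
      using c by (intro mult_right_mono) (auto intro: card_mono)
    ultimately show ?thesis
      by (simp add: sum_log_sv[OF pd(1,2) W] sum_log_sv[OF pd(3,4) W'])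
  qed
  have "down_closed {..k}" "down_closed {..<k}" by (auto simp: down_closed_def)
  from close[OF this(1)] close[OF this(2)]
  show ?thesis
    using sum.insert[of "{..<k}" k "($) (log_sv G K)"] sum.insert[of "{..<k}" k "($) (log_sv G' K')"]
    by (simp add: ivl_disj_un_singleton(2)[symmetric])
qed

lemma bounded_bilinear_matrix_vector_mult:
  "bounded_bilinear ((*v) :: real^'n^'n \<Rightarrow> real^'n \<Rightarrow> real^'n)"
  by (rule bilinear_conv_bounded_bilinear[THEN iffD1], unfold bilinear_def, intro conjI allI linearI)
     (auto simp: matrix_vector_right_distrib matrix_vector_mult_add_rdistrib matrix_vector_mult_scaleR scaleR_matrix_vector_assoc)

lemma matrix_form_bound:
  obtains B where "0 < B" "\<And>A (x :: real^'n). \<bar>x \<bullet> (A *v x)\<bar> \<le> B * norm A * (x \<bullet> x)"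
proof -
  from bounded_bilinear.pos_bounded[OF bounded_bilinear_matrix_vector_mult]
  obtain B where B: "0 < B" "\<And>A (x :: real^'n). norm (A *v x :: real^'n) \<le> norm A * norm x * B" by blast
  have "\<bar>x \<bullet> (A *v x)\<bar> \<le> B * norm A * (x \<bullet> x)" for A and x :: "real^'n"
  proof -
    have "\<bar>x \<bullet> (A *v x)\<bar> \<le> norm x * norm (A *v x)" by (rule Cauchy_Schwarz_ineq2)
    also have "\<dots> \<le> norm x * (norm A * norm x * B)" by (intro mult_left_mono B) simp
    finally show ?thesis by (simp add: dot_square_norm power2_eq_square mult_ac)
  qed
  then show thesis using that B(1) by blast
qed

text \<open>The assumed distance gives a relative error of at most \<open>1 - 1 / c\<close>. The
  lower estimate is then immediate, and the upper one uses \<open>2 - 1 / c \<le> c\<close>, which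
  is the nonnegativity of the square of \<open>c - 1\<close>.\<close>

lemma comparable_of_norm:
  fixes c m B :: real and G G' :: "real^'n^'n"
  assumes c: "1 < c" and m: "0 < m" "\<And>x. m * (x \<bullet> x) \<le> x \<bullet> (G *v x)"
    and B: "\<And>x :: real^'n. \<bar>x \<bullet> ((G' - G) *v x)\<bar> \<le> B * norm (G' - G) * (x \<bullet> x)"
    and close: "B * norm (G' - G) \<le> m * (1 - 1 / c)"
  shows "comparable c G G'"
  unfolding comparable_def
proof
  fix x :: "real^'n"
  let ?q = "x \<bullet> (G *v x)" and ?q' = "x \<bullet> (G' *v x)"
  have "\<bar>?q' - ?q\<bar> \<le> B * norm (G' - G) * (x \<bullet> x)"
    using B[of x] by (simp add: matrix_vector_mult_diff_rdistrib inner_diff_right)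
  also have "\<dots> \<le> m * (1 - 1 / c) * (x \<bullet> x)" by (intro mult_right_mono close) simp
  also have "\<dots> = (1 - 1 / c) * (m * (x \<bullet> x))" by simp
  also have "\<dots> \<le> (1 - 1 / c) * ?q" using c by (intro mult_left_mono m) simp
  finally have d: "\<bar>?q' - ?q\<bar> \<le> (1 - 1 / c) * ?q" .
  have q: "0 \<le> ?q" using m(1) m(2)[of x] by (meson inner_ge_zero less_imp_le mult_nonneg_nonneg order_trans)
  have "?q / c \<le> ?q'" using d by (simp add: algebra_simps abs_le_iff)
  then have 1: "?q \<le> c * ?q'" using c by (simp add: divide_simps mult.commute)
  have "(2 - 1 / c) * ?q \<le> c * ?q"
  proof (rule mult_right_mono[OF _ q])
    have "0 \<le> (c - 1)\<^sup>2" by simp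
    then show "2 - 1 / c \<le> c" using c by (simp add: field_simps power2_eq_square)
  qed
  then have 2: "?q' \<le> c * ?q" using d by (simp add: algebra_simps abs_le_iff)
  show "?q \<le> c * ?q' \<and> ?q' \<le> c * ?q" using 1 2 ..
qed

lemma eventually_comparable:
  fixes G :: "'a \<Rightarrow> real^'n^'n"
  assumes "(G \<longlongrightarrow> G0) F" "pd G0" "1 < c"
  shows "\<forall>\<^sub>F x in F. comparable c G0 (G x)"
proof -
  obtain m where m: "0 < m" "\<And>x. m * (x \<bullet> x) \<le> x \<bullet> (G0 *v x)" using pd_bounds[OF assms(2)] by blast
  obtain B where B: "0 < B" "\<And>A (x :: real^'n). \<bar>x \<bullet> (A *v x)\<bar> \<le> B * norm A * (x \<bullet> x)"
    using matrix_form_bound by blast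
  have "0 < m * (1 - 1 / c) / B" using m(1) B(1) assms(3) by simp
  from tendstoD[OF assms(1) this]
  show ?thesis
  proof eventually_elim
    case (elim x)
    show ?case
      by (rule comparable_of_norm[OF assms(3) m B(2)])
         (use elim B(1) in \<open>simp add: dist_norm field_simps less_imp_le\<close>)
  qed
qed

lemma continuous_on_log_sv:
  fixes G :: "'a::topological_space \<Rightarrow> 'n::{finite,linorder} sqmat"
  assumes G: "continuous_on S G" "\<And>x. x \<in> S \<Longrightarrow> pd (G x)" and K: "continuous_on S K" "\<And>x. x \<in> S \<Longrightarrow> pd (K x)"
  shows "continuous_on S (\<lambda>x. log_sv (G x) (K x))"
  unfolding continuous_on_def
proof (intro ballI vec_tendstoI tendstoI)
  fix x k and e :: real assume x: "x \<in> S" and e: "0 < e"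
  \<comment> \<open>Chosen so that the bound of \<open>log_sv_close\<close> equals
    \<open>e / 2\<close>.\<close>
  define c where "c = exp (e / (4 * real CARD('n)))"
  have c: "1 < c" using e by (simp add: c_def)
  have lc: "2 * real CARD('n) * ln c < e" using e by (simp add: c_def)
  have "\<forall>\<^sub>F y in at x within S. y \<in> S" by (simp add: eventually_at_filter)
  moreover have "\<forall>\<^sub>F y in at x within S. comparable c (G x) (G y)"
    using G x c by (intro eventually_comparable) (auto simp: continuous_on_def)
  moreover have "\<forall>\<^sub>F y in at x within S. comparable c (K x) (K y)"
    using K x c by (intro eventually_comparable) (auto simp: continuous_on_def)
  ultimately show "\<forall>\<^sub>F y in at x within S. dist (log_sv (G y) (K y) $ k) (log_sv (G x) (K x) $ k) < e"
  proof eventually_elim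
    case (elim y)
    have "\<bar>log_sv (G y) (K y) $ k - log_sv (G x) (K x) $ k\<bar> \<le> 2 * real CARD('n) * ln c"
      using elim c x by (intro log_sv_close G(2) K(2)) auto
    then show ?case using lc by (simp add: dist_real_def)
  qed
qed

lemma log_sv_geometric_mean:
  fixes Gs :: "'n::{finite,linorder} sqmat"
  assumes pd: "pd Gs" "pd Gm" "pd Gt" "pd Ks" "pd Km" "pd Kt"
    and mean: "Gm ** matrix_inv Gs ** Gm = Gt" "Km ** matrix_inv Ks ** Km = Kt" and I: "down_closed I"
  shows "2 * (\<Sum>i\<in>I. log_sv Gm Km $ i) \<le> (\<Sum>i\<in>I. log_sv Gs Ks $ i) + (\<Sum>i\<in>I. log_sv Gt Kt $ i)"
proof -
  obtain Ws ls where Ws: "eigenbasis Gs Ks Ws ls" using pd_eigenbasis[OF pd(1,4)] .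
  obtain Wm lm where Wm: "eigenbasis Gm Km Wm lm" using pd_eigenbasis[OF pd(2,5)] .
  obtain Wt lt where Wt: "eigenbasis Gt Kt Wt lt" using pd_eigenbasis[OF pd(3,6)] .
  have pos: "0 < prod ls I" "0 < prod lm I" "0 < prod lt I"
    using eigenbasis_pos[OF Ws pd(4)] eigenbasis_pos[OF Wm pd(5)] eigenbasis_pos[OF Wt pd(6)]
    by (auto intro!: prod_pos)
  have "(prod lm I)\<^sup>2 \<le> prod ls I * prod lt I"
    by (rule eigenvalues_geometric_mean[OF pd mean Ws Wm Wt I])
  moreover have "0 < (prod lm I)\<^sup>2" "0 < prod ls I * prod lt I" using pos by (simp_all only: zero_less_power mult_pos_pos)
  ultimately have "ln ((prod lm I)\<^sup>2) \<le> ln (prod ls I * prod lt I)" by (simp only: ln_le_cancel_iff)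
  moreover have "ln (x\<^sup>2) = 2 * ln x" "ln (y * z) = ln y + ln z" if "0 < x" "0 < y" "0 < z" for x y z :: real
    using that by (simp_all add: ln_mult ln_realpow)
  ultimately have "2 * ln (prod lm I) \<le> ln (prod ls I) + ln (prod lt I)" using pos by metis
  then show ?thesis by (simp add: sum_log_sv[OF pd(1,4) Ws] sum_log_sv[OF pd(2,5) Wm] sum_log_sv[OF pd(3,6) Wt])
qed

text \<open>If the function minus its chord were positive somewhere, it would have a least maximiser
  \<open>m\<close>, which is interior. To its left the value is strictly smaller and to its right it
  is no larger, against midpoint convexity.\<close>

lemma midpoint_convex_continuous:
  fixes \<phi> :: "real \<Rightarrow> real"
  assumes cont: "continuous_on {0..1} \<phi>"
    and mid: "\<And>m k. 0 < m \<Longrightarrow> m < 1 \<Longrightarrow> 0 < k \<Longrightarrow> 0 \<le> m - k \<Longrightarrow> m + k \<le> 1 \<Longrightarrow>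
      2 * \<phi> m \<le> \<phi> (m - k) + \<phi> (m + k)"
    and t: "t \<in> {0..1}"
  shows "\<phi> t \<le> (1 - t) * \<phi> 0 + t * \<phi> 1"
proof (rule ccontr)
  define \<psi> where "\<psi> s = \<phi> s - ((1 - s) * \<phi> 0 + s * \<phi> 1)" for s
  assume "\<not> ?thesis"
  then have pt: "0 < \<psi> t" by (simp add: \<psi>_def)
  have c: "continuous_on {0..1} \<psi>" unfolding \<psi>_def by (intro continuous_intros cont)
  obtain u where u: "u \<in> {0..1}" "\<And>s. s \<in> {0..1} \<Longrightarrow> \<psi> s \<le> \<psi> u"
    using continuous_attains_sup[OF compact_Icc _ c] by auto
  define S where "S = {s \<in> {0..1}. \<psi> s = \<psi> u}"
  have "closed S" unfolding S_def
    by (rule continuous_closed_preimage_constant[OF c]) simp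
  then have "compact ({0..1} \<inter> S)" by (rule compact_Int_closed[OF compact_Icc])
  moreover have "{0..1} \<inter> S = S" by (auto simp: S_def)
  ultimately have "compact S" by simp
  moreover have "S \<noteq> {}" using u(1) by (auto simp: S_def)
  ultimately obtain m where m: "m \<in> S" "\<And>s. s \<in> S \<Longrightarrow> m \<le> s"
    using compact_attains_inf[of S] by blast
  have mm: "m \<in> {0..1}" "\<psi> m = \<psi> u" using m(1) by (auto simp: S_def)
  have "0 < \<psi> m" using pt u(2)[OF t] mm(2) by simp
  then have "m \<noteq> 0" "m \<noteq> 1" by (auto simp: \<psi>_def)
  then have m01: "0 < m" "m < 1" using mm by auto
  define k where "k = min m (1 - m)"
  have k: "0 < k" "0 \<le> m - k" "m + k \<le> 1" using m01 by (auto simp: k_def)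
  have "2 * \<psi> m \<le> \<psi> (m - k) + \<psi> (m + k)"
    using mid[OF m01 k] by (simp add: \<psi>_def algebra_simps)
  moreover have "\<psi> (m + k) \<le> \<psi> m" using u(2)[of "m + k"] k m01 mm by simp
  moreover have "\<psi> (m - k) < \<psi> m"
  proof -
    have "m - k \<notin> S" using m(2)[of "m - k"] k(1) by auto
    then have "\<psi> (m - k) \<noteq> \<psi> u" using k m01 by (auto simp: S_def)
    moreover have "\<psi> (m - k) \<le> \<psi> u" using k m01 by (intro u(2)) auto
    ultimately show ?thesis using mm by simp
  qed
  ultimately show False by simp
qed

section \<open>Singular values of a diffeomorphism\<close>

lemma C1_map_has_derivative:
  assumes A: "smooth_atlas A" "c \<in> A" "d \<in> A" and F: "C1_map A F" and x: "x \<in> cdom c" "F x \<in> cdom d"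
  shows "((coord d \<circ> F \<circ> cinv c) has_derivative (\<lambda>v. local_deriv c d F x *v v)) (at (coord c x))"
  by (rule local_deriv_has_derivative[of 1 "coord c ` (cdom c \<inter> F -` cdom d)"])
     (use A F x in \<open>auto simp: C1_map_def\<close>)

lemma local_deriv_change_charts:
  assumes A: "smooth_atlas A" "c \<in> A" "d \<in> A" "c' \<in> A" "d' \<in> A" and F: "C1_map A F"
    and x: "x \<in> cdom c" "F x \<in> cdom d" "x \<in> cdom c'" "F x \<in> cdom d'"
  shows "local_deriv c' d' F x = jac d d' (F x) ** (local_deriv c d F x ** jac c' c x)"
proof -
  have cF: "continuous_on UNIV F" using F by (simp add: C1_map_def)
  have j1: "((coord c \<circ> (\<lambda>x. x) \<circ> cinv c') has_derivative (*v) (jac c' c x)) (at (coord c' x))"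
    using jac_has_derivative[OF A(1,4,2) x(3,1)] by (simp add: o_def)
  have j2: "((coord d' \<circ> (\<lambda>x. x) \<circ> cinv d) has_derivative (*v) (jac d d' (F x))) (at (coord d (F x)))"
    using jac_has_derivative[OF A(1,3,5) x(2,4)] by (simp add: o_def)
  have 1: "local_deriv c' d F x = local_deriv c d F x ** jac c' c x"
    using local_deriv_compose(1)[OF A(1,4,2,3) x(3), of "\<lambda>x. x" F] x j1
      C1_map_has_derivative[OF A(1,2,3) F x(1,2)] by (simp add: o_def)
  have 2: "local_deriv c' d' F x = jac d d' (F x) ** local_deriv c' d F x"
    using local_deriv_compose(1)[OF A(1,4,3,5) x(3), of F "\<lambda>x. x"] x j2 cF
      C1_map_has_derivative[OF A(1,4,3) F x(3,2)] by (simp add: o_def)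
  show ?thesis unfolding 2 1 ..
qed

text \<open>The chain rule for the composition of \<open>f\<close> with its inverse, which is also
  of class C^1.\<close>

lemma local_deriv_det_ne_0:
  assumes A: "smooth_atlas A" "c \<in> A" "d \<in> A" and f: "C1_diffeo A f" and x: "x \<in> cdom c" "f x \<in> cdom d"
  shows "det (local_deriv c d f x) \<noteq> 0"
proof -
  have b: "bij f" and C: "C1_map A f" "C1_map A (inv f)" using f by (auto simp: C1_diffeo_def)
  have inv: "inv f (f x) = x" for x using b by (simp add: bij_is_inj)
  have cf: "continuous_on UNIV f" using C by (simp add: C1_map_def)
  have "local_deriv c c (inv f \<circ> f) x = local_deriv d c (inv f) (f x) ** local_deriv c d f x"
    by (rule local_deriv_compose(1)[OF A A(2) x _ cf C1_map_has_derivative[OF A C(1) x]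
        C1_map_has_derivative[OF A(1,3,2) C(2) x(2)]]) (simp_all add: inv x)
  moreover have "inv f \<circ> f = (\<lambda>x. x)" by (simp add: fun_eq_iff inv)
  ultimately have "local_deriv d c (inv f) (f x) ** local_deriv c d f x = mat 1"
    using jac_self[OF A(1,2) x(1)] by simp
  from arg_cong[OF this, of det] show ?thesis by (auto simp: det_mul)
qed

lemma metric_continuous:
  assumes A: "smooth_atlas A" "c \<in> A" and g: "g \<in> sym_tensors A"
  shows "continuous_on (cimg c) (\<lambda>y. g c (cinv c y))" "continuous_on (cdom c) (g c)"
proof -
  show 1: "continuous_on (cimg c) (\<lambda>y. g c (cinv c y))"
    using sym_tensorsD(4)[OF g A(2)] smooth_on_open[OF atlas_open_cimg[OF A]] Ck_on_continuous by blast
  have "continuous_on (cdom c) (\<lambda>x. g c (cinv c (coord c x)))"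
    by (rule continuous_on_compose2[OF 1 atlas_continuous_coord[OF A]]) (use atlas_coord_in[OF A] in auto)
  then show "continuous_on (cdom c) (g c)"
    by (rule continuous_on_cong[OF refl, THEN iffD1, rotated]) (simp add: atlas_cinv_coord[OF A])
qed

definition pullback :: "('m, 'n::finite) tensor2 \<Rightarrow> ('m \<Rightarrow> 'm) \<Rightarrow> ('m, 'n) chart \<Rightarrow> ('m, 'n) chart \<Rightarrow> 'm \<Rightarrow> real^'n^'n" where
  "pullback g f c d x = transpose (local_deriv c d f x) ** g d (f x) ** local_deriv c d f x"

locale diffeo =
  fixes A :: "('m::t2_space, 'n::{finite,linorder}) chart set"
    and w :: "('m, 'n) chart \<Rightarrow> 'm \<Rightarrow> real" and f :: "'m \<Rightarrow> 'm"
  assumes co: "compact (UNIV :: 'm set)" and A: "smooth_atlas A" and w: "volume_form A w"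
    and f: "C1_diffeo A f"
begin

lemma f_C1: "C1_map A f" and f_cont: "continuous_on UNIV f"
  using f by (auto simp: C1_diffeo_def C1_map_def)

lemma pd_pullback:
  assumes "g \<in> metrics_vol A w" "c \<in> A" "d \<in> A" "x \<in> cdom c" "f x \<in> cdom d"
  shows "pd (pullback g f c d x)"
  unfolding pullback_def
  by (rule pd_congruence[OF metrics_vol_pd[OF assms(1,3,5)] local_deriv_det_ne_0[OF A assms(2,3) f assms(4,5)]])

text \<open>Removes the arbitrary choice of \<open>chart_at\<close>: a change of chart at
  \<open>f x\<close> leaves the pullback fixed, and one at \<open>x\<close> is a common congruence
  of the metric and the pullback.\<close>

lemma sigma_vec_chart:
  assumes g: "g \<in> metrics_vol A w" and c: "c \<in> A" "d \<in> A" "x \<in> cdom c" "f x \<in> cdom d"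
  shows "sigma_vec A g f x = log_sv (g c x) (pullback g f c d x)"
proof -
  define c' where "c' = chart_at A x"
  define d' where "d' = chart_at A (f x)"
  have c': "c' \<in> A" "d' \<in> A" "x \<in> cdom c'" "f x \<in> cdom d'"
    unfolding c'_def d'_def using chart_at[OF A] by auto
  let ?J = "jac c' c x" and ?J' = "jac d d' (f x)" and ?L = "local_deriv c d f x"
  have J: "det ?J \<noteq> 0" by (rule jac_det_ne_0[OF A c'(1) c(1) c'(3) c(3)])
  have gt: "g c' x = transpose ?J ** g c x ** ?J" "g d (f x) = transpose ?J' ** g d' (f x) ** ?J'"
    by (rule sym_tensorsD(3)[OF metrics_vol_sym[OF g]]; fact)+
  have L: "local_deriv c' d' f x = ?J' ** (?L ** ?J)"
    by (rule local_deriv_change_charts[OF A c(1,2) c'(1,2) f_C1 c(3,4) c'(3,4)])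
  have K: "pullback g f c' d' x = transpose ?J ** pullback g f c d x ** ?J"
    unfolding pullback_def L gt(2) by (simp add: matrix_transpose_mul matrix_mul_assoc)
  have "sigma_vec A g f x = log_sv (g c' x) (pullback g f c' d' x)"
    unfolding sigma_vec_def Let_def c'_def[symmetric] d'_def[symmetric] pullback_def
    by (rule singular_values_log[OF metrics_vol_pd[OF g c'(1,3)] metrics_vol_pd[OF g c'(2,4)]
        local_deriv_det_ne_0[OF A c'(1,2) f c'(3,4)]])
  also have "\<dots> = log_sv (g c x) (pullback g f c d x)"
    unfolding K gt(1) by (rule log_sv_congruence[OF metrics_vol_pd[OF g c(1,3)] pd_pullback[OF g c] J])
  finally show ?thesis .
qed

lemma charts_at:
  obtains c d where "c \<in> A" "d \<in> A" "x \<in> cdom c" "f x \<in> cdom d"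
  using atlas_cover[OF A] by metis

lemma sigma_vec_a_plus:
  assumes g: "g \<in> metrics_vol A w"
  shows "sigma_vec A g f x \<in> a_plus"
proof -
  obtain c d where c: "c \<in> A" "d \<in> A" "x \<in> cdom c" "f x \<in> cdom d" by (rule charts_at)
  show ?thesis unfolding sigma_vec_chart[OF g c]
    by (rule log_sv_a_plus[OF metrics_vol_pd[OF g c(1,3)] pd_pullback[OF g c]])
qed

text \<open>On the open set where a given pair of charts serves for \<open>x\<close> and
  \<open>f x\<close>, the matrices of the metric at both points and of the derivative are
  continuous. On the compact manifold this yields boundedness and so integrability.\<close>

lemma continuous_sigma_vec:
  assumes g: "g \<in> metrics_vol A w"
  shows "continuous_on UNIV (sigma_vec A g f)"
proof -
  let ?V = "\<lambda>p. cdom (fst p) \<inter> f -` cdom (snd p)"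
  have V: "open (?V p)" if "p \<in> A \<times> A" for p
    using that open_vimage[OF atlas_open_cdom[OF A] f_cont] atlas_open_cdom[OF A]
    by (intro open_Int) auto
  have "continuous_on (?V p) (sigma_vec A g f)" if p: "p \<in> A \<times> A" for p
  proof -
    obtain c d where cd: "p = (c, d)" "c \<in> A" "d \<in> A" using p by auto
    let ?U = "cdom c \<inter> f -` cdom d"
    have U: "open (coord c ` ?U)" using V[OF p] cd by (intro atlas_coord_image_open[OF A]) auto
    have "Ck_on (Suc 0) (coord c ` ?U) (coord d \<circ> f \<circ> cinv c)"
      using f_C1 cd by (simp add: C1_map_def)
    from matrix_frechet_Ck[OF U this]
    have "continuous_on (coord c ` ?U) (\<lambda>y. matrix (frechet_derivative (coord d \<circ> f \<circ> cinv c) (at y)))"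
      by (simp add: Ck_on_0)
    then have L: "continuous_on ?U (local_deriv c d f)"
      unfolding local_deriv_def
      by (rule continuous_on_compose2[OF _ continuous_on_subset[OF atlas_continuous_coord[OF A cd(2)]]]) auto
    have g1: "continuous_on ?U (g c)"
      by (rule continuous_on_subset[OF metric_continuous(2)[OF A cd(2) metrics_vol_sym[OF g]]]) auto
    have g2: "continuous_on ?U (\<lambda>x. g d (f x))"
      by (rule continuous_on_compose2[OF metric_continuous(2)[OF A cd(3) metrics_vol_sym[OF g]]
          continuous_on_subset[OF f_cont]]) auto
    have "continuous_on ?U (\<lambda>x. log_sv (g c x) (pullback g f c d x))"
    proof (rule continuous_on_log_sv[OF g1])
      show "continuous_on ?U (pullback g f c d)"
        unfolding pullback_def
        by (intro continuous_on_matrix_mult bounded_linear.continuous_on[OF bounded_linear_transpose] L g2)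
    qed (use metrics_vol_pd[OF g cd(2)] pd_pullback[OF g cd(2,3)] in auto)
    then show ?thesis
      unfolding cd(1) fst_conv snd_conv
      by (rule continuous_on_cong[OF refl, THEN iffD1, rotated]) (simp add: sigma_vec_chart[OF g cd(2,3)])
  qed
  then have "continuous_on (\<Union>p\<in>A \<times> A. ?V p) (sigma_vec A g f)"
    using V by (intro continuous_on_open_UN) auto
  moreover have "(\<Union>p\<in>A \<times> A. ?V p) = UNIV"
  proof -
    have "x \<in> (\<Union>p\<in>A \<times> A. ?V p)" for x
    proof -
      obtain c d where "c \<in> A" "d \<in> A" "x \<in> cdom c" "f x \<in> cdom d" by (rule charts_at)
      then show ?thesis by (intro UN_I[of "(c, d)"]) auto
    qed
    then show ?thesis by blast
  qed
  ultimately show ?thesis by simp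
qed

section \<open>The integrated singular value vector\<close>

lemma integrable_sigma_vec:
  assumes \<mu>: "prob_space \<mu>" "sets \<mu> = sets borel" and g: "g \<in> metrics_vol A w"
  shows "integrable \<mu> (sigma_vec A g f)"
proof -
  interpret prob_space \<mu> by fact
  have "bounded (range (sigma_vec A g f))"
    by (rule compact_imp_bounded[OF compact_continuous_image[OF continuous_sigma_vec[OF g] co]])
  then obtain B where B: "\<And>x. norm (sigma_vec A g f x) \<le> B" unfolding bounded_iff by auto
  have "sigma_vec A g f \<in> borel_measurable \<mu>"
    using borel_measurable_continuous_onI[OF continuous_sigma_vec[OF g]] unfolding measurable_cong_sets[OF \<mu>(2) refl] .
  then show ?thesis using B by (intro integrable_const_bound[where B=B]) auto
qed

lemma S_vec_nth:
  assumes \<mu>: "prob_space \<mu>" "sets \<mu> = sets borel" and g: "g \<in> metrics_vol A w"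
  shows "integrable \<mu> (\<lambda>x. sigma_vec A g f x $ i)" "S_vec A f \<mu> g $ i = (\<integral>x. sigma_vec A g f x $ i \<partial>\<mu>)"
  using integrable_bounded_linear[OF bounded_linear_vec_nth integrable_sigma_vec[OF assms], of i]
    integral_bounded_linear[OF bounded_linear_vec_nth integrable_sigma_vec[OF assms], of i]
  by (simp_all add: S_vec_def)

lemma S_vec_a_plus:
  assumes \<mu>: "prob_space \<mu>" "sets \<mu> = sets borel" and g: "g \<in> metrics_vol A w"
  shows "S_vec A f \<mu> g \<in> a_plus"
  using sigma_vec_a_plus[OF g] unfolding a_plus_def mem_Collect_eq S_vec_nth(2)[OF assms]
  by (auto intro!: integral_mono S_vec_nth(1)[OF assms])

text \<open>Uniform closeness of matrices over a closed coordinate ball in one chart gives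
  comparability at its points, and congruence invariance extends this to every chart
  \<open>d\<close> around such a point.\<close>

lemma chart_comparable_nhd:
  assumes g0: "g0 \<in> metrics_vol A w" and c: "1 < c"
  shows "\<exists>U V. openin (Cinf_topology A) U \<and> g0 \<in> U \<and> open V \<and> x \<in> V \<and>
    (\<forall>g\<in>U. g \<in> sym_tensors A \<and> (\<forall>z\<in>V. \<forall>d\<in>A. z \<in> cdom d \<longrightarrow> comparable c (g0 d z) (g d z)))"
proof -
  obtain e where e: "e \<in> A" "x \<in> cdom e" using atlas_cover[OF A] by blast
  then obtain r where r: "r > 0" "cball (coord e x) r \<subseteq> cimg e"
    using atlas_open_cimg[OF A e(1)] atlas_coord_in[OF A e] open_contains_cball by blast
  let ?K = "cball (coord e x) r" and ?S = "sphere (0 :: 'n rvec) 1"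
  let ?q = "\<lambda>p. snd p \<bullet> (g0 e (cinv e (fst p)) *v snd p)"
  have gs: "g0 \<in> sym_tensors A" by (rule metrics_vol_sym[OF g0])
  have pdK: "pd (g0 e (cinv e y))" if "y \<in> ?K" for y
    using metrics_vol_pd[OF g0 e(1) atlas_cinv_in[OF A e(1)]] r(2) that by blast
  have "continuous_on (?K \<times> ?S) (\<lambda>p. g0 e (cinv e (fst p)))"
    by (rule continuous_on_compose2[OF metric_continuous(1)[OF A e(1) gs] continuous_on_fst[OF continuous_on_id]])
       (use r(2) in auto)
  then have "continuous_on (?K \<times> ?S) ?q"
    by (intro continuous_on_inner continuous_on_snd continuous_on_id
        bounded_bilinear.continuous_on[OF bounded_bilinear_matrix_vector_mult])
  moreover have "compact (?K \<times> ?S)" by (intro compact_Times) auto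
  moreover have "?K \<times> ?S \<noteq> {}"
  proof -
    have "coord e x \<in> ?K" using r(1) by simp
    moreover have "(axis undefined 1 :: 'n rvec) \<in> ?S" by simp
    ultimately show ?thesis by blast
  qed
  ultimately obtain p where p: "p \<in> ?K \<times> ?S" "\<And>q. q \<in> ?K \<times> ?S \<Longrightarrow> ?q p \<le> ?q q"
    using continuous_attains_inf[of "?K \<times> ?S" ?q] by blast
  \<comment> \<open>The minimum of \<open>g0\<close> over unit vectors at all points of the closed
    ball, hence a positive lower bound uniform in the point.\<close>
  define m where "m = ?q p"
  have m0: "0 < m"
  proof -
    have "snd p \<noteq> 0" "fst p \<in> ?K" using p(1) by (auto simp: mem_Times_iff)
    then show ?thesis using pdK[of "fst p"] unfolding m_def pd_def by blast
  qed
  have m: "m * (v \<bullet> v) \<le> v \<bullet> (g0 e (cinv e y) *v v)" if y: "y \<in> ?K" for y v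
  proof (cases "v = 0")
    case False
    have "m \<le> (v /\<^sub>R norm v) \<bullet> (g0 e (cinv e y) *v (v /\<^sub>R norm v))"
      unfolding m_def using p(2)[of "(y, v /\<^sub>R norm v)"] y False by simp
    also have "\<dots> = (v \<bullet> (g0 e (cinv e y) *v v)) / (v \<bullet> v)"
      by (simp add: matrix_vector_mult_scaleR dot_square_norm power2_eq_square divide_simps)
    finally show ?thesis using False by (simp add: field_simps)
  qed simp
  obtain B where B: "0 < B" "\<And>M (v :: 'n rvec). \<bar>v \<bullet> (M *v v)\<bar> \<le> B * norm M * (v \<bullet> v)"
    using matrix_form_bound by blast
  define \<eta> where "\<eta> = m * (1 - 1 / c) / B"
  have \<eta>: "0 < \<eta>" using m0 B(1) c by (simp add: \<eta>_def)
  \<comment> \<open>The empty list of derivatives is taken: a subbasic set that controls values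
    only. The radius \<open>\<eta>\<close> is what \<open>comparable_of_norm\<close>
    requires.\<close>
  define U where "U = {h \<in> sym_tensors A. \<forall>y\<in>?K.
         norm (iter_deriv [] (\<lambda>y. h e (cinv e y) - g0 e (cinv e y)) y) < \<eta>}"
  define V where "V = cinv e ` ball (coord e x) r"
  have "openin (Cinf_topology A) U"
    unfolding Cinf_topology_def
  proof (rule topology_generated_by_Basis, unfold mem_Collect_eq, intro exI conjI)
    show "U = {h \<in> sym_tensors A. \<forall>y\<in>?K.
         norm (iter_deriv [] (\<lambda>y. h e (cinv e y) - g0 e (cinv e y)) y) < \<eta>}" by (rule U_def)
  qed (use gs e(1) r(2) \<eta> in auto)
  moreover have "g0 \<in> U" using gs \<eta> by (simp add: U_def)
  moreover have "open V"
    unfolding V_def using r(2) ball_subset_cball by (intro atlas_cinv_image_open[OF A e(1)]) auto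
  moreover have "x \<in> V"
    unfolding V_def using r(1) atlas_cinv_coord[OF A e] by (intro image_eqI[of _ _ "coord e x"]) auto
  moreover have "comparable c (g0 d z) (g d z)" if g: "g \<in> U" and z: "z \<in> V" "d \<in> A" "z \<in> cdom d" for g z d
  proof -
    obtain y where y: "y \<in> ball (coord e x) r" "z = cinv e y" using z(1) by (auto simp: V_def)
    have yK: "y \<in> ?K" using y(1) by simp
    have ze: "z \<in> cdom e" unfolding y(2) using atlas_cinv_in[OF A e(1)] yK r(2) by blast
    have gsym: "g \<in> sym_tensors A" and n: "norm (g e z - g0 e z) < \<eta>" using g yK by (auto simp: U_def y(2))
    have "comparable c (g0 e z) (g e z)"
    proof (rule comparable_of_norm[OF c m0 _ B(2)])
      show "m * (v \<bullet> v) \<le> v \<bullet> (g0 e z *v v)" for v unfolding y(2) by (rule m[OF yK])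
      show "B * norm (g e z - g0 e z) \<le> m * (1 - 1 / c)"
        using n B(1) by (simp add: \<eta>_def field_simps less_imp_le)
    qed
    then show ?thesis
      unfolding sym_tensorsD(3)[OF gs z(2) e(1) z(3) ze] sym_tensorsD(3)[OF gsym z(2) e(1) z(3) ze]
      by (rule comparable_congruence)
  qed
  moreover have "g \<in> sym_tensors A" if "g \<in> U" for g using that by (simp add: U_def)
  ultimately show ?thesis by blast
qed

text \<open>Finitely many of the open sets \<open>V x\<close> cover the manifold, and intersecting
  the corresponding neighbourhoods of \<open>g0\<close> makes the comparison hold at all points at
  once.\<close>

lemma comparable_nhd:
  assumes g0: "g0 \<in> metrics_vol A w" and c: "1 < c"
  obtains U where "openin (Cinf_topology A) U" "g0 \<in> U"
    "\<forall>g\<in>U. \<forall>z. \<forall>d\<in>A. z \<in> cdom d \<longrightarrow> comparable c (g0 d z) (g d z)"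
proof -
  obtain U V where UV: "\<And>x. openin (Cinf_topology A) (U x)" "\<And>x. g0 \<in> U x" "\<And>x. open (V x)" "\<And>x. x \<in> V x"
    "\<And>x. \<forall>g\<in>U x. g \<in> sym_tensors A \<and> (\<forall>z\<in>V x. \<forall>d\<in>A. z \<in> cdom d \<longrightarrow> comparable c (g0 d z) (g d z))"
    using chart_comparable_nhd[OF assms] by metis
  have "UNIV \<subseteq> (\<Union>x\<in>UNIV. V x)" using UV(4) by blast
  then obtain X where X: "X \<subseteq> UNIV" "finite X" "UNIV \<subseteq> (\<Union>x\<in>X. V x)"
    by (rule compactE_image[OF co UV(3)])
  then have ne: "X \<noteq> {}" by auto
  show thesis
  proof (rule that[of "\<Inter>x\<in>X. U x"])
    show "openin (Cinf_topology A) (\<Inter>x\<in>X. U x)"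
      using X(2) ne UV(1) by (intro openin_INT2) auto
    show "g0 \<in> (\<Inter>x\<in>X. U x)" using UV(2) by blast
    show "\<forall>g\<in>\<Inter>x\<in>X. U x. \<forall>z. \<forall>d\<in>A. z \<in> cdom d \<longrightarrow> comparable c (g0 d z) (g d z)"
    proof (intro ballI allI impI)
      fix g z d assume g: "g \<in> (\<Inter>x\<in>X. U x)" and d: "d \<in> A" "z \<in> cdom d"
      obtain x where "x \<in> X" "z \<in> V x" using X(3) by blast
      then show "comparable c (g0 d z) (g d z)" using UV(5)[of x] g d by blast
    qed
  qed
qed

text \<open>One factor \<open>real CARD('n)\<close> comes from \<open>log_sv_close\<close>, the
  other from bounding the Euclidean norm by the sum of the coordinates.\<close>

lemma S_vec_close:
  assumes \<mu>: "prob_space \<mu>" "sets \<mu> = sets borel" and g: "g0 \<in> metrics_vol A w" "g \<in> metrics_vol A w"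
    and c: "1 < c" and cmp: "\<forall>z. \<forall>d\<in>A. z \<in> cdom d \<longrightarrow> comparable c (g0 d z) (g d z)"
  shows "norm (S_vec A f \<mu> g - S_vec A f \<mu> g0) \<le> 2 * (real CARD('n))\<^sup>2 * ln c"
proof -
  interpret prob_space \<mu> by fact
  let ?B = "2 * real CARD('n) * ln c"
  have pt: "\<bar>sigma_vec A g f x $ k - sigma_vec A g0 f x $ k\<bar> \<le> ?B" for x k
  proof -
    obtain c1 d where cd: "c1 \<in> A" "d \<in> A" "x \<in> cdom c1" "f x \<in> cdom d" by (rule charts_at)
    have "comparable c (pullback g0 f c1 d x) (pullback g f c1 d x)"
      unfolding pullback_def using cmp cd by (intro comparable_congruence) blast
    then show ?thesis
      unfolding sigma_vec_chart[OF g(1) cd] sigma_vec_chart[OF g(2) cd]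
      using cmp cd c by (intro log_sv_close metrics_vol_pd[OF g(1)] metrics_vol_pd[OF g(2)] pd_pullback g) auto
  qed
  have "\<bar>(S_vec A f \<mu> g - S_vec A f \<mu> g0) $ k\<bar> \<le> ?B" for k
  proof -
    note i = S_vec_nth[OF \<mu> g(1), of k] S_vec_nth[OF \<mu> g(2), of k]
    have "\<bar>(S_vec A f \<mu> g - S_vec A f \<mu> g0) $ k\<bar> = \<bar>\<integral>x. sigma_vec A g f x $ k - sigma_vec A g0 f x $ k \<partial>\<mu>\<bar>"
      using i by simp
    also have "\<dots> \<le> (\<integral>x. \<bar>sigma_vec A g f x $ k - sigma_vec A g0 f x $ k\<bar> \<partial>\<mu>)" by (rule integral_abs_bound)
    also have "\<dots> \<le> (\<integral>x. ?B \<partial>\<mu>)"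
      using i pt by (intro integral_mono) auto
    also have "\<dots> = ?B" by (simp add: prob_space)
    finally show ?thesis .
  qed
  then have "(\<Sum>k\<in>UNIV. \<bar>(S_vec A f \<mu> g - S_vec A f \<mu> g0) $ k\<bar>) \<le> real CARD('n) * ?B"
    by (rule sum_bounded_above)
  then show ?thesis
    using norm_le_l1_cart[of "S_vec A f \<mu> g - S_vec A f \<mu> g0"] by (simp add: power2_eq_square mult_ac)
qed

lemma continuous_map_S_vec:
  assumes \<mu>: "prob_space \<mu>" "sets \<mu> = sets borel"
  shows "continuous_map (subtopology (Cinf_topology A) (metrics_vol A w)) (top_of_set a_plus) (S_vec A f \<mu>)"
  unfolding continuous_map_in_subtopology
proof
  let ?T = "subtopology (Cinf_topology A) (metrics_vol A w)"
  show "S_vec A f \<mu> \<in> topspace ?T \<rightarrow> a_plus"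
    using S_vec_a_plus[OF \<mu>] by auto
  show "continuous_map ?T euclidean (S_vec A f \<mu>)"
    unfolding continuous_map_def
  proof (intro conjI allI impI)
    fix O' :: "'n rvec set" assume "openin euclidean O'"
    then have O': "open O'" by simp
    show "openin ?T {g \<in> topspace ?T. S_vec A f \<mu> g \<in> O'}"
    proof (subst openin_subopen, intro ballI)
      fix g0 assume g0: "g0 \<in> {g \<in> topspace ?T. S_vec A f \<mu> g \<in> O'}"
      then have g0m: "g0 \<in> metrics_vol A w" by simp
      obtain e where e: "e > 0" "ball (S_vec A f \<mu> g0) e \<subseteq> O'"
        using O' g0 open_contains_ball by blast
      \<comment> \<open>Chosen so that the bound of \<open>S_vec_close\<close> equals
        \<open>e / 2\<close>.\<close>
      define c where "c = exp (e / (4 * (real CARD('n))\<^sup>2))"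
      have c: "1 < c" using e(1) by (simp add: c_def)
      have lc: "2 * (real CARD('n))\<^sup>2 * ln c < e" using e(1) by (simp add: c_def)
      obtain U where U: "openin (Cinf_topology A) U" "g0 \<in> U"
        "\<forall>g\<in>U. \<forall>z. \<forall>d\<in>A. z \<in> cdom d \<longrightarrow> comparable c (g0 d z) (g d z)"
        by (rule comparable_nhd[OF g0m c])
      have "S_vec A f \<mu> g \<in> O'" if "g \<in> U" "g \<in> metrics_vol A w" for g
      proof -
        have "norm (S_vec A f \<mu> g - S_vec A f \<mu> g0) < e"
          using S_vec_close[OF \<mu> g0m that(2) c] U(3) that(1) lc by fastforce
        then show ?thesis using e(2) by (auto simp: dist_norm norm_minus_commute)
      qed
      then have "U \<inter> metrics_vol A w \<subseteq> {g \<in> topspace ?T. S_vec A f \<mu> g \<in> O'}"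
        using openin_subset[OF U(1)] by auto
      then show "\<exists>T. openin ?T T \<and> g0 \<in> T \<and> T \<subseteq> {g \<in> topspace ?T. S_vec A f \<mu> g \<in> O'}"
        using U(1,2) g0m by (intro exI[of _ "U \<inter> metrics_vol A w"]) (auto simp: openin_subtopology)
    qed
  qed simp
qed

lemma sigma_vec_convex:
  assumes geo: "geodesic_segment A w g" and I: "down_closed I" and t: "t \<in> {0..1}"
  shows "(\<Sum>i\<in>I. sigma_vec A (g t) f x $ i)
    \<le> (1 - t) * (\<Sum>i\<in>I. sigma_vec A (g 0) f x $ i) + t * (\<Sum>i\<in>I. sigma_vec A (g 1) f x $ i)"
proof -
  interpret metric_path A w g
    using geo by unfold_locales (auto simp: co A w geodesic_segment_def)
  obtain c d where cd: "c \<in> A" "d \<in> A" "x \<in> cdom c" "f x \<in> cdom d" by (rule charts_at)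
  let ?L = "local_deriv c d f x"
  let ?K = "\<lambda>t. pullback (g t) f c d x"
  have det: "det ?L \<noteq> 0" by (rule local_deriv_det_ne_0[OF A cd(1,2) f cd(3,4)])
  have sig: "sigma_vec A (g t) f x = log_sv (g t c x) (?K t)" if "t \<in> {0..1}" for t
    by (rule sigma_vec_chart[OF g_in[OF that] cd])
  have pdK: "pd (?K t)" if "t \<in> {0..1}" for t by (rule pd_pullback[OF g_in[OF that] cd])
  have cg: "continuous_on {0..1} (\<lambda>t. g t e y)" if "e \<in> A" "y \<in> cdom e" for e y
    using g_deriv[OF that] by (intro continuous_on_vector_derivative) auto
  have cK: "continuous_on {0..1} ?K"
    unfolding pullback_def by (intro continuous_on_matrix_mult continuous_on_const cg cd)
  have "(\<Sum>i\<in>I. log_sv (g t c x) (?K t) $ i)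
    \<le> (1 - t) * (\<Sum>i\<in>I. log_sv (g 0 c x) (?K 0) $ i) + t * (\<Sum>i\<in>I. log_sv (g 1 c x) (?K 1) $ i)"
  proof (rule midpoint_convex_continuous[OF _ _ t])
    show "continuous_on {0..1} (\<lambda>t. \<Sum>i\<in>I. log_sv (g t c x) (?K t) $ i)"
      by (intro continuous_intros continuous_on_log_sv cg cK g_pd pdK cd) 
    fix m k :: real assume m: "0 < m" "m < 1" and k: "0 < k" "0 \<le> m - k" "m + k \<le> 1"
    have in01: "m \<in> {0..1}" "m - k \<in> {0..1}" "m + k \<in> {0..1}" using m k by auto
    have LL: "?L ** matrix_inv ?L = mat 1" "matrix_inv ?L ** ?L = mat 1" using matrix_inv_mult[OF det] by auto
    have tLL: "transpose (matrix_inv ?L) ** transpose ?L = mat 1"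
      using arg_cong[OF LL(1), of transpose] by (simp add: matrix_transpose_mul)
    let ?h = "\<lambda>t. g t d (f x)"
    have inv: "matrix_inv (?K (m - k)) = matrix_inv ?L ** matrix_inv (?h (m - k)) ** transpose (matrix_inv ?L)"
      unfolding pullback_def by (rule matrix_inv_congruence[OF g_det_ne[OF in01(2) cd(2,4)] LL(1)])
    \<comment> \<open>Congruence by the derivative respects the geometric mean: the inner factors
      \<open>?L\<close> and their inverses cancel, leaving the relation for the metrics at
      \<open>f x\<close>.\<close>
    have "?K m ** matrix_inv (?K (m - k)) ** ?K m
      = transpose ?L ** (?h m ** (?L ** matrix_inv ?L) ** matrix_inv (?h (m - k)) **
          (transpose (matrix_inv ?L) ** transpose ?L) ** ?h m) ** ?L"
      unfolding inv by (simp only: pullback_def matrix_mul_assoc)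
    also have "\<dots> = ?K (m + k)"
      using geodesic_mean[OF geo cd(2,4) m k] by (simp add: LL tLL pullback_def)
    finally have "?K m ** matrix_inv (?K (m - k)) ** ?K m = ?K (m + k)" .
    then show "2 * (\<Sum>i\<in>I. log_sv (g m c x) (?K m) $ i)
      \<le> (\<Sum>i\<in>I. log_sv (g (m - k) c x) (?K (m - k)) $ i) + (\<Sum>i\<in>I. log_sv (g (m + k) c x) (?K (m + k)) $ i)"
      using geodesic_mean[OF geo cd(1,3) m k]
      by (intro log_sv_geometric_mean g_pd pdK in01 cd I)
  qed
  then show ?thesis using sig[OF t] sig[of 0] sig[of 1] by simp
qed

lemma sum_sigma_vec_UNIV:
  assumes g: "g \<in> metrics_vol A w" "h \<in> metrics_vol A w"
  shows "(\<Sum>i\<in>UNIV. sigma_vec A g f x $ i) = (\<Sum>i\<in>UNIV. sigma_vec A h f x $ i)"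
proof -
  obtain c d where cd: "c \<in> A" "d \<in> A" "x \<in> cdom c" "f x \<in> cdom d" by (rule charts_at)
  have val: "(\<Sum>i\<in>UNIV. sigma_vec A h f x $ i)
      = (ln ((det (local_deriv c d f x))\<^sup>2 * (w d (f x))\<^sup>2) - ln ((w c x)\<^sup>2)) / 2"
    if h: "h \<in> metrics_vol A w" for h
    using sum_log_sv_UNIV[OF metrics_vol_pd[OF h cd(1,3)] pd_pullback[OF h cd]]
    unfolding sigma_vec_chart[OF h cd]
    by (simp add: pullback_def det_mul metrics_vol_det(2)[OF w h] cd power2_eq_square mult_ac)
  show ?thesis unfolding val[OF g(1)] val[OF g(2)] ..
qed

lemma S_vec_majorized:
  assumes \<mu>: "prob_space \<mu>" "sets \<mu> = sets borel" and geo: "geodesic_segment A w g" and t: "t \<in> {0..1}"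
  shows "S_vec A f \<mu> (g t) \<preceq> (1 - t) *\<^sub>R S_vec A f \<mu> (g 0) + t *\<^sub>R S_vec A f \<mu> (g 1)"
proof -
  have g: "g s \<in> metrics_vol A w" if "s \<in> {0..1}" for s
    using geo that by (auto simp: geodesic_segment_def smooth_path_in_def)
  note g01 = g[of 0, simplified] g[of 1, simplified] g[OF t]
  note int = S_vec_nth(1)[OF \<mu>]
  have S: "(\<Sum>i\<in>I. S_vec A f \<mu> (g s) $ i) = (\<integral>x. (\<Sum>i\<in>I. sigma_vec A (g s) f x $ i) \<partial>\<mu>)"
    if "s \<in> {0..1}" for s I
    using g[OF that] by (simp add: S_vec_nth(2)[OF \<mu>] int)
  have comb: "(\<Sum>i\<in>I. ((1 - t) *\<^sub>R S_vec A f \<mu> (g 0) + t *\<^sub>R S_vec A f \<mu> (g 1)) $ i)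
    = (\<integral>x. (1 - t) * (\<Sum>i\<in>I. sigma_vec A (g 0) f x $ i) + t * (\<Sum>i\<in>I. sigma_vec A (g 1) f x $ i) \<partial>\<mu>)" for I
  proof -
    have "(\<Sum>i\<in>I. ((1 - t) *\<^sub>R S_vec A f \<mu> (g 0) + t *\<^sub>R S_vec A f \<mu> (g 1)) $ i)
      = (1 - t) * (\<Sum>i\<in>I. S_vec A f \<mu> (g 0) $ i) + t * (\<Sum>i\<in>I. S_vec A f \<mu> (g 1) $ i)"
      by (simp add: sum.distrib sum_distrib_left)
    also have "\<dots> = (1 - t) * (\<integral>x. (\<Sum>i\<in>I. sigma_vec A (g 0) f x $ i) \<partial>\<mu>) + t * (\<integral>x. (\<Sum>i\<in>I. sigma_vec A (g 1) f x $ i) \<partial>\<mu>)"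
      using S[of 0 I] S[of 1 I] by simp
    also have "\<dots> = (\<integral>x. (1 - t) * (\<Sum>i\<in>I. sigma_vec A (g 0) f x $ i) + t * (\<Sum>i\<in>I. sigma_vec A (g 1) f x $ i) \<partial>\<mu>)"
      by (subst Bochner_Integration.integral_add) (auto intro!: integrable_mult_right Bochner_Integration.integrable_sum int g01)
    finally show ?thesis .
  qed
  have ap: "S_vec A f \<mu> (g s) $ j \<le> S_vec A f \<mu> (g s) $ i" if "s \<in> {0..1}" "i \<le> j" for s i j
    using S_vec_a_plus[OF \<mu> g[OF that(1)]] that(2) by (auto simp: a_plus_def)
  show ?thesis
    unfolding majorized_def
  proof (intro conjI allI)
    show "S_vec A f \<mu> (g t) \<in> a_plus" by (rule S_vec_a_plus[OF \<mu> g01(3)])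
    show "(1 - t) *\<^sub>R S_vec A f \<mu> (g 0) + t *\<^sub>R S_vec A f \<mu> (g 1) \<in> a_plus"
      using t by (auto simp: a_plus_def intro!: add_mono mult_left_mono ap)
    show "(\<Sum>i\<in>{..k}. S_vec A f \<mu> (g t) $ i) \<le> (\<Sum>i\<in>{..k}. ((1 - t) *\<^sub>R S_vec A f \<mu> (g 0) + t *\<^sub>R S_vec A f \<mu> (g 1)) $ i)" for k
      unfolding comb S[OF t]
      by (intro integral_mono Bochner_Integration.integrable_add integrable_mult_right Bochner_Integration.integrable_sum
          int g01 sigma_vec_convex[OF geo _ t]) (auto simp: down_closed_def)
    \<comment> \<open>The total is the same for all metrics with this volume form, and the weights
      \<open>1 - t\<close> and \<open>t\<close> add up to 1.\<close>
    show "(\<Sum>i\<in>UNIV. S_vec A f \<mu> (g t) $ i) = (\<Sum>i\<in>UNIV. ((1 - t) *\<^sub>R S_vec A f \<mu> (g 0) + t *\<^sub>R S_vec A f \<mu> (g 1)) $ i)"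
      unfolding comb S[OF t] sum_sigma_vec_UNIV[OF g01(1) g01(3)] sum_sigma_vec_UNIV[OF g01(2) g01(3)]
      by (simp add: algebra_simps)
  qed
qed

end

theorem theorem5p3:
  fixes A :: "('m::t2_space, 'n::{finite,linorder}) chart set"
    and f :: "'m \<Rightarrow> 'm"
    and \<mu> :: "'m measure"
    and \<omega> :: "('m, 'n) chart \<Rightarrow> 'm \<Rightarrow> real"
  assumes "compact (UNIV :: 'm set)" and "smooth_atlas A" and "orientable A"
    and "C1_diffeo A f"
    and "prob_space \<mu>" and "sets \<mu> = sets borel" and "distr \<mu> \<mu> f = \<mu>"
    and "volume_form A \<omega>"
  shows "(\<forall>g\<in>metrics_vol A \<omega>. integrable \<mu> (sigma_vec A g f)) \<and>
    continuous_map (subtopology (Cinf_topology A) (metrics_vol A \<omega>)) (top_of_set a_plus)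
      (S_vec A f \<mu>) \<and>
    (\<forall>g. geodesic_segment A \<omega> g \<longrightarrow>
      (\<forall>t\<in>{0..1}. S_vec A f \<mu> (g t) \<preceq> (1 - t) *\<^sub>R S_vec A f \<mu> (g 0) + t *\<^sub>R S_vec A f \<mu> (g 1)))"
proof -
  interpret diffeo A \<omega> f by unfold_locales fact+
  show ?thesis
    using integrable_sigma_vec continuous_map_S_vec S_vec_majorized assms(5,6) by blast
qed

end
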